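(* Assume that (1) the best alternative $\pi^*(c)=\arg\max_{k\in\mathcal K}F(k,c)$ is unique for all $c\in\mathcal C$; (2) the observation noise satisfies $\epsilon^n(k,c)\sim\mathcal N(0,\sigma^2(k,c))$ with known $\sigma^2(k,c)$, independent across $n,k,c$; (3) the GP prior is fixed across iterations; (4) for every $k\in\mathcal K$ the prior covariance matrix is strictly positive definite and diagonal, $\Sigma_0(\mathcal C,\mathcal C;k)=\mathrm{diag}([\Sigma_0(k,c)]_{c\in\mathcal C})$. Let $\hat p_n(k,c)$ be the fraction of the first $n$ samples that the GP-C-OCBA policy allocates to $(k,c)$, and let $$\hat\eta_n(k,c)=\frac{(F(\pi^*(c),c)-F(k,c))^2}{\sigma^2(\pi^*(c),c)/\hat p_n(\pi^*(c),c)+\sigma^2(k,c)/\hat p_n(k,c)}.$$ Then, almost surely as $n\to\infty$, $$\frac{\hat p_n(\pi^*(c),c)^2}{\sigma^2(\pi^*(c),c)}-\sum_{k\ne\pi^*(c)}\frac{\hat p_n(k,c)^2}{\sigma^2(k,c)}\to0\quad\text{for all }c\in\mathcal C,$$ $$\hat\eta_n(k,c)-\hat\eta_n(k',c)\to0\quad\text{for all }c\in\mathcal C\text{ and all distinct }k,k'\in\mathcal K\setminus\{\pi^*(c)\},$$ $$\hat\eta_n(k,c)-\hat\eta_n(k',c')\to0\quad\text{for all }c\ne c',\ k\ne\pi^*(c),\ k'\ne\pi^*(c').$$ In other words, $\hat p_n$ asymptotically satisfies the optimality conditions of the optimal static allocation ratio $p^*$, and $\hat p_n(k,c)\to p^*(k,c)$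 almost surely for all $(k,c)$.
   Context: Setting. $\mathcal K$ is a finite set of alternatives ($|\mathcal K|\ge 2$), $\mathcal C\subset\mathbb R^d$ is a finite nonempty set of contexts, $F:\mathcal K\times\mathcal C\to\mathbb R$ is a fixed unknown reward function. Sampling $(k,c)$ returns $F(k,c)+\epsilon^n(k,c)$ with noise variance $\sigma^2(k,c)>0$. Probabilities are with respect to the observation noise (with $F$ fixed). $N_n(k,c)$ is the number of the first $n$ samples allocated to $(k,c)$. Optimal static allocation ratio. $p^*=(p^*(k,c))_{k,c}$ is the maximizer, over $p(k,c)\ge0$ with $\sum_{k,c}p(k,c)=1$, of the large deviations rate $$\min_{c\in\mathcal C}\min_{k\ne\pi^*(c)}\frac{(F(\pi^*(c),c)-F(k,c))^2}{2\big(\sigma^2(\pi^*(c),c)/p(\pi^*(c),c)+\sigma^2(k,c)/p(k,c)\big)}.$$ With $\eta(k,c)=\frac{(F(\pi^*(c),c)-F(k,c))^2}{\sigma^2(\pi^*(c),c)/p^*(\pi^*(c),c)+\sigma^2(k,c)/p^*(k,c)}$, its optimality conditions are: $\frac{p^*(\pi^*(c),c)^2}{\sigma^2(\pi^*(c),c)}=\sum_{k\ne\pi^*(c)}\frac{p^*(k,c)^2}{\sigma^2(k,c)}$ for all $c$, and $\eta(k,c)$ takes the same value for all $c\in\mathcal C$, $k\neq\pi^*(c)$. Gaussian process (GP) model with diagonal prior. The prior for the reward of $(k,c)$ has mean $\mu_0(k,c)$ and variance $\Sigma_0(k,c)\in(0,\infty]$, with no correlation between contexts or alternatives. The posterior mean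 and variance after $n$ samples are $$\mu_n(k,c)=\frac{\mu_0(k,c)/\Sigma_0(k,c)+N_n(k,c)\overline Y_n(k,c)/\sigma^2(k,c)}{1/\Sigma_0(k,c)+N_n(k,c)/\sigma^2(k,c)},\qquad \Sigma_n(k,c)=\frac1{1/\Sigma_0(k,c)+N_n(k,c)/\sigma^2(k,c)},$$ where $\overline Y_n(k,c)$ is the average of the observations of $(k,c)$ so far. The value $\Sigma_0(k,c)=\infty$ (uninformative prior) means $1/\Sigma_0(k,c)=0$ in these formulas, in which case $(k,c)$ is assumed to receive at least one initial sample. The predicted best alternative is $\pi^n(c)=\arg\max_k\mu_n(k,c)$. GP-C-OCBA policy. Use a pre-determined rule to allocate $N_0$ initial samples to the alternatives. Then for $n=N_0,N_0+1,\dots$: compute $\mu_n,\Sigma_n,\pi^n$ and let $\hat p_n(k,c)=N_n(k,c)/n$. For all $c$ and $k\ne\pi^n(c)$ set $$\zeta(k,c)=\frac{(\mu_n(\pi^n(c),c)-\mu_n(k,c))^2}{\Sigma_n(\pi^n(c),c)+\Sigma_n(k,c)},\quad \psi^{(1)}(c)=\frac{\hat p_n(\pi^n(c),c)}{\Sigma_n(\pi^n(c),c)},\quad \psi^{(2)}(c)=\sum_{k\ne\pi^n(c)}\frac{\hat p_n(k,c)}{\Sigma_n(k,c)}.$$ Let $(\tilde k^*,\tilde c^* )$ minimize $\zeta(k,c)$ over $c\in\mathcal C$, $k\ne\pi^n(c)$. The next sample is drawn from $(\pi^n(\tilde c^* ),\tilde c^* )$ if $\psi^{(1)}(\tilde c^*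 )<\psi^{(2)}(\tilde c^* )$ and from $(\tilde k^*,\tilde c^* )$ otherwise. *)

theory Defs
  imports "HOL-Probability.Probability"
begin

text \<open>
  A pair \<open>(k, c)\<close> consists of an alternative \<open>k \<in> K\<close> and a context \<open>c \<in> C\<close>.
  Throughout, \<open>F\<close> is the reward function, \<open>v\<close> the noise variance \<open>\<sigma>\<^sup>2\<close>, and \<open>b\<close>
  assigns to each context the (true or predicted) best alternative.
\<close>

definition best_alt :: "('k \<times> 'c \<Rightarrow> real) \<Rightarrow> 'k set \<Rightarrow> 'c \<Rightarrow> 'k" where
  "best_alt F K c = arg_max_on (\<lambda>k. F (k, c)) K"

subsection \<open>Optimal static allocation\<close>

text \<open>
  The quotients \<open>v / p\<close> are \<open>\<infinity>\<close> when \<open>p = 0\<close>, which makes \<open>eta\<close> equal to 0.  This case is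
  treated separately because in HOL \<open>v / 0 = 0\<close>.
\<close>

definition eta ::
  "('k \<times> 'c \<Rightarrow> real) \<Rightarrow> ('k \<times> 'c \<Rightarrow> real) \<Rightarrow> ('c \<Rightarrow> 'k) \<Rightarrow> ('k \<times> 'c \<Rightarrow> real) \<Rightarrow> 'k \<Rightarrow> 'c \<Rightarrow> real" where
  "eta F v b p k c =
     (if p (b c, c) = 0 \<or> p (k, c) = 0 then 0
      else (F (b c, c) - F (k, c))\<^sup>2 / (v (b c, c) / p (b c, c) + v (k, c) / p (k, c)))"

definition ld_rate ::
  "('k \<times> 'c \<Rightarrow> real) \<Rightarrow> ('k \<times> 'c \<Rightarrow> real) \<Rightarrow> 'k set \<Rightarrow> 'c set \<Rightarrow> ('k \<times> 'c \<Rightarrow> real) \<Rightarrow> real" where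
  "ld_rate F v K C p =
     (MIN c\<in>C. MIN k\<in>K - {best_alt F K c}. eta F v (best_alt F K) p k c / 2)"

definition allocations :: "'k set \<Rightarrow> 'c set \<Rightarrow> ('k \<times> 'c \<Rightarrow> real) set" where
  "allocations K C = {p. (\<forall>z\<in>K \<times> C. 0 \<le> p z) \<and> (\<Sum>z\<in>K \<times> C. p z) = 1}"

definition optimal_allocation ::
  "('k \<times> 'c \<Rightarrow> real) \<Rightarrow> ('k \<times> 'c \<Rightarrow> real) \<Rightarrow> 'k set \<Rightarrow> 'c set \<Rightarrow> ('k \<times> 'c \<Rightarrow> real) \<Rightarrow> bool" where
  "optimal_allocation F v K C p \<longleftrightarrow>
     is_arg_max (ld_rate F v K C) (\<lambda>q. q \<in> allocations K C) p"

subsection \<open>Sample statistics and the Gaussian process posterior\<close>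

text \<open>
  A sample path is given by the sampled pairs \<open>x 0, x 1, \<dots>\<close> and the corresponding observations
  \<open>y 0, y 1, \<dots>\<close>; the first \<open>n\<close> samples are those with index \<open>i < n\<close>.
\<close>

definition num_samples :: "(nat \<Rightarrow> 'z) \<Rightarrow> nat \<Rightarrow> 'z \<Rightarrow> nat" where
  "num_samples x n z = card {i. i < n \<and> x i = z}"

definition sample_frac :: "(nat \<Rightarrow> 'z) \<Rightarrow> nat \<Rightarrow> 'z \<Rightarrow> real" where
  "sample_frac x n z = real (num_samples x n z) / real n"

definition sample_mean :: "(nat \<Rightarrow> 'z) \<Rightarrow> (nat \<Rightarrow> real) \<Rightarrow> nat \<Rightarrow> 'z \<Rightarrow> real" where
  "sample_mean x y n z = (\<Sum>i | i < n \<and> x i = z. y i) / real (num_samples x n z)"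

text \<open>The reciprocal of the prior variance \<open>\<Sigma>\<^sub>0 \<in> (0, \<infinity>]\<close>, which is 0 for \<open>\<Sigma>\<^sub>0 = \<infinity>\<close>.\<close>

definition prior_precision :: "('z \<Rightarrow> ennreal) \<Rightarrow> 'z \<Rightarrow> real" where
  "prior_precision \<Sigma>0 z = enn2real (1 / \<Sigma>0 z)"

definition post_mean ::
  "('z \<Rightarrow> real) \<Rightarrow> ('z \<Rightarrow> ennreal) \<Rightarrow> ('z \<Rightarrow> real) \<Rightarrow> (nat \<Rightarrow> 'z) \<Rightarrow> (nat \<Rightarrow> real) \<Rightarrow> nat \<Rightarrow> 'z \<Rightarrow> real" where
  "post_mean \<mu>0 \<Sigma>0 v x y n z =
     (\<mu>0 z * prior_precision \<Sigma>0 z + real (num_samples x n z) * sample_mean x y n z / v z) /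
     (prior_precision \<Sigma>0 z + real (num_samples x n z) / v z)"

definition post_var ::
  "('z \<Rightarrow> ennreal) \<Rightarrow> ('z \<Rightarrow> real) \<Rightarrow> (nat \<Rightarrow> 'z) \<Rightarrow> nat \<Rightarrow> 'z \<Rightarrow> real" where
  "post_var \<Sigma>0 v x n z = 1 / (prior_precision \<Sigma>0 z + real (num_samples x n z) / v z)"

subsection \<open>The GP-C-OCBA policy\<close>

definition zeta ::
  "('k \<times> 'c \<Rightarrow> real) \<Rightarrow> ('k \<times> 'c \<Rightarrow> real) \<Rightarrow> ('c \<Rightarrow> 'k) \<Rightarrow> 'k \<Rightarrow> 'c \<Rightarrow> real" where
  "zeta \<mu> S b k c = (\<mu> (b c, c) - \<mu> (k, c))\<^sup>2 / (S (b c, c) + S (k, c))"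

definition psi1 ::
  "('k \<times> 'c \<Rightarrow> real) \<Rightarrow> ('k \<times> 'c \<Rightarrow> real) \<Rightarrow> ('c \<Rightarrow> 'k) \<Rightarrow> 'c \<Rightarrow> real" where
  "psi1 p S b c = p (b c, c) / S (b c, c)"

definition psi2 ::
  "'k set \<Rightarrow> ('k \<times> 'c \<Rightarrow> real) \<Rightarrow> ('k \<times> 'c \<Rightarrow> real) \<Rightarrow> ('c \<Rightarrow> 'k) \<Rightarrow> 'c \<Rightarrow> real" where
  "psi2 K p S b c = (\<Sum>k\<in>K - {b c}. p (k, c) / S (k, c))"

text \<open>
  \<open>gp_c_ocba_next K C \<mu> S p z\<close>: given posterior means \<open>\<mu>\<close>, posterior variances \<open>S\<close> and sample
  fractions \<open>p\<close>, the policy may sample \<open>z\<close> next.  It is a relation because ties in the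
  maximization of \<open>\<mu>\<close> and in the minimization of \<open>zeta\<close> may be broken in any way.
\<close>

definition gp_c_ocba_next ::
  "'k set \<Rightarrow> 'c set \<Rightarrow> ('k \<times> 'c \<Rightarrow> real) \<Rightarrow> ('k \<times> 'c \<Rightarrow> real) \<Rightarrow> ('k \<times> 'c \<Rightarrow> real) \<Rightarrow> 'k \<times> 'c \<Rightarrow> bool" where
  "gp_c_ocba_next K C \<mu> S p z \<longleftrightarrow>
     (\<exists>b k c.
        (\<forall>c'\<in>C. is_arg_max (\<lambda>k'. \<mu> (k', c')) (\<lambda>k'. k' \<in> K) (b c')) \<and>
        is_arg_min (\<lambda>(k', c'). zeta \<mu> S b k' c')
          (\<lambda>(k', c'). c' \<in> C \<and> k' \<in> K \<and> k' \<noteq> b c') (k, c) \<and>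
        z = (if psi1 p S b c < psi2 K p S b c then (b c, c) else (k, c)))"

text \<open>The first \<open>N0\<close> samples are the initial ones.\<close>

definition gp_c_ocba_path ::
  "'k set \<Rightarrow> 'c set \<Rightarrow> ('k \<times> 'c \<Rightarrow> real) \<Rightarrow> ('k \<times> 'c \<Rightarrow> ennreal) \<Rightarrow> ('k \<times> 'c \<Rightarrow> real) \<Rightarrow> nat \<Rightarrow>
   (nat \<Rightarrow> 'k \<times> 'c) \<Rightarrow> (nat \<Rightarrow> real) \<Rightarrow> bool" where
  "gp_c_ocba_path K C \<mu>0 \<Sigma>0 v N0 x y \<longleftrightarrow>
     (\<forall>n\<ge>N0. gp_c_ocba_next K C (post_mean \<mu>0 \<Sigma>0 v x y n) (post_var \<Sigma>0 v x n)
               (sample_frac x n) (x n))"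

text \<open>
  The information available before sample \<open>n\<close> is drawn is contained in the sigma-algebra generated
  by the noise variables with index \<open>i < n\<close>.  Measurability of the \<open>n\<close>-th sampled pair with
  respect to it expresses that neither the rule for the initial samples nor the tie-breaking rule
  looks into the future.
\<close>

definition noise_history ::
  "'w measure \<Rightarrow> (nat \<Rightarrow> 'z \<Rightarrow> 'w \<Rightarrow> real) \<Rightarrow> 'z set \<Rightarrow> nat \<Rightarrow> 'w measure" where
  "noise_history M \<epsilon> D n =
     sigma (space M) {\<epsilon> i z -` B \<inter> space M | i z B. i < n \<and> z \<in> D \<and> B \<in> sets borel}"

end

theory Submission
  imports Defs
begin

text \<open>
  The noise sampled at the pairs forms independent streams of normal variables, since the choice of a
  pair does not look into the future; streams that are not exhausted are completed from an independent copy.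
  Two almost sure properties of these streams make the rest deterministic: the averages along each
  stream tend to 0, and at infinitely many scales \<open>m\<close> the averages of different streams, taken over any numbers
  of samples between \<open>m\<close> and \<open>L * m\<close>, are separated by a large multiple of \<open>1 / sqrt m\<close>.

  If some pair were sampled only finitely often, the minimal \<open>zeta\<close> would stay bounded, and in some context
  the policy would eventually sample only alternatives with exactly the same reward.  Their counts stay
  comparable by the \<open>\<psi>\<close>-test, so at a separated scale the lowest ones can neither become the predicted best
  nor have a bounded \<open>zeta\<close>, and all counts of that context get stuck.  Hence every pair is sampled infinitely often.

  Then the \<open>\<psi>\<close>-test balances the squares of the counts within a context up to a linear error.  The ratio of the count of
  an alternative to that of the best one increases only when that alternative minimizes \<open>zeta\<close>, which
  happens only while the ratio is at most its target value; together with the balance this forces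
  convergence of the ratios, and the same argument compares different contexts.
\<close>

subsection \<open>Sums of independent normal variables\<close>

text \<open>The law of large numbers settles convergence only after every pair is known to be
  sampled infinitely often. The obstacle is a tie: if the best alternative of a context were
  starved, the policy might keep comparing alternatives of exactly equal reward. Their posterior
  means differ by the order \<open>1 / sqrt m\<close>, just the order at which \<open>zeta\<close>
  stays bounded, so convergence of averages gives no contradiction. Fluctuations exceeding that
  order by any prescribed factor are needed, for all tied streams at once and over a whole range of
  counts, because the counts are random and depend on the noise. This dictates the windows
  \<open>{m..L * m}\<close>. The tied set is random as well, so the order in which the streams are
  separated is fixed in advance by an injective rank \<open>r\<close> on all pairs. The optimum is
  not found by differentiating the rate. A solution of the optimality conditions is constructed,
  shown to be the unique maximizer by convexity, and used as the target \<open>p\<close> on each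
  path. The three limits of the theorem are read off from the convergence to \<open>p\<close> by
  continuity.\<close>

context prob_space
begin

lemma indep_normal_sum_distributed:
  fixes W :: "'i \<Rightarrow> 'a \<Rightarrow> real"
  assumes "indep_vars (\<lambda>_. borel) W J" "finite I" "I \<noteq> {}" "I \<subseteq> J" "0 < \<sigma>"
    and "\<And>i. i \<in> J \<Longrightarrow> distributed M lborel (W i) (normal_density 0 \<sigma>)"
  shows "distributed M lborel (\<lambda>\<omega>. \<Sum>i\<in>I. W i \<omega>) (normal_density 0 (sqrt (card I) * \<sigma>))"
proof -
  have "distributed M lborel (\<lambda>\<omega>. \<Sum>i\<in>I. W i \<omega>) (normal_density (\<Sum>i\<in>I. 0) (sqrt (\<Sum>i\<in>I. \<sigma>\<^sup>2)))"
    using assms by (intro sum_indep_normal indep_vars_subset[OF assms(1)]) auto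
  then show ?thesis
    using assms(5) by (simp add: real_sqrt_mult)
qed

lemma indep_normal_sum_tail:
  fixes W :: "'i \<Rightarrow> 'a \<Rightarrow> real"
  assumes indep: "indep_vars (\<lambda>_. borel) W J" and I: "finite I" "I \<subseteq> J" and pos: "0 < \<sigma>" "0 < q"
    and norm: "\<And>i. i \<in> J \<Longrightarrow> distributed M lborel (W i) (normal_density 0 \<sigma>)"
  shows "prob {\<omega> \<in> space M. q < \<bar>\<Sum>i\<in>I. W i \<omega>\<bar>} \<le> real (card I) * \<sigma>\<^sup>2 / q\<^sup>2"
proof (cases "I = {}")
  case False
  define X where "X \<omega> = (\<Sum>i\<in>I. W i \<omega>)" for \<omega>
  define s where "s = sqrt (card I) * \<sigma>"
  have s: "0 < s"
    using False I pos by (simp add: s_def card_gt_0_iff)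
  have D: "distributed M lborel X (normal_density 0 s)"
    unfolding s_def X_def[abs_def] by (rule indep_normal_sum_distributed[OF indep I(1) False I(2) pos(1) norm])
  have X [measurable]: "X \<in> borel_measurable M"
    using distributed_measurable[OF D] by simp
  have E: "expectation X = 0"
    by (rule normal_distributed_expectation[OF s D])
  have V: "variance X = s\<^sup>2"
    by (rule normal_distributed_variance[OF s D])
  have int: "integrable M (\<lambda>\<omega>. (X \<omega>)\<^sup>2)"
    using integrable_normal_moment[OF s, of 0 2] distributed_integrable[OF D, of "\<lambda>x. x\<^sup>2"] by simp
  have "prob {\<omega> \<in> space M. q < \<bar>X \<omega>\<bar>} \<le> prob {\<omega> \<in> space M. q \<le> \<bar>X \<omega> - expectation X\<bar>}"
    by (intro finite_measure_mono) (auto simp: E)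
  also have "\<dots> \<le> s\<^sup>2 / q\<^sup>2"
    unfolding V[symmetric] by (rule Chebyshev_inequality) (use int pos in auto)
  finally show ?thesis
    by (simp add: X_def s_def power_mult_distrib)
qed (use pos in auto)

text \<open>
  The fourth moments of the averages are summable, hence so are almost surely the fourth powers
  of the averages.
\<close>

lemma indep_normal_averages_tendsto_0:
  fixes W :: "nat \<Rightarrow> 'a \<Rightarrow> real"
  assumes indep: "indep_vars (\<lambda>_. borel) W UNIV" and pos: "0 < \<sigma>"
    and norm: "\<And>i. distributed M lborel (W i) (normal_density 0 \<sigma>)"
  shows "AE \<omega> in M. (\<lambda>n. (\<Sum>i<n. W i \<omega>) / real n) \<longlonglongrightarrow> 0"
proof -
  define X where "X n \<omega> = (\<Sum>i<n. W i \<omega>)" for n \<omega>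
  have [measurable]: "W i \<in> borel_measurable M" for i
    using distributed_measurable[OF norm[of i]] by simp
  have X [measurable]: "X n \<in> borel_measurable M" for n
    unfolding X_def[abs_def] by measurable
  have moment: "(\<integral>\<^sup>+\<omega>. ennreal ((X n \<omega> / real n) ^ 4) \<partial>M) = ennreal (3 * \<sigma> ^ 4 * (1 / (real n)\<^sup>2))" for n
  \<comment> \<open>For \<open>n = 0\<close> both sides vanish because
    \<open>x / 0 = 0\<close>.\<close>
  proof (cases "n = 0")
    case False
    define s where "s = sqrt (real n) * \<sigma>"
    have s: "0 < s"
      using False pos by (simp add: s_def)
    have D: "distributed M lborel (X n) (normal_density 0 s)"
      unfolding s_def X_def[abs_def]
      using indep_normal_sum_distributed[OF indep finite_lessThan _ _ pos norm, of n] False by auto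
    \<comment> \<open>The fourth moment of a centred normal variable is three times the square of
      its variance, here \<open>n * \<sigma>\<^sup>2\<close>; dividing by \<open>n ^ 4\<close>
      leaves a multiple of \<open>1 / n\<^sup>2\<close>.\<close>
    have hb: "has_bochner_integral lborel (\<lambda>x. normal_density 0 s x * x ^ 4) (3 * s ^ 4)"
      using normal_moment_even[OF s, of 0 2] s by (simp add: fact_numeral power_divide field_simps)
    have int: "integrable M (\<lambda>\<omega>. X n \<omega> ^ 4)"
      using has_bochner_integral_iff[THEN iffD1, OF hb] distributed_integrable[OF D, of "\<lambda>x. x ^ 4"] by simp
    have "expectation (\<lambda>\<omega>. X n \<omega> ^ 4) = 3 * s ^ 4"
      using has_bochner_integral_iff[THEN iffD1, OF hb] distributed_integral[OF D, of "\<lambda>x. x ^ 4"] by simp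
    then have "(\<integral>\<^sup>+\<omega>. ennreal (X n \<omega> ^ 4 / real n ^ 4) \<partial>M) = ennreal (3 * s ^ 4 / real n ^ 4)"
      using int by (subst nn_integral_eq_integral) auto
    moreover have "s ^ 4 / real n ^ 4 = \<sigma> ^ 4 / (real n)\<^sup>2"
    proof -
      have "s ^ 4 = (s\<^sup>2)\<^sup>2" by simp
      also have "\<dots> = (real n)\<^sup>2 * \<sigma> ^ 4"
        by (simp add: s_def power_mult_distrib)
      finally show ?thesis
        using False by (simp add: power4_eq_xxxx power2_eq_square)
    qed
    ultimately show ?thesis
      by (simp add: power_divide)
  qed (simp add: X_def)
  have "summable (\<lambda>n. 3 * \<sigma> ^ 4 * (1 / (real n)\<^sup>2))"
    by (intro summable_mult) (use inverse_power_summable[of 2, where 'a=real] in \<open>simp add: inverse_eq_divide\<close>)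
  then have "(\<Sum>n. ennreal (3 * \<sigma> ^ 4 * (1 / (real n)\<^sup>2))) \<noteq> \<infinity>"
    by (simp add: ennreal_suminf_neq_top)
  then have "(\<integral>\<^sup>+\<omega>. (\<Sum>n. ennreal ((X n \<omega> / real n) ^ 4)) \<partial>M) \<noteq> \<infinity>"
    by (subst nn_integral_suminf) (auto simp: moment)
  then have "AE \<omega> in M. (\<Sum>n. ennreal ((X n \<omega> / real n) ^ 4)) \<noteq> \<infinity>"
    by (rule nn_integral_PInf_AE[rotated]) measurable
  then show ?thesis
  proof eventually_elim
    have root4: "root 4 (x ^ 4) = \<bar>x\<bar>" for x :: real
      using root_abs_power[of 4 x] by simp
    fix \<omega> assume "(\<Sum>n. ennreal ((X n \<omega> / real n) ^ 4)) \<noteq> \<infinity>"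
    then have "summable (\<lambda>n. (X n \<omega> / real n) ^ 4)"
      by (intro summable_suminf_not_top) auto
    then have "(\<lambda>n. (X n \<omega> / real n) ^ 4) \<longlonglongrightarrow> 0"
      by (rule summable_LIMSEQ_zero)
    then have "(\<lambda>n. root 4 ((X n \<omega> / real n) ^ 4)) \<longlonglongrightarrow> root 4 0"
      by (rule tendsto_real_root)
    then show "(\<lambda>n. (\<Sum>i<n. W i \<omega>) / real n) \<longlonglongrightarrow> 0"
      unfolding root4 X_def by (subst tendsto_rabs_zero_iff[symmetric]) simp
  qed
qed


text \<open>Ottaviani's argument: split according to the first passage above \<open>2 * q\<close>.\<close>

lemma indep_normal_maximal_inequality:
  fixes W :: "nat \<Rightarrow> 'a \<Rightarrow> real"
  assumes indep: "indep_vars (\<lambda>_. borel) W {a..<b}" and pos: "0 < \<sigma>" "0 < q"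
    and norm: "\<And>i. i \<in> {a..<b} \<Longrightarrow> distributed M lborel (W i) (normal_density 0 \<sigma>)"
    and q: "4 * (real (b - a) * \<sigma>\<^sup>2) \<le> q\<^sup>2"
  shows "prob {\<omega> \<in> space M. \<exists>n\<in>{a..b}. 2 * q < \<bar>\<Sum>i\<in>{a..<n}. W i \<omega>\<bar>} \<le> 1 / 2"
proof -
  define S where "S n \<omega> = (\<Sum>i\<in>{a..<n}. W i \<omega>)" for n \<omega>
  \<comment> \<open>\<open>A n\<close> is the first passage at time \<open>n\<close> and depends on
    the variables before \<open>n\<close> only; \<open>R n\<close> depends on those from
    \<open>n\<close> on. This makes the two independent.\<close>
  define A where "A n = {\<omega> \<in> space M. 2 * q < \<bar>S n \<omega>\<bar> \<and> (\<forall>k\<in>{a..<n}. \<bar>S k \<omega>\<bar> \<le> 2 * q)}" for n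
  define R where "R n = {\<omega> \<in> space M. \<bar>\<Sum>i\<in>{n..<b}. W i \<omega>\<bar> \<le> q}" for n
  have W: "W i \<in> borel_measurable M" if "i \<in> {a..<b}" for i
    using distributed_measurable[OF norm[OF that]] by simp
  have S [measurable]: "S n \<in> borel_measurable M" if "n \<le> b" for n
    unfolding S_def[abs_def] using that by (intro borel_measurable_sum W) auto
  have A [measurable]: "A n \<in> events" if "n \<le> b" for n
  proof -
    have "A n = {\<omega> \<in> space M. 2 * q < \<bar>S n \<omega>\<bar>} \<inter> {\<omega> \<in> space M. \<forall>k\<in>{a..<n}. \<bar>S k \<omega>\<bar> \<le> 2 * q}"
      by (auto simp: A_def)
    also have "\<dots> \<in> events"
      using that by (intro sets.Int sets.sets_Collect_finite_All borel_measurable_less borel_measurable_le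
          borel_measurable_abs borel_measurable_const S) auto
    finally show ?thesis .
  qed
  \<comment> \<open>The constant 4 in the assumption on \<open>q\<close> turns Chebyshev's bound
    into \<open>1 / 4\<close>, uniformly in the starting point \<open>n\<close>.\<close>
  have tail: "prob {\<omega> \<in> space M. q < \<bar>\<Sum>i\<in>{n..<b}. W i \<omega>\<bar>} \<le> 1 / 4" if "n \<in> {a..b}" for n
  proof -
    have "prob {\<omega> \<in> space M. q < \<bar>\<Sum>i\<in>{n..<b}. W i \<omega>\<bar>} \<le> real (card {n..<b}) * \<sigma>\<^sup>2 / q\<^sup>2"
      using that by (intro indep_normal_sum_tail[OF indep] pos norm) auto
    also have "\<dots> \<le> real (b - a) * \<sigma>\<^sup>2 / q\<^sup>2"
      using that pos by (intro divide_right_mono mult_right_mono) auto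
    also have "\<dots> \<le> 1 / 4"
      using q pos by (simp add: field_simps)
    finally show ?thesis .
  qed
  have AR: "prob (A n) * (3 / 4) \<le> prob (A n \<inter> R n)" if n: "n \<in> {a..b}" for n
  proof -
    let ?PA = "PiM {a..<n} (\<lambda>_. borel :: real measure)" and ?PB = "PiM {n..<b} (\<lambda>_. borel :: real measure)"
    define GA where "GA = {f \<in> space ?PA. 2 * q < \<bar>\<Sum>i\<in>{a..<n}. f i\<bar> \<and> (\<forall>k\<in>{a..<n}. \<bar>\<Sum>i\<in>{a..<k}. f i\<bar> \<le> 2 * q)}"
    define GB where "GB = {f \<in> space ?PB. \<bar>\<Sum>i\<in>{n..<b}. f i\<bar> \<le> q}"
    have sumA: "(\<lambda>f. \<Sum>i\<in>{a..<k}. f i) \<in> borel_measurable ?PA" if "k \<le> n" for k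
      using that by (intro borel_measurable_sum measurable_component_singleton) auto
    have GA: "GA \<in> sets ?PA"
    proof -
      have "GA = {f \<in> space ?PA. 2 * q < \<bar>\<Sum>i\<in>{a..<n}. f i\<bar>} \<inter>
          {f \<in> space ?PA. \<forall>k\<in>{a..<n}. \<bar>\<Sum>i\<in>{a..<k}. f i\<bar> \<le> 2 * q}"
        by (auto simp: GA_def)
      also have "\<dots> \<in> sets ?PA"
        by (intro sets.Int sets.sets_Collect_finite_All borel_measurable_less borel_measurable_le
            borel_measurable_abs borel_measurable_const sumA) auto
      finally show ?thesis .
    qed
    have GB: "GB \<in> sets ?PB"
      unfolding GB_def by measurable
    have ind: "indep_var ?PA (\<lambda>\<omega>. restrict (\<lambda>i. W i \<omega>) {a..<n}) ?PB (\<lambda>\<omega>. restrict (\<lambda>i. W i \<omega>) {n..<b})"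
      using n by (intro indep_var_restrict[OF indep]) auto
    have eqA: "(\<lambda>\<omega>. restrict (\<lambda>i. W i \<omega>) {a..<n}) -` GA \<inter> space M = A n"
      by (auto simp: GA_def A_def S_def space_PiM)
    have eqB: "(\<lambda>\<omega>. restrict (\<lambda>i. W i \<omega>) {n..<b}) -` GB \<inter> space M = R n"
      by (auto simp: GB_def R_def space_PiM)
    have "prob (A n \<inter> R n) = prob (A n) * prob (R n)"
      using indep_varD[OF ind GA GB] unfolding eqA[symmetric] eqB[symmetric]
      by (simp add: vimage_def Collect_conj_eq[symmetric] Int_def conj_ac)
    moreover have "3 / 4 \<le> prob (R n)"
    proof -
      have "{\<omega> \<in> space M. q < \<bar>\<Sum>i\<in>{n..<b}. W i \<omega>\<bar>} = space M - R n"
        by (auto simp: R_def)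
      moreover have "R n \<in> events"
        unfolding R_def using n by (intro borel_measurable_le borel_measurable_abs borel_measurable_sum W) auto
      ultimately show ?thesis
        using tail[OF n] by (simp add: prob_compl)
    qed
    ultimately show ?thesis
      using mult_left_mono[of "3 / 4" "prob (R n)" "prob (A n)"] by simp
  qed
  have less: "A m \<inter> A n = {}" if "a \<le> m" "m < n" for m n
  proof -
    have False if \<omega>: "\<omega> \<in> A m" "\<omega> \<in> A n" for \<omega>
    proof -
      have "\<bar>S m \<omega>\<bar> \<le> 2 * q"
        using \<omega>(2) \<open>a \<le> m\<close> \<open>m < n\<close> unfolding A_def by simp
      moreover have "2 * q < \<bar>S m \<omega>\<bar>"
        using \<omega>(1) unfolding A_def by simp
      ultimately show False by simp
    qed
    then show ?thesis by blast
  qed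
  have disj: "A m \<inter> A n = {}" if "m \<in> {a..b}" "n \<in> {a..b}" "m \<noteq> n" for m n
  proof (cases "m < n")
    case True then show ?thesis using less[of m n] that by simp
  next
    case False
    then have "A n \<inter> A m = {}"
      using less[of n m] that by simp
    then show ?thesis by blast
  qed
  have "{\<omega> \<in> space M. \<exists>n\<in>{a..b}. 2 * q < \<bar>S n \<omega>\<bar>} = (\<Union>n\<in>{a..b}. A n)"
  proof (intro set_eqI iffI)
    fix \<omega> assume *: "\<omega> \<in> {\<omega> \<in> space M. \<exists>n\<in>{a..b}. 2 * q < \<bar>S n \<omega>\<bar>}"
    define n where "n = (LEAST n. n \<in> {a..b} \<and> 2 * q < \<bar>S n \<omega>\<bar>)"
    have n: "n \<in> {a..b} \<and> 2 * q < \<bar>S n \<omega>\<bar>"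
      unfolding n_def by (rule LeastI_ex[where P = "\<lambda>n. n \<in> {a..b} \<and> 2 * q < \<bar>S n \<omega>\<bar>"]) (use * in blast)
    have "\<bar>S k \<omega>\<bar> \<le> 2 * q" if k: "k \<in> {a..<n}" for k
    proof -
      have "\<not> (k \<in> {a..b} \<and> 2 * q < \<bar>S k \<omega>\<bar>)"
        by (rule not_less_Least[where P = "\<lambda>n. n \<in> {a..b} \<and> 2 * q < \<bar>S n \<omega>\<bar>"]) (use k in \<open>unfold n_def[symmetric], simp\<close>)
      moreover have "k \<in> {a..b}"
        using k n by simp
      ultimately show ?thesis by simp
    qed
    then have "\<omega> \<in> A n"
      using * n unfolding A_def by simp
    then show "\<omega> \<in> (\<Union>n\<in>{a..b}. A n)"
      using n by blast
  next
    fix \<omega> assume "\<omega> \<in> (\<Union>n\<in>{a..b}. A n)"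
    then obtain n where "n \<in> {a..b}" "\<omega> \<in> A n"
      by blast
    then show "\<omega> \<in> {\<omega> \<in> space M. \<exists>n\<in>{a..b}. 2 * q < \<bar>S n \<omega>\<bar>}"
      unfolding A_def by blast
  qed
  moreover have "prob (\<Union>n\<in>{a..b}. A n) = (\<Sum>n\<in>{a..b}. prob (A n))"
  proof (rule finite_measure_finite_Union)
    show "disjoint_family_on A {a..b}"
      using disj by (simp add: disjoint_family_on_def)
    show "A ` {a..b} \<subseteq> events"
      using A by (intro image_subsetI) simp
  qed simp
  \<comment> \<open>On the intersection of \<open>A n\<close> and \<open>R n\<close> the whole sum
    still exceeds \<open>q\<close>, and first passages at different times are disjoint. The total is
    thus at most \<open>1 / 3\<close>, below the claimed \<open>1 / 2\<close>.\<close>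
  moreover have "(\<Sum>n\<in>{a..b}. prob (A n)) * (3 / 4) \<le> 1 / 4"
  proof -
    have R [measurable]: "R n \<in> events" if "n \<in> {a..b}" for n
      unfolding R_def using that by (intro borel_measurable_le borel_measurable_abs borel_measurable_sum W) auto
    have "(\<Sum>n\<in>{a..b}. prob (A n)) * (3 / 4) \<le> (\<Sum>n\<in>{a..b}. prob (A n \<inter> R n))"
      unfolding sum_distrib_right by (intro sum_mono AR)
    also have "\<dots> = prob (\<Union>n\<in>{a..b}. A n \<inter> R n)"
    proof (rule finite_measure_finite_Union[symmetric])
      show "disjoint_family_on (\<lambda>n. A n \<inter> R n) {a..b}"
        unfolding disjoint_family_on_def using disj by blast
      show "(\<lambda>n. A n \<inter> R n) ` {a..b} \<subseteq> events"
        using A R by (intro image_subsetI sets.Int) simp_all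
    qed simp
    also have "\<dots> \<le> prob {\<omega> \<in> space M. q < \<bar>\<Sum>i\<in>{a..<b}. W i \<omega>\<bar>}"
    proof (rule finite_measure_mono)
      show "(\<Union>n\<in>{a..b}. A n \<inter> R n) \<subseteq> {\<omega> \<in> space M. q < \<bar>\<Sum>i\<in>{a..<b}. W i \<omega>\<bar>}"
      proof
        fix \<omega> assume "\<omega> \<in> (\<Union>n\<in>{a..b}. A n \<inter> R n)"
        then obtain n where "n \<in> {a..b}" "\<omega> \<in> A n" "\<omega> \<in> R n"
          by blast
        then have "\<omega> \<in> space M" "2 * q < \<bar>S n \<omega>\<bar>" "\<bar>\<Sum>i\<in>{n..<b}. W i \<omega>\<bar> \<le> q"
          unfolding A_def R_def by blast+
        moreover have "(\<Sum>i\<in>{a..<b}. W i \<omega>) = S n \<omega> + (\<Sum>i\<in>{n..<b}. W i \<omega>)"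
          using \<open>n \<in> {a..b}\<close> by (simp add: S_def sum.atLeastLessThan_concat)
        ultimately have "q < \<bar>\<Sum>i\<in>{a..<b}. W i \<omega>\<bar>"
          by linarith
        then show "\<omega> \<in> {\<omega> \<in> space M. q < \<bar>\<Sum>i\<in>{a..<b}. W i \<omega>\<bar>}"
          using \<open>\<omega> \<in> space M\<close> by simp
      qed
      show "{\<omega> \<in> space M. q < \<bar>\<Sum>i\<in>{a..<b}. W i \<omega>\<bar>} \<in> events"
        by (intro borel_measurable_less borel_measurable_abs borel_measurable_sum W) auto
    qed
    also have "\<dots> \<le> 1 / 4"
    proof (cases "a \<le> b")
      case True then show ?thesis using tail[of a] by simp
    qed (use pos in simp)
    finally show ?thesis .
  qed
  ultimately have "prob {\<omega> \<in> space M. \<exists>n\<in>{a..b}. 2 * q < \<bar>S n \<omega>\<bar>} * (3 / 4) \<le> 1 / 4"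
    by simp
  then show ?thesis
    unfolding S_def by linarith
qed

end

subsection \<open>Separation of averages at infinitely many scales\<close>

text \<open>Only entries with index from \<open>l\<close> to below \<open>L * m\<close> enter, so
  windows on disjoint index blocks are independent. The omitted first \<open>l\<close> entries are
  left to the law of large numbers: with \<open>m = 4 * l\<^sup>2\<close> a sum of size at most
  \<open>l\<close> is half of \<open>sqrt m\<close>. The second condition keeps the sum near its
  level at every count up to \<open>L * m\<close>.\<close>

definition in_window :: "'z set \<Rightarrow> ('z \<Rightarrow> real) \<Rightarrow> real \<Rightarrow> nat \<Rightarrow> nat \<Rightarrow> nat \<Rightarrow> ('z \<times> nat \<Rightarrow> real) \<Rightarrow> bool" where
  "in_window Z c q L l m f \<longleftrightarrow> (\<forall>z\<in>Z.
     (c z * sqrt m \<le> (\<Sum>i\<in>{l..<m}. f (z, i)) \<and> (\<Sum>i\<in>{l..<m}. f (z, i)) \<le> (c z + 1) * sqrt m) \<and>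
     (\<forall>n\<in>{m..L * m}. \<bar>\<Sum>i\<in>{m..<n}. f (z, i)\<bar> \<le> q * sqrt m))"

lemma in_window_cong:
  assumes "0 < L" "\<And>z i. z \<in> Z \<Longrightarrow> l \<le> i \<Longrightarrow> i < L * m \<Longrightarrow> f (z, i) = g (z, i)" "l \<le> m"
  shows "in_window Z c q L l m f \<longleftrightarrow> in_window Z c q L l m g"
proof -
  have m: "m \<le> L * m"
    using assms(1) by simp
  have "(\<Sum>i\<in>{l..<m}. f (z, i)) = (\<Sum>i\<in>{l..<m}. g (z, i))" if "z \<in> Z" for z
    using that by (intro sum.cong assms(2)) (auto intro: less_le_trans[OF _ m])
  moreover have "(\<Sum>i\<in>{m..<n}. f (z, i)) = (\<Sum>i\<in>{m..<n}. g (z, i))" if "z \<in> Z" "n \<in> {m..L * m}" for z n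
    using that assms(3) by (intro sum.cong assms(2)) auto
  ultimately show ?thesis
    unfolding in_window_def by (intro ball_cong refl conj_cong) simp_all
qed

lemma in_window_measurable:
  assumes "finite Z" "l \<le> m" "m \<le> L * m" "Z \<times> {l..<L * m} \<subseteq> J"
  shows "{f \<in> space (PiM J (\<lambda>_. borel)). in_window Z c q L l m f} \<in> sets (PiM J (\<lambda>_. borel))"
proof -
  have sum: "(\<lambda>f. \<Sum>i\<in>{a..<b}. f (z, i)) \<in> borel_measurable (PiM J (\<lambda>_. borel :: real measure))"
    if "z \<in> Z" "l \<le> a" "b \<le> L * m" for z a b
    using that assms(4) by (intro borel_measurable_sum measurable_component_singleton) auto
  show ?thesis
    unfolding in_window_def using assms
    by (intro sets.sets_Collect_finite_All sets.sets_Collect_conj borel_measurable_le borel_measurable_abs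
        borel_measurable_const sum) auto
qed

context prob_space
begin

lemma indep_vars_row:
  assumes "indep_vars (\<lambda>_. N) W (Z \<times> UNIV)" "z \<in> Z"
  shows "indep_vars (\<lambda>_. N) (\<lambda>i. W (z, i)) A"
proof -
  have "indep_vars (\<lambda>i. PiM {(z, i)} (\<lambda>_. N)) (\<lambda>i \<omega>. restrict (\<lambda>j. W j \<omega>) {(z, i)}) A"
    using assms(2) by (intro indep_vars_restrict[OF assms(1)]) (auto simp: disjoint_family_on_def)
  then have "indep_vars (\<lambda>_. N) (\<lambda>i \<omega>. restrict (\<lambda>j. W j \<omega>) {(z, i)} (z, i)) A"
    by (rule indep_vars_compose2) (rule measurable_component_singleton, simp)
  then show ?thesis
    by simp
qed

text \<open>The interval has length \<open>sqrt m\<close>, and the density on it is at least a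
  constant times \<open>1 / sqrt m\<close>; so the bound does not depend on the scale.\<close>

lemma normal_interval_prob:
  fixes m n :: nat
  assumes D: "distributed M lborel X (normal_density 0 (sqrt n * \<sigma>))"
    and m: "0 < m" "m \<le> 2 * n" "n \<le> m" and pos: "0 < \<sigma>" "0 \<le> c"
  shows "exp (- ((c + 1)\<^sup>2 / \<sigma>\<^sup>2)) / (sqrt (2 * pi) * \<sigma>)
           \<le> prob {\<omega> \<in> space M. c * sqrt m \<le> X \<omega> \<and> X \<omega> \<le> (c + 1) * sqrt m}"
proof -
  define A where "A = {c * sqrt m .. (c + 1) * sqrt m}"
  \<comment> \<open>\<open>K\<close> bounds the density from below on \<open>A\<close>:
    \<open>m \<le> 2 * n\<close> controls the exponent and \<open>n \<le> m\<close> the normalizing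
    factor.\<close>
  define K where "K = exp (- ((c + 1)\<^sup>2 / \<sigma>\<^sup>2)) / (sqrt (2 * pi * (m * \<sigma>\<^sup>2)))"
  have K: "0 \<le> K"
    unfolding K_def by simp
  have density: "K \<le> normal_density 0 (sqrt n * \<sigma>) x" if x: "x \<in> A" for x
  proof -
    have n: "0 < real n"
      using m by simp
    have "0 \<le> x"
      using x pos by (auto simp: A_def intro: order_trans[of _ "c * sqrt m"])
    then have "x\<^sup>2 \<le> ((c + 1) * sqrt m)\<^sup>2"
      using x by (intro power_mono) (auto simp: A_def)
    also have "\<dots> = (c + 1)\<^sup>2 * m"
      by (simp add: power_mult_distrib)
    also have "\<dots> \<le> (c + 1)\<^sup>2 * (2 * n)"
      using m by (intro mult_left_mono) auto
    finally have "x\<^sup>2 / (2 * (n * \<sigma>\<^sup>2)) \<le> (c + 1)\<^sup>2 / \<sigma>\<^sup>2"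
      using pos n by (simp add: field_simps)
    then have "exp (- ((c + 1)\<^sup>2 / \<sigma>\<^sup>2)) \<le> exp (- (x\<^sup>2 / (2 * (n * \<sigma>\<^sup>2))))"
      by simp
    moreover have "sqrt (2 * pi * (n * \<sigma>\<^sup>2)) \<le> sqrt (2 * pi * (m * \<sigma>\<^sup>2))"
      using m pos by (intro real_sqrt_le_mono mult_left_mono mult_right_mono) auto
    ultimately have "K \<le> exp (- (x\<^sup>2 / (2 * (n * \<sigma>\<^sup>2)))) / sqrt (2 * pi * (n * \<sigma>\<^sup>2))"
      unfolding K_def using pos n by (intro frac_le) auto
    then show ?thesis
      by (simp add: normal_density_def power_mult_distrib)
  qed
  have "ennreal (K * sqrt m) = ennreal K * emeasure lborel A"
    using K by (simp add: A_def algebra_simps ennreal_mult)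
  also have "\<dots> = (\<integral>\<^sup>+x. ennreal K * indicator A x \<partial>lborel)"
    by (subst nn_integral_cmult_indicator) (auto simp: A_def)
  also have "\<dots> \<le> (\<integral>\<^sup>+x. ennreal (normal_density 0 (sqrt n * \<sigma>) x) * indicator A x \<partial>lborel)"
    using density by (intro nn_integral_mono) (auto simp: indicator_def intro!: ennreal_leI)
  also have "\<dots> = emeasure M (X -` A \<inter> space M)"
    by (rule distributed_emeasure[OF D, symmetric]) (auto simp: A_def)
  also have "X -` A \<inter> space M = {\<omega> \<in> space M. c * sqrt m \<le> X \<omega> \<and> X \<omega> \<le> (c + 1) * sqrt m}"
    by (auto simp: A_def)
  finally have "K * sqrt m \<le> prob {\<omega> \<in> space M. c * sqrt m \<le> X \<omega> \<and> X \<omega> \<le> (c + 1) * sqrt m}"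
    by (simp add: emeasure_eq_measure)
  moreover have "K * sqrt m = exp (- ((c + 1)\<^sup>2 / \<sigma>\<^sup>2)) / (sqrt (2 * pi) * \<sigma>)"
    using m pos by (simp add: K_def real_sqrt_mult)
  ultimately show ?thesis
    by simp
qed

text \<open>Each stream has to meet two conditions on disjoint blocks, one bounded below by
  \<open>normal_interval_prob\<close>, the other by the maximal inequality; independence multiplies
  the bounds. What matters later is that \<open>\<delta>\<close> is the same for all
  \<open>l\<close> and \<open>m\<close>.\<close>

lemma in_window_prob:
  fixes W :: "'z \<times> nat \<Rightarrow> 'a \<Rightarrow> real"
  assumes indep: "indep_vars (\<lambda>_. borel) W (Z \<times> UNIV)" and Z: "finite Z" "Z \<noteq> {}"
    and norm: "\<And>z i. z \<in> Z \<Longrightarrow> distributed M lborel (W (z, i)) (normal_density 0 (\<sigma> z))"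
    and pos: "\<And>z. z \<in> Z \<Longrightarrow> 0 < \<sigma> z" "\<And>z. z \<in> Z \<Longrightarrow> 0 \<le> c z" "0 < q"
    and q: "\<And>z. z \<in> Z \<Longrightarrow> 16 * (real L * (\<sigma> z)\<^sup>2) \<le> q\<^sup>2"
  shows "\<exists>\<delta>>0. \<forall>l m. 0 < m \<longrightarrow> 2 * l \<le> m \<longrightarrow>
           \<delta> \<le> prob {\<omega> \<in> space M. in_window Z c q L l m (\<lambda>i. W i \<omega>)}"
proof -
  define \<delta>1 where "\<delta>1 z = exp (- ((c z + 1)\<^sup>2 / (\<sigma> z)\<^sup>2)) / (sqrt (2 * pi) * \<sigma> z)" for z
  \<comment> \<open>In an index \<open>(z, b)\<close>, \<open>True\<close> stands for the level
    reached over \<open>{l..<m}\<close> and \<open>False\<close> for the bounded excursion over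
    \<open>{m..<L * m}\<close>.\<close>
  define \<delta> where "\<delta> = (\<Prod>j\<in>Z \<times> UNIV. if snd j then \<delta>1 (fst j) else 1 / 2)"
  have "0 < \<delta>"
    unfolding \<delta>_def \<delta>1_def using pos(1) by (intro prod_pos) auto
  moreover have "\<delta> \<le> prob {\<omega> \<in> space M. in_window Z c q L l m (\<lambda>i. W i \<omega>)}" if m: "0 < m" "2 * l \<le> m" for l m
  proof -
    define I where "I j = (if snd j then {fst j} \<times> {l..<m} else {fst j} \<times> {m..<L * m})" for j :: "'z \<times> bool"
    define P where "P j f \<longleftrightarrow>
      (if snd j then c (fst j) * sqrt m \<le> (\<Sum>i\<in>{l..<m}. f (fst j, i)) \<and> (\<Sum>i\<in>{l..<m}. f (fst j, i)) \<le> (c (fst j) + 1) * sqrt m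
       else (\<forall>n\<in>{m..L * m}. \<bar>\<Sum>i\<in>{m..<n}. f (fst j, i)\<bar> \<le> q * sqrt m))" for j and f :: "'z \<times> nat \<Rightarrow> real"
    define E where "E j = {\<omega> \<in> space M. P j (\<lambda>i. W i \<omega>)}" for j
    have W: "W (z, i) \<in> borel_measurable M" if "z \<in> Z" for z i
      using distributed_measurable[OF norm[OF that]] by simp
    have ind: "indep_vars (\<lambda>j. PiM (I j) (\<lambda>_. borel)) (\<lambda>j \<omega>. restrict (\<lambda>i. W i \<omega>) (I j)) (Z \<times> UNIV)"
      by (rule indep_vars_restrict[OF indep]) (auto simp: I_def disjoint_family_on_def split: if_splits)
    have restr: "P j (restrict f (I j)) = P j f" for j f
    proof -
      have sum: "(\<Sum>i\<in>A. restrict f (I j) (fst j, i)) = (\<Sum>i\<in>A. f (fst j, i))" if "{fst j} \<times> A \<subseteq> I j" for A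
        using that by (intro sum.cong) auto
      show ?thesis
      proof (cases "snd j")
        case True
        then have "{fst j} \<times> {l..<m} \<subseteq> I j"
          by (simp add: I_def)
        then show ?thesis
          using True by (simp add: P_def sum del: restrict_apply)
      next
        case False
        then have eq: "(\<Sum>i\<in>{m..<n}. restrict f (I j) (fst j, i)) = (\<Sum>i\<in>{m..<n}. f (fst j, i))"
          if "n \<in> {m..L * m}" for n
          using that by (intro sum) (auto simp: I_def)
        have "(\<forall>n\<in>{m..L * m}. \<bar>\<Sum>i\<in>{m..<n}. restrict f (I j) (fst j, i)\<bar> \<le> q * sqrt m) \<longleftrightarrow>
            (\<forall>n\<in>{m..L * m}. \<bar>\<Sum>i\<in>{m..<n}. f (fst j, i)\<bar> \<le> q * sqrt m)"
          by (intro ball_cong refl) (simp only: eq)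
        then show ?thesis
          using False by (simp add: P_def del: restrict_apply)
      qed
    qed
    have "indep_events (\<lambda>j. {\<omega> \<in> space M. P j (restrict (\<lambda>i. W i \<omega>) (I j))}) (Z \<times> UNIV)"
    proof (rule indep_eventsI_indep_vars[OF ind])
      fix j :: "'z \<times> bool" assume "j \<in> Z \<times> UNIV"
      have sum: "(\<lambda>f. \<Sum>i\<in>A. f (fst j, i)) \<in> borel_measurable (PiM (I j) (\<lambda>_. borel :: real measure))"
        if "{fst j} \<times> A \<subseteq> I j" for A
        using that by (intro borel_measurable_sum measurable_component_singleton) auto
      show "{f \<in> space (PiM (I j) (\<lambda>_. borel)). P j f} \<in> sets (PiM (I j) (\<lambda>_. borel))"
      proof (cases "snd j")
        case True
        then show ?thesis
          unfolding P_def using True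
          by (simp, intro sets.sets_Collect_conj borel_measurable_le borel_measurable_const sum) (auto simp: I_def)
      next
        case False
        then show ?thesis
          unfolding P_def using False
          by (simp, intro sets.sets_Collect_finite_All borel_measurable_le borel_measurable_abs
              borel_measurable_const sum) (auto simp: I_def)
      qed
    qed
    then have "indep_events E (Z \<times> UNIV)"
      unfolding restr E_def .
    then have "prob (\<Inter>j\<in>Z \<times> UNIV. E j) = (\<Prod>j\<in>Z \<times> UNIV. prob (E j))"
      using Z unfolding indep_events_def by simp
    also have "\<dots> \<ge> \<delta>"
      unfolding \<delta>_def
    proof (rule prod_mono, safe)
      fix z b assume z: "z \<in> Z"
      show "0 \<le> (if snd (z, b) then \<delta>1 (fst (z, b)) else 1 / 2)"
        using pos(1)[OF z] by (auto simp: \<delta>1_def)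
      note indz = indep_vars_row[OF indep z]
      show "(if snd (z, b) then \<delta>1 (fst (z, b)) else 1 / 2) \<le> prob (E (z, b))"
      proof (cases b)
        case True
        have "distributed M lborel (\<lambda>\<omega>. \<Sum>i\<in>{l..<m}. W (z, i) \<omega>) (normal_density 0 (sqrt (card {l..<m}) * \<sigma> z))"
          using z m by (intro indep_normal_sum_distributed[OF indz[of UNIV]] pos norm) auto
        then have D: "distributed M lborel (\<lambda>\<omega>. \<Sum>i\<in>{l..<m}. W (z, i) \<omega>) (normal_density 0 (sqrt (m - l) * \<sigma> z))"
          by simp
        have "\<delta>1 z \<le> prob {\<omega> \<in> space M. c z * sqrt m \<le> (\<Sum>i\<in>{l..<m}. W (z, i) \<omega>) \<and> (\<Sum>i\<in>{l..<m}. W (z, i) \<omega>) \<le> (c z + 1) * sqrt m}"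
          unfolding \<delta>1_def by (rule normal_interval_prob[OF D]) (use z m pos in auto)
        then show ?thesis
          using True by (simp add: E_def P_def)
      next
        case False
        \<comment> \<open>The maximal inequality is applied at \<open>q * sqrt m / 2\<close>; its
          factor 4 and the square of this halving account for the constant 16.\<close>
        have "prob {\<omega> \<in> space M. \<exists>n\<in>{m..L * m}. 2 * (q * sqrt m / 2) < \<bar>\<Sum>i\<in>{m..<n}. W (z, i) \<omega>\<bar>} \<le> 1 / 2"
        proof (rule indep_normal_maximal_inequality[OF indz])
          have "4 * (real (L * m - m) * (\<sigma> z)\<^sup>2) \<le> 4 * (real (L * m) * (\<sigma> z)\<^sup>2)"
            by (intro mult_left_mono mult_right_mono of_nat_mono) auto
          also have "\<dots> = (16 * (real L * (\<sigma> z)\<^sup>2)) * (real m / 4)"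
            by simp
          also have "\<dots> \<le> q\<^sup>2 * (real m / 4)"
            using q[OF z] by (intro mult_right_mono) auto
          finally show "4 * (real (L * m - m) * (\<sigma> z)\<^sup>2) \<le> (q * sqrt m / 2)\<^sup>2"
            by (simp add: power_mult_distrib power_divide)
        qed (use z m pos norm in auto)
        moreover have "{\<omega> \<in> space M. \<exists>n\<in>{m..L * m}. 2 * (q * sqrt m / 2) < \<bar>\<Sum>i\<in>{m..<n}. W (z, i) \<omega>\<bar>} = space M - E (z, False)"
          by (auto simp: E_def P_def not_le)
        moreover have "E (z, False) \<in> events"
          using \<open>indep_events E (Z \<times> UNIV)\<close> z by (auto simp: indep_events_def)
        ultimately show ?thesis
          using False by (simp add: prob_compl)
      qed
    qed
    also have "(\<Inter>j\<in>Z \<times> UNIV. E j) = {\<omega> \<in> space M. in_window Z c q L l m (\<lambda>i. W i \<omega>)}"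
    proof -
      have "in_window Z c q L l m f \<longleftrightarrow> (\<forall>j\<in>Z \<times> UNIV. P j f)" for f
        unfolding in_window_def P_def by (auto simp: all_bool_eq)
      then show ?thesis
        using Z(2) by (auto simp: E_def)
    qed
    finally show ?thesis .
  qed
  ultimately show ?thesis
    by blast
qed

end

text \<open>Scale \<open>s\<close> uses \<open>l = window_start L s\<close> and
  \<open>m = 4 * l\<^sup>2\<close>. The next start is \<open>L * m\<close>, so the index blocks of
  successive scales are adjacent and disjoint, and \<open>sqrt m = 2 * l\<close> makes the entries
  before a block harmless.\<close>

primrec window_start :: "nat \<Rightarrow> nat \<Rightarrow> nat" where
  "window_start L 0 = 1"
| "window_start L (Suc s) = L * (4 * (window_start L s)\<^sup>2)"

lemma window_start_le: "window_start L s \<le> 4 * (window_start L s)\<^sup>2"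
  by (simp add: power2_eq_square)

lemma window_start_pos: "0 < L \<Longrightarrow> 0 < window_start L s"
  by (induction s) auto

lemma window_start_less:
  assumes "0 < L"
  shows "window_start L s < window_start L (Suc s)"
proof -
  let ?l = "window_start L s"
  have "?l < 4 * ?l\<^sup>2"
    using window_start_pos[OF assms, of s] by (simp add: power2_eq_square)
  also have "\<dots> \<le> L * (4 * ?l\<^sup>2)"
    using assms by simp
  finally show ?thesis
    by simp
qed

lemma strict_mono_window_start: "0 < L \<Longrightarrow> strict_mono (window_start L)"
  using window_start_less by (simp add: strict_mono_Suc_iff)

context prob_space
begin

text \<open>Windows at successive scales live on disjoint blocks and have probability at least
  \<open>\<delta>\<close>. So infinitely many occur with probability at least
  \<open>\<delta>\<close>, hence with probability 1 by the zero-one law for independent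
  events.\<close>

lemma in_window_infinitely_often:
  fixes W :: "'z \<times> nat \<Rightarrow> 'a \<Rightarrow> real"
  assumes indep: "indep_vars (\<lambda>_. borel) W (Z \<times> UNIV)" and Z: "finite Z" "Z \<noteq> {}"
    and norm: "\<And>z i. z \<in> Z \<Longrightarrow> distributed M lborel (W (z, i)) (normal_density 0 (\<sigma> z))"
    and pos: "\<And>z. z \<in> Z \<Longrightarrow> 0 < \<sigma> z" "\<And>z. z \<in> Z \<Longrightarrow> 0 \<le> c z" "0 < q" "0 < L"
    and q: "\<And>z. z \<in> Z \<Longrightarrow> 16 * (real L * (\<sigma> z)\<^sup>2) \<le> q\<^sup>2"
  shows "AE \<omega> in M. \<exists>\<^sub>\<infinity>s. in_window Z c q L (window_start L s) (4 * (window_start L s)\<^sup>2) (\<lambda>i. W i \<omega>)"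
proof -
  let ?l = "window_start L"
  define m where "m s = 4 * (?l s)\<^sup>2" for s
  define E where "E s = {\<omega> \<in> space M. in_window Z c q L (?l s) (m s) (\<lambda>i. W i \<omega>)}" for s
  define I where "I s = Z \<times> {?l s..<L * m s}" for s
  have l: "0 < ?l s" "?l s \<le> m s" "m s \<le> L * m s" "2 * ?l s \<le> m s" "0 < m s" for s
    using window_start_pos[OF pos(4), of s] window_start_le[of L s] pos(4)
    by (auto simp: m_def power2_eq_square)
  have "disjoint_family I"
  proof -
    have "I s \<inter> I t = {}" if "s < t" for s t
    proof -
      have "L * m s = ?l (Suc s)"
        by (simp add: m_def)
      also have "\<dots> \<le> ?l t"
        using that by (intro strict_mono_leD[OF strict_mono_window_start[OF pos(4)]]) simp
      finally show ?thesis
        by (auto simp: I_def)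
    qed
    then have "I s \<inter> I t = {}" if "s \<noteq> t" for s t
      using that by (cases "s < t") (auto simp: Int_commute[of "I s"] not_less le_less)
    then show ?thesis
      by (simp add: disjoint_family_on_def)
  qed
  then have ind: "indep_vars (\<lambda>s. PiM (I s) (\<lambda>_. borel)) (\<lambda>s \<omega>. restrict (\<lambda>i. W i \<omega>) (I s)) UNIV"
    by (rule indep_vars_restrict[OF indep, rotated]) (auto simp: I_def)
  have restr: "in_window Z c q L (?l s) (m s) (restrict f (I s)) = in_window Z c q L (?l s) (m s) f" for f s
    using l by (intro in_window_cong pos) (auto simp: I_def)
  have "indep_events (\<lambda>s. {\<omega> \<in> space M. in_window Z c q L (?l s) (m s) (restrict (\<lambda>i. W i \<omega>) (I s))}) UNIV"
    by (rule indep_eventsI_indep_vars[OF ind], rule in_window_measurable) (use l Z in \<open>auto simp: I_def\<close>)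
  then have indE: "indep_events E UNIV"
    unfolding restr E_def .
  then have E [measurable]: "E s \<in> events" for s
    by (auto simp: indep_events_def)
  obtain \<delta> where \<delta>: "0 < \<delta>" "\<And>l m. 0 < m \<Longrightarrow> 2 * l \<le> m \<Longrightarrow> \<delta> \<le> prob {\<omega> \<in> space M. in_window Z c q L l m (\<lambda>i. W i \<omega>)}"
    using in_window_prob[of W Z \<sigma> c q L, OF indep Z norm pos(1) pos(2) pos(3) q] by blast
  have "(\<lambda>n. prob (\<Union>s\<in>{n..}. E s)) \<longlonglongrightarrow> prob (\<Inter>n. \<Union>s\<in>{n..}. E s)"
    by (intro finite_Lim_measure_decseq antimonoI UN_mono image_subsetI sets.countable_UN) auto
  moreover have "\<delta> \<le> prob (\<Union>s\<in>{n..}. E s)" for n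
  proof -
    have "\<delta> \<le> prob (E n)"
      unfolding E_def using l by (intro \<delta>) auto
    also have "\<dots> \<le> prob (\<Union>s\<in>{n..}. E s)"
      by (intro finite_measure_mono) auto
    finally show ?thesis .
  qed
  ultimately have "\<delta> \<le> prob (\<Inter>n. \<Union>s\<in>{n..}. E s)"
    by (intro LIMSEQ_le_const) auto
  then have "prob (\<Inter>n. \<Union>s\<in>{n..}. E s) = 1"
    using borel_0_1_law[OF indE] \<delta>(1) by auto
  then have "AE \<omega> in M. \<omega> \<in> (\<Inter>n. \<Union>s\<in>{n..}. E s)"
    by (subst (asm) prob_eq_1) auto
  then show ?thesis
    by eventually_elim (auto simp: INFM_nat_le E_def m_def)
qed

end

text \<open>
  The levels \<open>c\<close> grow geometrically with ratio \<open>L\<close>, so that dividing the sums by counts that differ by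
  a factor of at most \<open>L\<close> preserves the order.
\<close>

lemma in_window_separated:
  fixes f :: "'z \<times> nat \<Rightarrow> real"
  assumes win: "in_window Z c q L l m f" and m: "m = 4 * l\<^sup>2" and l: "0 < l" and L: "0 < L"
    and init: "\<And>z. z \<in> Z \<Longrightarrow> \<bar>\<Sum>i<l. f (z, i)\<bar> \<le> real l" and z: "z \<in> Z" "z' \<in> Z"
    and c: "1 + q \<le> c z" "0 \<le> c z'" "0 \<le> q" "h + c z' + 2 + q \<le> (c z - 1 - q) / L"
    and n: "n \<in> {m..L * m}" "n' \<in> {m..L * m}"
  shows "h / sqrt m \<le> (\<Sum>i<n. f (z, i)) / n - (\<Sum>i<n'. f (z', i)) / n'"
proof -
  have sq: "sqrt m = 2 * l" "0 < sqrt m" "sqrt m * sqrt m = m"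
    using l by (simp_all add: m real_sqrt_mult power2_eq_square)
  have lm: "l \<le> m" "0 < m"
    using l by (simp_all add: m power2_eq_square)
  have split: "(\<Sum>i<k. f (x, i)) = (\<Sum>i<l. f (x, i)) + (\<Sum>i\<in>{l..<m}. f (x, i)) + (\<Sum>i\<in>{m..<k}. f (x, i))"
    if "m \<le> k" for x k
    using that lm by (simp add: lessThan_atLeast0 sum.atLeastLessThan_concat)
  have w: "c x * sqrt m \<le> (\<Sum>i\<in>{l..<m}. f (x, i))" "(\<Sum>i\<in>{l..<m}. f (x, i)) \<le> (c x + 1) * sqrt m"
    "\<bar>\<Sum>i\<in>{m..<k}. f (x, i)\<bar> \<le> q * sqrt m" "\<bar>\<Sum>i<l. f (x, i)\<bar> \<le> sqrt m"
    if "x \<in> Z" "k \<in> {m..L * m}" for x k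
    using win init[OF that(1)] that sq unfolding in_window_def by auto
  \<comment> \<open>In units of \<open>sqrt m\<close>, the first \<open>l\<close> entries cost at
    most 1 and the excursion at most \<open>q\<close>. The worst denominator is \<open>L * m\<close>
    for the higher stream \<open>z\<close>, and \<open>m\<close> for the lower stream
    \<open>z'\<close>.\<close>
  have "(c z - 1 - q) * sqrt m \<le> (\<Sum>i<n. f (z, i))"
    using w[OF z(1) n(1)] split[of n z] n(1) by (simp add: algebra_simps)
  then have "(c z - 1 - q) * sqrt m / n \<le> (\<Sum>i<n. f (z, i)) / n"
    by (rule divide_right_mono) simp
  moreover have "(c z - 1 - q) * sqrt m / (L * m) \<le> (c z - 1 - q) * sqrt m / n"
    using n(1) lm c(1) L by (intro divide_left_mono mult_nonneg_nonneg) (auto simp: of_nat_mult[symmetric] simp del: of_nat_mult)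
  moreover have "(c z - 1 - q) * sqrt m / (L * m) = (c z - 1 - q) / L / sqrt m"
  proof -
    have "sqrt m / m = 1 / sqrt m"
      using sq(2) lm(2) by (simp add: field_simps)
    then have "(c z - 1 - q) / L * (sqrt m / m) = (c z - 1 - q) / L * (1 / sqrt m)"
      by simp
    then show ?thesis
      by simp
  qed
  moreover have "(\<Sum>i<n'. f (z', i)) \<le> (c z' + 2 + q) * sqrt m"
    using w[OF z(2) n(2)] split[of n' z'] n(2) by (simp add: algebra_simps)
  then have "(\<Sum>i<n'. f (z', i)) / n' \<le> (c z' + 2 + q) * sqrt m / n'"
    by (rule divide_right_mono) simp
  moreover have "(c z' + 2 + q) * sqrt m / n' \<le> (c z' + 2 + q) * sqrt m / m"
    using n(2) lm c by (intro divide_left_mono mult_nonneg_nonneg) auto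
  moreover have "(c z' + 2 + q) * sqrt m / m = (c z' + 2 + q) / sqrt m"
  proof -
    have "sqrt m / m = 1 / sqrt m"
      using sq(2) lm(2) by (simp add: field_simps)
    then have "(c z' + 2 + q) * (sqrt m / m) = (c z' + 2 + q) * (1 / sqrt m)"
      by simp
    then show ?thesis
      by simp
  qed
  moreover have "(h + c z' + 2 + q) / sqrt m \<le> (c z - 1 - q) / L / sqrt m"
    using c(4) sq by (intro divide_right_mono) auto
  ultimately show ?thesis
    by (simp add: add_divide_distrib diff_divide_distrib)
qed

text \<open>A smaller rank means a higher average. The two counts range over the window
  independently, since the actual counts are not known in advance. \<open>L\<close>,
  \<open>h\<close> and \<open>m0\<close> are naturals so that these quantifiers commute with "almost
  surely".\<close>

definition averages_separated :: "'z set \<Rightarrow> ('z \<Rightarrow> nat) \<Rightarrow> ('z \<times> nat \<Rightarrow> real) \<Rightarrow> bool" where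
  "averages_separated Z r f \<longleftrightarrow> (\<forall>(L :: nat) (h :: nat) (m0 :: nat). \<exists>m\<ge>m0. \<forall>z\<in>Z. \<forall>z'\<in>Z. r z < r z' \<longrightarrow>
     (\<forall>n\<in>{m..L * m}. \<forall>n'\<in>{m..L * m}.
        h / sqrt m \<le> (\<Sum>i<n. f (z, i)) / n - (\<Sum>i<n'. f (z', i)) / n'))"

context prob_space
begin

lemma averages_separated_infinitely_often:
  fixes W :: "'z \<times> nat \<Rightarrow> 'a \<Rightarrow> real" and r :: "'z \<Rightarrow> nat"
  assumes indep: "indep_vars (\<lambda>_. borel) W (Z \<times> UNIV)" and Z: "finite Z" "Z \<noteq> {}"
    and norm: "\<And>z i. z \<in> Z \<Longrightarrow> distributed M lborel (W (z, i)) (normal_density 0 (\<sigma> z))"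
    and pos: "\<And>z. z \<in> Z \<Longrightarrow> 0 < \<sigma> z"
    and lln: "AE \<omega> in M. \<forall>z\<in>Z. (\<lambda>n. (\<Sum>i<n. W (z, i) \<omega>) / real n) \<longlonglongrightarrow> 0"
  shows "AE \<omega> in M. averages_separated Z r (\<lambda>i. W i \<omega>)"
  unfolding averages_separated_def AE_all_countable
proof (intro allI)
  fix L h m0 :: nat
  \<comment> \<open>\<open>Suc\<close> makes the factor positive also for
    \<open>L = 0\<close>.\<close>
  define L' where "L' = Suc L"
  \<comment> \<open>A single \<open>q\<close> serves all streams: it dominates every
    \<open>16 * (L' * (\<sigma> z)\<^sup>2)\<close>, and \<open>1 \<le> q\<close> gives
    \<open>q \<le> q\<^sup>2\<close>.\<close>
  define q where "q = 1 + (\<Sum>z\<in>Z. 16 * (real L' * (\<sigma> z)\<^sup>2))"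
  have q1: "1 \<le> q"
    unfolding q_def by (simp add: sum_nonneg)
  have q2: "16 * (real L' * (\<sigma> z)\<^sup>2) \<le> q\<^sup>2" if "z \<in> Z" for z
  proof -
    have "16 * (real L' * (\<sigma> z)\<^sup>2) \<le> q"
      using member_le_sum[OF that, of "\<lambda>z. 16 * (real L' * (\<sigma> z)\<^sup>2)"] Z(1) by (simp add: q_def)
    also have "\<dots> \<le> q\<^sup>2"
      using q1 by (simp add: power2_eq_square)
    finally show ?thesis .
  qed
  \<comment> \<open>The recursion solves
    \<open>h + \<gamma> i + 2 + q = (\<gamma> (Suc i) - 1 - q) / L'\<close>, the gap between levels
    demanded by \<open>in_window_separated\<close>.\<close>
  define \<gamma> where "\<gamma> = rec_nat (1 + q) (\<lambda>_ x. 1 + q + real L' * (real h + x + 2 + q))"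
  have \<gamma>0: "\<gamma> 0 = 1 + q" and \<gamma>Suc: "\<gamma> (Suc i) = 1 + q + real L' * (real h + \<gamma> i + 2 + q)" for i
    by (simp_all add: \<gamma>_def)
  have \<gamma>ge: "1 + q \<le> \<gamma> i" for i
    by (induction i) (use q1 in \<open>auto simp: \<gamma>0 \<gamma>Suc\<close>)
  have "\<gamma> i \<le> \<gamma> (Suc i)" for i
  proof -
    have "1 * \<gamma> i \<le> real L' * (real h + \<gamma> i + 2 + q)"
      using \<gamma>ge[of i] q1 by (intro mult_mono) (auto simp: L'_def)
    then show ?thesis
      using q1 unfolding \<gamma>Suc by simp
  qed
  then have mono: "mono \<gamma>"
    by (simp add: mono_iff_le_Suc)
  define R where "R = Max (r ` Z)"
  \<comment> \<open>\<open>R - r z\<close> reverses the order, so that the smallest rank receives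
    the highest level.\<close>
  define c where "c z = \<gamma> (R - r z)" for z
  have R: "r z \<le> R" if "z \<in> Z" for z
    unfolding R_def using that Z by (intro Max_ge) auto
  have c0: "0 \<le> c z" for z
    using \<gamma>ge[of "R - r z"] q1 by (simp add: c_def)
  have L': "0 < L'"
    by (simp add: L'_def)
  have "AE \<omega> in M. \<exists>\<^sub>\<infinity>s. in_window Z c q L' (window_start L' s) (4 * (window_start L' s)\<^sup>2) (\<lambda>i. W i \<omega>)"
    using q1 q2 L' c0 by (intro in_window_infinitely_often[OF indep Z norm pos]) auto
  with lln show "AE \<omega> in M. \<exists>m\<ge>m0. \<forall>z\<in>Z. \<forall>z'\<in>Z. r z < r z' \<longrightarrow>
     (\<forall>n\<in>{m..L * m}. \<forall>n'\<in>{m..L * m}.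
        h / sqrt m \<le> (\<Sum>i<n. W (z, i) \<omega>) / n - (\<Sum>i<n'. W (z', i) \<omega>) / n')"
  proof eventually_elim
    fix \<omega>
    let ?f = "\<lambda>i. W i \<omega>" and ?l = "window_start L'"
    assume lim: "\<forall>z\<in>Z. (\<lambda>n. (\<Sum>i<n. W (z, i) \<omega>) / real n) \<longlonglongrightarrow> 0"
      and win: "\<exists>\<^sub>\<infinity>s. in_window Z c q L' (?l s) (4 * (?l s)\<^sup>2) ?f"
    have "\<forall>\<^sub>F n in sequentially. \<bar>\<Sum>i<n. W (z, i) \<omega>\<bar> \<le> real n" if "z \<in> Z" for z
    proof -
      have "\<forall>\<^sub>F n in sequentially. \<bar>(\<Sum>i<n. W (z, i) \<omega>) / real n\<bar> < 1"
        using lim that tendsto_rabs_zero order_tendstoD(2)[of _ 0 sequentially 1] by (metis zero_less_one)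
      then show ?thesis
        using eventually_gt_at_top[of 0] by eventually_elim (simp add: field_simps)
    qed
    then have "\<forall>\<^sub>F n in sequentially. \<forall>z\<in>Z. \<bar>\<Sum>i<n. W (z, i) \<omega>\<bar> \<le> real n"
      using Z(1) by (simp add: eventually_ball_finite)
    then obtain n0 where n0: "\<And>n z. n0 \<le> n \<Longrightarrow> z \<in> Z \<Longrightarrow> \<bar>\<Sum>i<n. W (z, i) \<omega>\<bar> \<le> real n"
      unfolding eventually_sequentially by blast
    obtain s where s: "max m0 n0 \<le> s" and ws: "in_window Z c q L' (?l s) (4 * (?l s)\<^sup>2) ?f"
      using win unfolding INFM_nat_le by blast
    have ls: "s \<le> ?l s"
      by (rule strict_mono_imp_increasing[OF strict_mono_window_start[OF L']])
    define m where "m = 4 * (?l s)\<^sup>2"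
    have "m0 \<le> m"
      using s ls window_start_le[of L' s] unfolding m_def by linarith
    moreover have "h / sqrt m \<le> (\<Sum>i<n. W (z, i) \<omega>) / n - (\<Sum>i<n'. W (z', i) \<omega>) / n'"
      if z: "z \<in> Z" "z' \<in> Z" "r z < r z'" and n: "n \<in> {m..L * m}" "n' \<in> {m..L * m}" for z z' n n'
    proof (rule in_window_separated[where f = ?f and Z = Z and c = c and q = q and L = L' and l = "?l s"])
      show "in_window Z c q L' (?l s) m ?f"
        using ws by (simp add: m_def)
      show "\<bar>\<Sum>i<?l s. W (x, i) \<omega>\<bar> \<le> real (?l s)" if "x \<in> Z" for x
        using that s ls by (intro n0) auto
      have "\<gamma> (Suc (R - r z')) \<le> c z"
        unfolding c_def using z R[OF z(1)] R[OF z(2)] by (intro monoD[OF mono]) linarith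
      then have "real L' * (real h + c z' + 2 + q) \<le> c z - 1 - q"
        unfolding \<gamma>Suc c_def by linarith
      then show "real h + c z' + 2 + q \<le> (c z - 1 - q) / L'"
        using L' by (simp add: field_simps)
      show "1 + q \<le> c z"
        by (simp add: c_def \<gamma>ge)
      show "n \<in> {m..L' * m}" "n' \<in> {m..L' * m}"
        using n by (auto simp: L'_def)
    qed (use z q1 L' c0 window_start_pos[OF L'] in \<open>auto simp: m_def\<close>)
    ultimately show "\<exists>m\<ge>m0. \<forall>z\<in>Z. \<forall>z'\<in>Z. r z < r z' \<longrightarrow>
     (\<forall>n\<in>{m..L * m}. \<forall>n'\<in>{m..L * m}.
        h / sqrt m \<le> (\<Sum>i<n. W (z, i) \<omega>) / n - (\<Sum>i<n'. W (z', i) \<omega>) / n')"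
      by blast
  qed
qed

end

subsection \<open>Streams of sampled noise\<close>

lemma num_samples_0 [simp]: "num_samples x 0 z = 0"
  by (simp add: num_samples_def)

lemma num_samples_Suc: "num_samples x (Suc n) z = num_samples x n z + (if x n = z then 1 else 0)"
proof -
  have "{i. i < Suc n \<and> x i = z} = {i. i < n \<and> x i = z} \<union> (if x n = z then {n} else {})"
    by (auto simp: less_Suc_eq)
  then show ?thesis
    by (simp add: num_samples_def card_insert_if)
qed

lemma num_samples_mono: "m \<le> n \<Longrightarrow> num_samples x m z \<le> num_samples x n z"
  by (rule lift_Suc_mono_le) (auto simp: num_samples_Suc)

lemma num_samples_le: "num_samples x n z \<le> n"
  by (induction n) (auto simp: num_samples_Suc)

text \<open>Entry \<open>(z, m)\<close> is the noise of the sample of \<open>z\<close> that is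
  preceded by exactly \<open>m\<close> samples of \<open>z\<close>, so entries are counted from 0.
  If there is no such sample, \<open>LEAST\<close> gives an unspecified index; \<open>table\<close>
  replaces these entries.\<close>

definition stream_value :: "(nat \<Rightarrow> 'z) \<Rightarrow> (nat \<Rightarrow> real) \<Rightarrow> 'z \<times> nat \<Rightarrow> real" where
  "stream_value x e j = e (LEAST i. x i = fst j \<and> num_samples x i (fst j) = snd j)"

lemma stream_value_eq:
  assumes "x i = z" "num_samples x i z = m"
  shows "stream_value x e (z, m) = e i"
proof -
  have "(LEAST i. x i = z \<and> num_samples x i z = m) = i"
  proof (rule Least_equality)
    fix j assume j: "x j = z \<and> num_samples x j z = m"
    show "i \<le> j"
    proof (rule ccontr)
      assume "\<not> i \<le> j"
      then have "num_samples x (Suc j) z \<le> num_samples x i z"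
        by (intro num_samples_mono) auto
      then show False
        using j assms by (simp add: num_samples_Suc)
    qed
  qed (use assms in auto)
  then show ?thesis
    by (simp add: stream_value_def)
qed

lemma less_num_samples_iff: "m < num_samples x n z \<longleftrightarrow> (\<exists>i<n. x i = z \<and> num_samples x i z = m)"
proof (induction n)
  case (Suc n)
  then show ?case
    using less_Suc_eq by (auto simp: num_samples_Suc)
qed simp

lemma sum_stream_value:
  "(\<Sum>i<num_samples x n z. stream_value x e (z, i)) = (\<Sum>i | i < n \<and> x i = z. e i)"
proof (induction n)
  case (Suc n)
  have "{i. i < Suc n \<and> x i = z} = {i. i < n \<and> x i = z} \<union> (if x n = z then {n} else {})"
    by (auto simp: less_Suc_eq)
  then show ?case
    using Suc stream_value_eq[of x n z "num_samples x n z" e] by (simp add: num_samples_Suc)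
qed simp

locale adaptive_sampling = prob_space M for M :: "'w measure" +
  fixes \<epsilon> :: "nat \<Rightarrow> 'z \<Rightarrow> 'w \<Rightarrow> real" and D :: "'z set" and X :: "nat \<Rightarrow> 'w \<Rightarrow> 'z" and law :: "'z \<Rightarrow> real measure"
  assumes D: "finite D" "D \<noteq> {}"
    and noise [measurable]: "\<And>n z. z \<in> D \<Longrightarrow> \<epsilon> n z \<in> borel_measurable M"
    and law: "\<And>n z. z \<in> D \<Longrightarrow> distr M borel (\<epsilon> n z) = law z"
    and indep: "indep_vars (\<lambda>_. borel) (\<lambda>(n, z). \<epsilon> n z) (UNIV \<times> D)"
    and nonanticipating: "\<And>n. X n \<in> measurable (noise_history M \<epsilon> D n) (count_space D)"
begin

abbreviation "H \<equiv> noise_history M \<epsilon> D"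
abbreviation "sampled \<omega> \<equiv> \<lambda>i. X i \<omega>"
abbreviation "sampled_noise \<omega> \<equiv> \<lambda>i. \<epsilon> i (X i \<omega>) \<omega>"
abbreviation "counts n z \<omega> \<equiv> num_samples (sampled \<omega>) n z"

lemma space_H [simp]: "space (H n) = space M"
  by (simp add: noise_history_def space_measure_of_conv)

lemma sets_H: "sets (H n) = sigma_sets (space M) {\<epsilon> i z -` B \<inter> space M | i z B. i < n \<and> z \<in> D \<and> B \<in> sets borel}"
  unfolding noise_history_def by (rule sets_measure_of) auto

lemma sets_H_subset: "sets (H n) \<subseteq> sets M"
  unfolding sets_H by (rule sets.sigma_sets_subset) auto

lemma sets_H_mono: "m \<le> n \<Longrightarrow> sets (H m) \<subseteq> sets (H n)"
  unfolding sets_H by (rule sigma_sets_mono') (auto intro: less_le_trans)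

lemma measurable_H: "m \<le> n \<Longrightarrow> f \<in> measurable (H m) N \<Longrightarrow> f \<in> measurable (H n) N"
  using sets_H_mono[of m n] by (auto simp: measurable_def)

lemma measurable_H_M: "f \<in> measurable (H m) N \<Longrightarrow> f \<in> measurable M N"
  using sets_H_subset by (auto simp: measurable_def)

lemma noise_H: "i < n \<Longrightarrow> z \<in> D \<Longrightarrow> \<epsilon> i z \<in> borel_measurable (H n)"
proof (rule measurableI)
  fix B assume "i < n" "z \<in> D" "B \<in> sets (borel :: real measure)"
  then have "\<epsilon> i z -` B \<inter> space M \<in> {\<epsilon> i z -` B \<inter> space M | i z B. i < n \<and> z \<in> D \<and> B \<in> sets borel}"
    by blast
  then show "\<epsilon> i z -` B \<inter> space (H n) \<in> sets (H n)"
    unfolding sets_H space_H by (rule sigma_sets.Basic)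
qed simp

lemma X_H: "i \<le> n \<Longrightarrow> X i \<in> measurable (H n) (count_space D)"
  using measurable_H[OF _ nonanticipating] .

lemma X_in: "\<omega> \<in> space M \<Longrightarrow> X i \<omega> \<in> D"
  using measurable_space[OF nonanticipating[of i]] by simp

lemma X_eq_H: "i \<le> n \<Longrightarrow> {\<omega> \<in> space M. X i \<omega> = z} \<in> sets (H n)"
proof -
  assume "i \<le> n"
  then have "X i -` ({z} \<inter> D) \<inter> space (H n) \<in> sets (H n)"
    by (intro measurable_sets[OF X_H]) auto
  also have "X i -` ({z} \<inter> D) \<inter> space (H n) = {\<omega> \<in> space M. X i \<omega> = z}"
    using X_in by auto
  finally show ?thesis .
qed

text \<open>The bound is \<open>Suc n\<close> because the count over \<open>n + 1\<close> samples
  involves only \<open>X 0\<close> to \<open>X n\<close>, and \<open>X n\<close> is determined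
  before the noise at time \<open>n\<close> is drawn.\<close>

lemma count_H: "i \<le> Suc n \<Longrightarrow> {\<omega> \<in> space M. counts i z \<omega> = m} \<in> sets (H n)"
proof (induction i arbitrary: m)
  case 0
  show ?case
    using sets.top[of "H n"] sets.empty_sets[of "H n"] by (cases m) auto
next
  case (Suc i)
  have X: "{\<omega> \<in> space M. X i \<omega> = z} \<in> sets (H n)"
    using Suc.prems by (intro X_eq_H) simp
  have eq: "{\<omega> \<in> space M. counts (Suc i) z \<omega> = m} =
      ({\<omega> \<in> space M. X i \<omega> = z} \<inter> (if m = 0 then {} else {\<omega> \<in> space M. counts i z \<omega> = m - 1})) \<union>
      ({\<omega> \<in> space M. counts i z \<omega> = m} - {\<omega> \<in> space M. X i \<omega> = z})"
    by (auto simp: num_samples_Suc split: if_splits)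
  show ?case
    unfolding eq using X Suc by (intro sets.Un sets.Int sets.Diff) auto
qed

lemma count_less_H: "{\<omega> \<in> space M. m < counts n z \<omega>} \<in> sets (H n)"
proof -
  have "{\<omega> \<in> space M. m < counts n z \<omega>} = (\<Union>k\<in>{m<..}. {\<omega> \<in> space M. counts n z \<omega> = k})"
    by auto
  then show ?thesis
    by (simp, intro sets.countable_UN') (auto intro: count_H)
qed

lemma filled_H:
  assumes "B \<in> sets borel" "z \<in> D"
  shows "{\<omega> \<in> space M. m < counts n z \<omega> \<and> stream_value (sampled \<omega>) (sampled_noise \<omega>) (z, m) \<in> B} \<in> sets (H n)"
proof -
  have "{\<omega> \<in> space M. m < counts n z \<omega> \<and> stream_value (sampled \<omega>) (sampled_noise \<omega>) (z, m) \<in> B} =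
      (\<Union>i<n. {\<omega> \<in> space M. X i \<omega> = z} \<inter> {\<omega> \<in> space M. counts i z \<omega> = m} \<inter> (\<epsilon> i z -` B \<inter> space (H n)))"
    by (auto simp: less_num_samples_iff stream_value_eq)
  also have "\<dots> \<in> sets (H n)"
    using assms by (intro sets.finite_UN sets.Int X_eq_H count_H measurable_sets[OF noise_H]) auto
  finally show ?thesis .
qed

text \<open>The generators of \<open>H n\<close> are noise events at times below \<open>n\<close>.
  Grouping these apart from the single variable \<open>\<epsilon> n z\<close> and passing to
  generated sigma-algebras preserves independence.\<close>

lemma indep_history:
  assumes "A \<in> sets (H n)" "B \<in> sets borel" "z \<in> D"
  shows "prob (A \<inter> (\<epsilon> n z -` B \<inter> space M)) = prob A * prob (\<epsilon> n z -` B \<inter> space M)"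
proof -
  define E where "E j = {(case j of (n, z) \<Rightarrow> \<epsilon> n z) -` B \<inter> space M | B. B \<in> sets (borel :: real measure)}" for j :: "nat \<times> 'z"
  define I where "I b = (if b then {..<n} \<times> D else {(n, z)})" for b
  have "indep_sets E (UNIV \<times> D)"
    using indep unfolding indep_vars_def2 E_def by simp
  then have "indep_sets E (\<Union>b\<in>UNIV. I b)"
    by (rule indep_sets_mono_index[rotated]) (use assms in \<open>auto simp: I_def split: if_splits\<close>)
  moreover have "Int_stable (E j)" for j
  proof (rule Int_stableI)
    fix a b assume "a \<in> E j" "b \<in> E j"
    then obtain A B where "a = (case j of (n, z) \<Rightarrow> \<epsilon> n z) -` A \<inter> space M" "b = (case j of (n, z) \<Rightarrow> \<epsilon> n z) -` B \<inter> space M"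
      "A \<in> sets borel" "B \<in> sets borel"
      unfolding E_def by blast
    then have "a \<inter> b = (case j of (n, z) \<Rightarrow> \<epsilon> n z) -` (A \<inter> B) \<inter> space M" "A \<inter> B \<in> sets borel"
      by auto
    then show "a \<inter> b \<in> E j"
      unfolding E_def by blast
  qed
  moreover have "disjoint_family_on I UNIV"
    by (auto simp: disjoint_family_on_def I_def)
  ultimately have "indep_sets (\<lambda>b. sigma_sets (space M) (\<Union>j\<in>I b. E j)) UNIV"
    by (rule indep_sets_collect_sigma)
  then have "prob (\<Inter>b\<in>UNIV. (if b then A else \<epsilon> n z -` B \<inter> space M)) =
      (\<Prod>b\<in>UNIV. prob (if b then A else \<epsilon> n z -` B \<inter> space M))"
  proof (rule indep_setsD)
    show "\<forall>b\<in>UNIV. (if b then A else \<epsilon> n z -` B \<inter> space M) \<in> sigma_sets (space M) (\<Union>j\<in>I b. E j)"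
    proof
      fix b :: bool
      have "{\<epsilon> i z -` B \<inter> space M | i z B. i < n \<and> z \<in> D \<and> B \<in> sets borel} \<subseteq> (\<Union>j\<in>I True. E j)"
      proof safe
        fix i z B assume "i < n" "z \<in> D" "B \<in> sets (borel :: real measure)"
        then have "(i, z) \<in> I True" "\<epsilon> i z -` B \<inter> space M \<in> E (i, z)"
          by (auto simp: I_def E_def)
        then show "\<epsilon> i z -` B \<inter> space M \<in> (\<Union>j\<in>I True. E j)"
          by blast
      qed
      then have "sets (H n) \<subseteq> sigma_sets (space M) (\<Union>j\<in>I True. E j)"
        unfolding sets_H by (rule sigma_sets_mono')
      moreover have "\<epsilon> n z -` B \<inter> space M \<in> sigma_sets (space M) (\<Union>j\<in>I False. E j)"
        using assms by (intro sigma_sets.Basic) (auto simp: I_def E_def)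
      ultimately show "(if b then A else \<epsilon> n z -` B \<inter> space M) \<in> sigma_sets (space M) (\<Union>j\<in>I b. E j)"
        using assms(1) by auto
    qed
  qed auto
  then show ?thesis
    by (simp add: UNIV_bool Int_commute mult.commute)
qed

text \<open>\<open>indep_history\<close> is the case of an indicator; linearity and monotone limits
  give the rest. \<open>G\<close> will be a product of conditional probabilities known before the
  noise at time \<open>n\<close>.\<close>

lemma nn_integral_indep_history:
  assumes G: "G \<in> borel_measurable (H n)" and B: "B \<in> sets borel" "z \<in> D"
  shows "(\<integral>\<^sup>+\<omega>. G \<omega> * indicator B (\<epsilon> n z \<omega>) \<partial>M) = (\<integral>\<^sup>+\<omega>. G \<omega> \<partial>M) * emeasure (law z) B"
proof -
  define E where "E = \<epsilon> n z -` B \<inter> space M"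
  have E [measurable]: "E \<in> events"
    unfolding E_def using B by (intro measurable_sets noise) auto
  have "emeasure (law z) B = emeasure M E"
    unfolding law[OF B(2), of n, symmetric] E_def using B by (subst emeasure_distr) (auto intro: noise)
  moreover have "(\<integral>\<^sup>+\<omega>. G \<omega> * indicator E \<omega> \<partial>M) = (\<integral>\<^sup>+\<omega>. G \<omega> \<partial>M) * emeasure M E"
    using G
  proof (induct rule: borel_measurable_induct)
    case (cong f g)
    have "(\<integral>\<^sup>+\<omega>. f \<omega> * indicator E \<omega> \<partial>M) = (\<integral>\<^sup>+\<omega>. g \<omega> * indicator E \<omega> \<partial>M)"
      using cong(3) by (intro nn_integral_cong) simp
    moreover have "(\<integral>\<^sup>+\<omega>. f \<omega> \<partial>M) = (\<integral>\<^sup>+\<omega>. g \<omega> \<partial>M)"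
      using cong(3) by (intro nn_integral_cong) simp
    ultimately show ?case
      using cong(4) by simp
  next
    case (set A)
    have [measurable]: "A \<in> events"
      using set sets_H_subset by auto
    have "(\<integral>\<^sup>+\<omega>. indicator A \<omega> * indicator E \<omega> \<partial>M) = (\<integral>\<^sup>+\<omega>. indicator (A \<inter> E) \<omega> \<partial>M)"
      by (simp add: indicator_inter_arith)
    also have "\<dots> = emeasure M A * emeasure M E"
      using indep_history[OF set B] by (simp add: E_def[symmetric] emeasure_eq_measure ennreal_mult)
    finally show ?case
      by simp
  next
    case (mult u c)
    note [measurable] = measurable_H_M[OF mult(2)]
    show ?case
      using mult(4) by (simp add: mult.assoc nn_integral_cmult)
  next
    case (add u v)
    note [measurable] = measurable_H_M[OF add(1)] measurable_H_M[OF add(4)]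
    show ?case
      using add(3,7) by (simp add: distrib_right nn_integral_add)
  next
    case (seq U)
    note [measurable] = measurable_H_M[OF seq(1)]
    have "(\<integral>\<^sup>+\<omega>. (SUP i. U i \<omega>) * indicator E \<omega> \<partial>M) = (\<integral>\<^sup>+\<omega>. (SUP i. U i \<omega> * indicator E \<omega>) \<partial>M)"
      by (simp add: SUP_mult_right_ennreal)
    also have "\<dots> = (SUP i. \<integral>\<^sup>+\<omega>. U i \<omega> * indicator E \<omega> \<partial>M)"
      using seq(4) by (intro nn_integral_monotone_convergence_SUP) (auto simp: incseq_def le_fun_def intro!: mult_right_mono)
    also have "\<dots> = (SUP i. \<integral>\<^sup>+\<omega>. U i \<omega> \<partial>M) * emeasure M E"
      using seq(3) by (simp add: SUP_mult_right_ennreal)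
    also have "(SUP i. \<integral>\<^sup>+\<omega>. U i \<omega> \<partial>M) = (\<integral>\<^sup>+\<omega>. (SUP i. U i \<omega>) \<partial>M)"
      using seq(4) by (intro nn_integral_monotone_convergence_SUP[symmetric]) auto
    finally show ?case
      by (simp add: SUP_apply[abs_def] image_comp)
  qed
  moreover have "(\<integral>\<^sup>+\<omega>. G \<omega> * indicator B (\<epsilon> n z \<omega>) \<partial>M) = (\<integral>\<^sup>+\<omega>. G \<omega> * indicator E \<omega> \<partial>M)"
    by (intro nn_integral_cong) (simp add: E_def indicator_def)
  ultimately show ?thesis
    by simp
qed

end

section \<open>Law of the completed table of noise streams\<close>

context adaptive_sampling
begin

definition filled :: "'z \<times> nat \<Rightarrow> 'w \<Rightarrow> bool" where
  "filled j \<omega> \<longleftrightarrow> (\<exists>n. snd j < counts n (fst j) \<omega>)"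

abbreviation "val j \<omega> \<equiv> stream_value (sampled \<omega>) (sampled_noise \<omega>) j"

text \<open>
  The conditional probability, given the first \<open>n\<close> samples, that the \<open>j\<close>-th entry of the table of
  streams lies in \<open>B j\<close>.
\<close>

definition factor :: "nat \<Rightarrow> ('z \<times> nat \<Rightarrow> real set) \<Rightarrow> 'z \<times> nat \<Rightarrow> 'w \<Rightarrow> ennreal" where
  "factor n B j \<omega> = (if snd j < counts n (fst j) \<omega> then indicator (B j) (val j \<omega>) else emeasure (law (fst j)) (B j))"

lemma prob_space_law: "z \<in> D \<Longrightarrow> prob_space (law z)"
  using prob_space_distr[OF noise[of z 0]] law[of z 0] by simp

lemma sets_law: "z \<in> D \<Longrightarrow> sets (law z) = sets borel"
  using law[of z 0] sets_distr[of M borel "\<epsilon> 0 z"] by simp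

lemma emeasure_law_le_1: "z \<in> D \<Longrightarrow> emeasure (law z) A \<le> 1"
  using prob_space.emeasure_le_1[OF prob_space_law] .

lemma factor_le_1: "fst j \<in> D \<Longrightarrow> factor n B j \<omega> \<le> 1"
  using emeasure_law_le_1 by (auto simp: factor_def indicator_def)

lemma factor_measurable:
  assumes "fst j \<in> D" "B j \<in> sets borel"
  shows "factor n B j \<in> borel_measurable (H n)"
proof -
  let ?S = "{\<omega> \<in> space M. snd j < counts n (fst j) \<omega>}"
  let ?T = "{\<omega> \<in> space M. snd j < counts n (fst j) \<omega> \<and> val j \<omega> \<in> B j}"
  have "?S \<in> sets (H n)" "?T \<in> sets (H n)"
    using count_less_H filled_H[OF assms(2,1), of "snd j" n] by auto
  then have "(\<lambda>\<omega>. indicator ?T \<omega> + emeasure (law (fst j)) (B j) * indicator (space (H n) - ?S) \<omega>) \<in> borel_measurable (H n)"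
    by (intro borel_measurable_add borel_measurable_times_ennreal borel_measurable_const borel_measurable_indicator sets.Diff sets.top)
  moreover have "factor n B j \<omega> = indicator ?T \<omega> + emeasure (law (fst j)) (B j) * indicator (space (H n) - ?S) \<omega>"
    if "\<omega> \<in> space (H n)" for \<omega>
    using that by (auto simp: factor_def indicator_def)
  ultimately show ?thesis
    by (subst measurable_cong) auto
qed

lemma factor_Suc:
  assumes "j \<noteq> (X n \<omega>, counts n (X n \<omega>) \<omega>)"
  shows "factor (Suc n) B j \<omega> = factor n B j \<omega>"
proof -
  have "snd j < counts (Suc n) (fst j) \<omega> \<longleftrightarrow> snd j < counts n (fst j) \<omega>"
    using assms by (cases j) (auto simp: num_samples_Suc less_Suc_eq)
  then show ?thesis
    by (simp add: factor_def)
qed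

lemma factor_current:
  assumes "j = (X n \<omega>, counts n (X n \<omega>) \<omega>)"
  shows "factor (Suc n) B j \<omega> = indicator (B j) (\<epsilon> n (fst j) \<omega>)"
    and "factor n B j \<omega> = emeasure (law (fst j)) (B j)"
  using assms by (simp_all add: factor_def num_samples_Suc stream_value_eq)

text \<open>The product has constant mean in \<open>n\<close>, like a martingale: step
  \<open>n\<close> fills exactly one entry, whose factor passes from the probability of
  \<open>B j\<close> to the indicator for fresh noise, which has the same mean given
  \<open>H n\<close>. At \<open>n = 0\<close> nothing is filled and the product is the claimed
  constant.\<close>

lemma nn_integral_factor:
  assumes J: "finite J" "J \<subseteq> D \<times> UNIV" and B: "\<And>j. j \<in> J \<Longrightarrow> B j \<in> sets borel"
  shows "(\<integral>\<^sup>+\<omega>. (\<Prod>j\<in>J. factor n B j \<omega>) \<partial>M) = (\<Prod>j\<in>J. emeasure (law (fst j)) (B j))"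
proof (induction n)
  case 0
  show ?case
    by (simp add: factor_def emeasure_space_1)
next
  case (Suc n)
  \<comment> \<open>\<open>Q j\<close> is the event that step \<open>n\<close> fills entry
    \<open>j\<close>. Since a count is at most \<open>n\<close>, the finitely many
    \<open>Q j\<close> with \<open>j\<close> in \<open>D \<times> {..n}\<close> partition the
    space.\<close>
  define Q where "Q j = {\<omega> \<in> space M. X n \<omega> = fst j} \<inter> {\<omega> \<in> space M. counts n (fst j) \<omega> = snd j}" for j
  have QH: "Q j \<in> sets (H n)" for j
    unfolding Q_def by (intro sets.Int X_eq_H count_H) auto
  have fH: "(\<lambda>\<omega>. \<Prod>j\<in>J'. factor n B j \<omega>) \<in> borel_measurable (H n)" if "J' \<subseteq> J" for J'
    using that J B by (intro borel_measurable_prod_ennreal factor_measurable) auto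
  have f: "(\<lambda>\<omega>. \<Prod>j\<in>J. factor n B j \<omega>) \<in> borel_measurable M" for n
    using J B by (intro borel_measurable_prod_ennreal measurable_H_M[OF factor_measurable]) auto
  have Q [measurable]: "Q j \<in> events" for j
    using subsetD[OF sets_H_subset QH] .
  have split: "(\<integral>\<^sup>+\<omega>. F \<omega> \<partial>M) = (\<Sum>j\<in>D \<times> {..n}. \<integral>\<^sup>+\<omega>. F \<omega> * indicator (Q j) \<omega> \<partial>M)"
    if F: "F \<in> borel_measurable M" for F
  proof -
    have "(\<Sum>j\<in>D \<times> {..n}. F \<omega> * indicator (Q j) \<omega>) = F \<omega>" if \<omega>: "\<omega> \<in> space M" for \<omega>
    proof -
      have "(\<Sum>j\<in>D \<times> {..n}. F \<omega> * indicator (Q j) \<omega>) =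
          (\<Sum>j\<in>D \<times> {..n}. if j = (X n \<omega>, counts n (X n \<omega>) \<omega>) then F \<omega> else 0)"
        using \<omega> by (intro sum.cong) (auto simp: Q_def indicator_def)
      also have "\<dots> = F \<omega>"
        using D(1) X_in[OF \<omega>] num_samples_le[of "sampled \<omega>" n "X n \<omega>"] by (subst sum.delta) auto
      finally show ?thesis .
    qed
    then have "(\<integral>\<^sup>+\<omega>. F \<omega> \<partial>M) = (\<integral>\<^sup>+\<omega>. (\<Sum>j\<in>D \<times> {..n}. F \<omega> * indicator (Q j) \<omega>) \<partial>M)"
      by (intro nn_integral_cong) simp
    also have "\<dots> = (\<Sum>j\<in>D \<times> {..n}. \<integral>\<^sup>+\<omega>. F \<omega> * indicator (Q j) \<omega> \<partial>M)"
      by (intro nn_integral_sum borel_measurable_times_ennreal F borel_measurable_indicator Q)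
    finally show ?thesis .
  qed
  have "(\<integral>\<^sup>+\<omega>. (\<Prod>i\<in>J. factor (Suc n) B i \<omega>) * indicator (Q j) \<omega> \<partial>M) =
      (\<integral>\<^sup>+\<omega>. (\<Prod>i\<in>J. factor n B i \<omega>) * indicator (Q j) \<omega> \<partial>M)" for j
  proof (cases "j \<in> J")
    case False
    have "factor (Suc n) B i \<omega> = factor n B i \<omega>" if "i \<in> J" "\<omega> \<in> Q j" for i \<omega>
      using that False by (intro factor_Suc) (auto simp: Q_def)
    then show ?thesis
      by (intro nn_integral_cong) (auto simp: indicator_def)
  next
    case True
    let ?P = "\<lambda>\<omega>. (\<Prod>i\<in>J - {j}. factor n B i \<omega>) * indicator (Q j) \<omega>"
    have PH: "?P \<in> borel_measurable (H n)"
      by (intro borel_measurable_times_ennreal fH borel_measurable_indicator QH) auto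
    have cur: "j = (X n \<omega>, counts n (X n \<omega>) \<omega>)" if "\<omega> \<in> Q j" for \<omega>
      using that by (cases j) (auto simp: Q_def)
    \<comment> \<open>On \<open>Q j\<close> only the factor of \<open>j\<close> changes; the
      remaining ones are known in \<open>H n\<close>, as \<open>nn_integral_indep_history\<close>
      requires.\<close>
    have "(\<Prod>i\<in>J. factor (Suc n) B i \<omega>) * indicator (Q j) \<omega> = ?P \<omega> * indicator (B j) (\<epsilon> n (fst j) \<omega>)" for \<omega>
    proof (cases "\<omega> \<in> Q j")
      case in_Q: True
      have "(\<Prod>i\<in>J - {j}. factor (Suc n) B i \<omega>) = (\<Prod>i\<in>J - {j}. factor n B i \<omega>)"
        using cur[OF in_Q] by (intro prod.cong factor_Suc) auto
      then show ?thesis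
        using factor_current(1)[OF cur[OF in_Q], of B] in_Q
        by (simp add: prod.remove[OF J(1) True] mult_ac)
    qed simp
    then have "(\<integral>\<^sup>+\<omega>. (\<Prod>i\<in>J. factor (Suc n) B i \<omega>) * indicator (Q j) \<omega> \<partial>M) =
        (\<integral>\<^sup>+\<omega>. ?P \<omega> * indicator (B j) (\<epsilon> n (fst j) \<omega>) \<partial>M)"
      by simp
    also have "\<dots> = (\<integral>\<^sup>+\<omega>. ?P \<omega> \<partial>M) * emeasure (law (fst j)) (B j)"
      using True J B by (intro nn_integral_indep_history PH) auto
    also have "\<dots> = (\<integral>\<^sup>+\<omega>. ?P \<omega> * emeasure (law (fst j)) (B j) \<partial>M)"
      using measurable_H_M[OF PH] by (simp add: nn_integral_multc)
    also have "\<dots> = (\<integral>\<^sup>+\<omega>. (\<Prod>i\<in>J. factor n B i \<omega>) * indicator (Q j) \<omega> \<partial>M)"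
    proof (intro nn_integral_cong)
      fix \<omega>
      show "?P \<omega> * emeasure (law (fst j)) (B j) = (\<Prod>i\<in>J. factor n B i \<omega>) * indicator (Q j) \<omega>"
        using factor_current(2)[OF cur, of \<omega> B]
        by (cases "\<omega> \<in> Q j") (simp_all add: prod.remove[OF J(1) True] mult_ac)
    qed
    finally show ?thesis .
  qed
  then show ?case
    unfolding split[OF f] Suc[symmetric] by simp
qed

definition factor_lim :: "('z \<times> nat \<Rightarrow> real set) \<Rightarrow> 'z \<times> nat \<Rightarrow> 'w \<Rightarrow> ennreal" where
  "factor_lim B j \<omega> = (if filled j \<omega> then indicator (B j) (val j \<omega>) else emeasure (law (fst j)) (B j))"

lemma factor_eventually: "\<forall>\<^sub>F n in sequentially. factor n B j \<omega> = factor_lim B j \<omega>"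
proof (cases "filled j \<omega>")
  case True
  then obtain m where m: "snd j < counts m (fst j) \<omega>"
    by (auto simp: filled_def)
  show ?thesis
    using eventually_ge_at_top[of m]
  proof eventually_elim
    case (elim n)
    then have "snd j < counts n (fst j) \<omega>"
      using m num_samples_mono[of m n] by (meson less_le_trans)
    then show ?case
      using True by (simp add: factor_def factor_lim_def)
  qed
next
  case False
  then show ?thesis
    by (intro always_eventually) (auto simp: factor_def factor_lim_def filled_def)
qed

lemma nn_integral_factor_lim:
  assumes J: "finite J" "J \<subseteq> D \<times> UNIV" and B: "\<And>j. j \<in> J \<Longrightarrow> B j \<in> sets borel"
  shows "(\<integral>\<^sup>+\<omega>. (\<Prod>j\<in>J. factor_lim B j \<omega>) \<partial>M) = (\<Prod>j\<in>J. emeasure (law (fst j)) (B j))"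
proof -
  have f: "(\<lambda>\<omega>. \<Prod>j\<in>J. factor n B j \<omega>) \<in> borel_measurable M" for n
    using J B by (intro borel_measurable_prod_ennreal measurable_H_M[OF factor_measurable]) auto
  have lim: "(\<lambda>n. \<Prod>j\<in>J. factor n B j \<omega>) \<longlonglongrightarrow> (\<Prod>j\<in>J. factor_lim B j \<omega>)" for \<omega>
  proof (rule tendsto_eventually)
    have "\<forall>\<^sub>F n in sequentially. \<forall>j\<in>J. factor n B j \<omega> = factor_lim B j \<omega>"
      using J(1) factor_eventually by (simp add: eventually_ball_finite)
    then show "\<forall>\<^sub>F n in sequentially. (\<Prod>j\<in>J. factor n B j \<omega>) = (\<Prod>j\<in>J. factor_lim B j \<omega>)"
      by eventually_elim (simp cong: prod.cong)
  qed
  have "(\<lambda>n. \<integral>\<^sup>+\<omega>. (\<Prod>j\<in>J. factor n B j \<omega>) \<partial>M) \<longlonglongrightarrow> (\<integral>\<^sup>+\<omega>. (\<Prod>j\<in>J. factor_lim B j \<omega>) \<partial>M)"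
  proof (rule nn_integral_dominated_convergence[where w = "\<lambda>_. 1"])
    show "(\<lambda>\<omega>. \<Prod>j\<in>J. factor_lim B j \<omega>) \<in> borel_measurable M"
      by (rule borel_measurable_LIMSEQ_order[OF lim f])
    show "AE \<omega> in M. (\<Prod>j\<in>J. factor n B j \<omega>) \<le> 1" for n
    proof (intro always_eventually allI)
      fix \<omega>
      have "(\<Prod>j\<in>J. factor n B j \<omega>) \<le> (\<Prod>j\<in>J. 1)"
        using J factor_le_1 by (intro prod_mono_ennreal) auto
      then show "(\<Prod>j\<in>J. factor n B j \<omega>) \<le> 1"
        by simp
    qed
  qed (use f lim in \<open>auto simp: emeasure_space_1\<close>)
  then show ?thesis
    using nn_integral_factor[OF J B] by (simp add: LIMSEQ_const_iff)
qed


abbreviation "table_measure \<equiv> PiM (D \<times> (UNIV :: nat set)) (\<lambda>j. law (fst j))"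

text \<open>Entries that the policy never reaches are filled from an independent table.\<close>

definition table :: "'w \<times> ('z \<times> nat \<Rightarrow> real) \<Rightarrow> 'z \<times> nat \<Rightarrow> real" where
  "table p = (\<lambda>j\<in>D \<times> UNIV. if filled j (fst p) then val j (fst p) else snd p j)"

lemma prob_space_table: "prob_space table_measure"
  by (intro prob_space_PiM prob_space_law) auto

lemma filled_val_measurable:
  assumes "fst j \<in> D" "B \<in> sets borel"
  shows "{\<omega> \<in> space M. filled j \<omega> \<and> val j \<omega> \<in> B} \<in> events"
proof -
  have "{\<omega> \<in> space M. filled j \<omega> \<and> val j \<omega> \<in> B} =
      (\<Union>n. {\<omega> \<in> space M. snd j < counts n (fst j) \<omega> \<and> val j \<omega> \<in> B})"
    by (auto simp: filled_def)
  also have "\<dots> \<in> events"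
    using filled_H[OF assms(2,1), of "snd j"] sets_H_subset by (intro sets.countable_UN) auto
  finally show ?thesis .
qed

lemma table_measurable: "table \<in> measurable (M \<Otimes>\<^sub>M table_measure) table_measure"
  unfolding table_def
proof (rule measurable_restrict)
  fix j :: "'z \<times> nat" assume j: "j \<in> D \<times> UNIV"
  show "(\<lambda>p. if filled j (fst p) then val j (fst p) else snd p j) \<in> measurable (M \<Otimes>\<^sub>M table_measure) (law (fst j))"
  proof (rule measurableI)
    fix B assume B: "B \<in> sets (law (fst j))"
    then have B': "B \<in> sets borel"
      using j sets_law by auto
    let ?F = "{\<omega> \<in> space M. filled j \<omega> \<and> val j \<omega> \<in> UNIV}"
    have "(\<lambda>p. if filled j (fst p) then val j (fst p) else snd p j) -` B \<inter> space (M \<Otimes>\<^sub>M table_measure) =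
      {\<omega> \<in> space M. filled j \<omega> \<and> val j \<omega> \<in> B} \<times> space table_measure \<union>
      (space M - ?F) \<times> ((\<lambda>y. y j) -` B \<inter> space table_measure)"
      by (auto simp: space_pair_measure split: if_splits)
    also have "\<dots> \<in> sets (M \<Otimes>\<^sub>M table_measure)"
      using j B B' by (intro sets.Un pair_measureI sets.Diff sets.top filled_val_measurable
          measurable_sets[OF measurable_component_singleton]) auto
    finally show "(\<lambda>p. if filled j (fst p) then val j (fst p) else snd p j) -` B \<inter> space (M \<Otimes>\<^sub>M table_measure)
        \<in> sets (M \<Otimes>\<^sub>M table_measure)" .
  next
    have "space (law (fst j)) = UNIV"
      using sets_eq_imp_space_eq[OF sets_law[of "fst j"]] j by auto
    then show "(if filled j (fst p) then val j (fst p) else snd p j) \<in> space (law (fst j))" for p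
      by simp
  qed
qed

text \<open>For fixed \<open>\<omega>\<close>, a filled entry contributes an indicator to the
  probability of a cylinder and an unfilled one its law, which gives the product of
  \<open>factor_lim\<close>. The mean of that product over \<open>\<omega>\<close> is the
  probability of the cylinder under independent entries.\<close>

lemma distr_table: "distr (M \<Otimes>\<^sub>M table_measure) table_measure table = table_measure"
proof (rule measure_eqI_PiM_infinite)
  interpret T: prob_space table_measure
    by (rule prob_space_table)
  interpret MT: pair_prob_space M table_measure ..
  show "finite_measure (distr (M \<Otimes>\<^sub>M table_measure) table_measure table)"
    using MT.prob_space_distr[OF table_measurable] prob_space.finite_measure by blast
  fix B J assume J: "finite J" "J \<subseteq> D \<times> (UNIV :: nat set)" and B: "\<And>j. j \<in> J \<Longrightarrow> B j \<in> sets (law (fst j))"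
  have emb: "emeasure table_measure (prod_emb (D \<times> UNIV) (\<lambda>j. law (fst j)) J (Pi\<^sub>E J A)) = (\<Prod>j\<in>J. emeasure (law (fst j)) (A j))"
    if "\<And>j. j \<in> J \<Longrightarrow> A j \<in> sets (law (fst j))" for A
    using that J by (intro emeasure_PiM_emb prob_space_law) auto
  have space_law: "space (law (fst j)) = UNIV" if "j \<in> D \<times> UNIV" for j :: "'z \<times> nat"
    using sets_eq_imp_space_eq[OF sets_law[of "fst j"]] that by auto
  have emb_eq: "prod_emb (D \<times> UNIV) (\<lambda>j. law (fst j)) J (Pi\<^sub>E J A) = {y \<in> space table_measure. \<forall>j\<in>J. y j \<in> A j}" for A
    using J(2) by (auto simp: prod_emb_def space_PiM PiE_iff extensional_def)
  let ?E = "prod_emb (D \<times> UNIV) (\<lambda>j. law (fst j)) J (Pi\<^sub>E J B)"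
  have E: "?E \<in> sets table_measure"
    using J B by (intro sets_PiM_I) auto
  have "emeasure (distr (M \<Otimes>\<^sub>M table_measure) table_measure table) ?E =
      emeasure (M \<Otimes>\<^sub>M table_measure) (table -` ?E \<inter> space (M \<Otimes>\<^sub>M table_measure))"
    by (rule emeasure_distr[OF table_measurable E])
  also have "\<dots> = (\<integral>\<^sup>+\<omega>. emeasure table_measure (Pair \<omega> -` (table -` ?E \<inter> space (M \<Otimes>\<^sub>M table_measure))) \<partial>M)"
    by (rule T.emeasure_pair_measure_alt[OF measurable_sets[OF table_measurable E]])
  also have "\<dots> = (\<integral>\<^sup>+\<omega>. (\<Prod>j\<in>J. factor_lim B j \<omega>) \<partial>M)"
  proof (rule nn_integral_cong)
    fix \<omega> assume \<omega>: "\<omega> \<in> space M"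
    \<comment> \<open>\<open>A\<close> turns the cylinder condition on
      \<open>table (\<omega>, y)\<close> into one on \<open>y\<close> alone: a filled entry either
      leaves \<open>y j\<close> free or excludes every \<open>y\<close>.\<close>
    define A where "A j = (if filled j \<omega> then if val j \<omega> \<in> B j then UNIV else {} else B j)" for j
    have "table (\<omega>, y) \<in> ?E \<longleftrightarrow> (\<forall>j\<in>J. y j \<in> A j)" if "y \<in> space table_measure" for y
    proof -
      have "table (\<omega>, y) \<in> space table_measure"
        using \<omega> that by (intro measurable_space[OF table_measurable]) (simp add: space_pair_measure)
      then have "table (\<omega>, y) \<in> ?E \<longleftrightarrow> (\<forall>j\<in>J. table (\<omega>, y) j \<in> B j)"
        unfolding emb_eq by simp
      also have "\<dots> \<longleftrightarrow> (\<forall>j\<in>J. y j \<in> A j)"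
        using J(2) by (intro ball_cong refl) (auto simp: table_def A_def)
      finally show ?thesis .
    qed
    then have "Pair \<omega> -` (table -` ?E \<inter> space (M \<Otimes>\<^sub>M table_measure)) = {y \<in> space table_measure. \<forall>j\<in>J. y j \<in> A j}"
      using \<omega> by (auto simp: space_pair_measure)
    also have "emeasure table_measure \<dots> = (\<Prod>j\<in>J. emeasure (law (fst j)) (A j))"
      unfolding emb_eq[symmetric] using B J(2) by (intro emb) (auto simp: A_def sets_law)
    also have "\<dots> = (\<Prod>j\<in>J. factor_lim B j \<omega>)"
    proof (intro prod.cong refl)
      fix j assume "j \<in> J"
      then have "fst j \<in> D"
        using J(2) by auto
      then have "emeasure (law (fst j)) UNIV = 1"
        using prob_space.emeasure_space_1[OF prob_space_law[of "fst j"]] space_law[of j] by (simp add: mem_Times_iff)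
      then show "emeasure (law (fst j)) (A j) = factor_lim B j \<omega>"
        by (simp add: A_def factor_lim_def)
    qed
    finally show "emeasure table_measure (Pair \<omega> -` (table -` ?E \<inter> space (M \<Otimes>\<^sub>M table_measure))) = (\<Prod>j\<in>J. factor_lim B j \<omega>)" .
  qed
  also have "\<dots> = (\<Prod>j\<in>J. emeasure (law (fst j)) (B j))"
  proof (rule nn_integral_factor_lim[OF J])
    fix j assume j: "j \<in> J"
    then have "fst j \<in> D"
      using J(2) by auto
    then show "B j \<in> sets borel"
      using B[OF j] sets_law by simp
  qed
  also have "\<dots> = emeasure table_measure ?E"
    using B by (rule emb[symmetric])
  finally show "emeasure (distr (M \<Otimes>\<^sub>M table_measure) table_measure table) ?E = emeasure table_measure ?E" .
qed simp_all

text \<open>Some completion \<open>y\<close> is enough, since the later statements about sampled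
  noise involve filled entries only, where \<open>table (\<omega>, y)\<close> does not depend on
  \<open>y\<close>.\<close>

lemma AE_table:
  assumes "AE y in table_measure. P y"
  shows "AE \<omega> in M. \<exists>y. P (table (\<omega>, y))"
proof -
  interpret T: prob_space table_measure
    by (rule prob_space_table)
  interpret MT: pair_prob_space M table_measure ..
  have "AE p in M \<Otimes>\<^sub>M table_measure. P (table p)"
    using AE_distrD[OF table_measurable, of P] assms unfolding distr_table by simp
  then have "AE \<omega> in M. AE y in table_measure. P (table (\<omega>, y))"
    by (rule MT.AE_pair)
  then show ?thesis
  proof eventually_elim
    case (elim \<omega>)
    show ?case
    proof (rule ccontr)
      assume "\<not> ?case"
      then have "AE y in table_measure. False"
        using elim by simp
      then show False
        by simp
    qed
  qed
qed

lemma sum_table: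
  assumes "z \<in> D"
  shows "(\<Sum>i<counts n z \<omega>. table (\<omega>, y) (z, i)) = (\<Sum>i | i < n \<and> X i \<omega> = z. \<epsilon> i (X i \<omega>) \<omega>)"
proof -
  have "(\<Sum>i<counts n z \<omega>. table (\<omega>, y) (z, i)) = (\<Sum>i<counts n z \<omega>. val (z, i) \<omega>)"
    using assms by (intro sum.cong) (auto simp: table_def filled_def)
  then show ?thesis
    by (simp add: sum_stream_value)
qed

lemma indep_vars_table: "prob_space.indep_vars table_measure (\<lambda>_. borel) (\<lambda>j y. y j) (D \<times> UNIV)"
proof -
  interpret T: prob_space table_measure
    by (rule prob_space_table)
  have m: "(\<lambda>y. y j) \<in> measurable table_measure borel" if "j \<in> D \<times> UNIV" for j
    using that measurable_component_singleton[OF that, of "\<lambda>j. law (fst j)"] sets_law[of "fst j"]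
    by (subst measurable_cong_sets[OF refl, of borel "law (fst j)"]) auto
  have "distr table_measure (PiM (D \<times> UNIV) (\<lambda>_. borel)) (\<lambda>y. \<lambda>j\<in>D \<times> UNIV. y j) = distr table_measure table_measure (\<lambda>y. y)"
    by (intro distr_cong sets_PiM_cong) (auto simp: sets_law space_PiM)
  also have "\<dots> = PiM (D \<times> UNIV) (\<lambda>j. distr table_measure borel (\<lambda>y. y j))"
  proof -
    have "distr table_measure borel (\<lambda>y. y j) = law (fst j)" if "j \<in> D \<times> UNIV" for j
    proof -
      have "distr table_measure borel (\<lambda>y. y j) = distr table_measure (law (fst j)) (\<lambda>y. y j)"
        using that by (intro distr_cong) (auto simp: sets_law)
      also have "\<dots> = law (fst j)"
        using that by (intro distr_PiM_component prob_space_law) auto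
      finally show ?thesis .
    qed
    then have "PiM (D \<times> UNIV) (\<lambda>j. distr table_measure borel (\<lambda>y. y j)) = table_measure"
      by (intro PiM_cong) auto
    then show ?thesis
      unfolding distr_id by (rule sym)
  qed
  finally have eq: "distr table_measure (PiM (D \<times> UNIV) (\<lambda>_. borel)) (\<lambda>y. \<lambda>j\<in>D \<times> UNIV. y j) =
      PiM (D \<times> UNIV) (\<lambda>j. distr table_measure borel (\<lambda>y. y j))" .
  have "D \<times> (UNIV :: nat set) \<noteq> {}"
    using D(2) by auto
  note * = T.indep_vars_iff_distr_eq_PiM'[THEN iffD2, OF this _ eq]
  show ?thesis
    by (rule *) (rule m)
qed

text \<open>By \<open>sum_table\<close>, a sample mean is the average of the first entries of a
  stream of independent normals, as many as the count. So facts that hold for all deterministic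
  numbers of entries carry over to the random counts, at all times simultaneously.\<close>

theorem AE_sampled_noise:
  fixes r :: "'z \<Rightarrow> nat"
  assumes pos: "\<And>z. z \<in> D \<Longrightarrow> 0 < \<sigma> z"
    and norm: "\<And>z. z \<in> D \<Longrightarrow> law z = density lborel (normal_density 0 (\<sigma> z))"
  shows "AE \<omega> in M.
    (\<forall>z\<in>D. filterlim (\<lambda>n. counts n z \<omega>) at_top sequentially \<longrightarrow>
       (\<lambda>n. sample_mean (sampled \<omega>) (sampled_noise \<omega>) n z) \<longlonglongrightarrow> 0) \<and>
    (\<forall>(L :: nat) (h :: nat) (m0 :: nat). \<exists>m\<ge>m0. \<forall>z\<in>D. \<forall>z'\<in>D. r z < r z' \<longrightarrow>
       (\<forall>n n'. counts n z \<omega> \<in> {m..L * m} \<longrightarrow> counts n' z' \<omega> \<in> {m..L * m} \<longrightarrow>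
          h / sqrt m \<le> sample_mean (sampled \<omega>) (sampled_noise \<omega>) n z
                          - sample_mean (sampled \<omega>) (sampled_noise \<omega>) n' z'))"
proof -
  interpret T: prob_space table_measure
    by (rule prob_space_table)
  have dist: "distributed table_measure lborel (\<lambda>y. y (z, i)) (normal_density 0 (\<sigma> z))" if z: "z \<in> D" for z i
  proof -
    have "distr table_measure lborel (\<lambda>y. y (z, i)) = distr table_measure (law z) (\<lambda>y. y (z, i))"
      using z by (intro distr_cong) (auto simp: sets_law)
    also have "\<dots> = law z"
      using z distr_PiM_component[of "D \<times> UNIV" "\<lambda>j. law (fst j)" "(z, i)"] prob_space_law by auto
    finally show ?thesis
      using z measurable_component_singleton[of "(z, i)" "D \<times> UNIV" "\<lambda>j. law (fst j)"] sets_law[OF z]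
      unfolding distributed_def
      by (auto simp: norm cong: measurable_cong_sets)
  qed
  have lln: "AE y in table_measure. \<forall>z\<in>D. (\<lambda>n. (\<Sum>i<n. y (z, i)) / real n) \<longlonglongrightarrow> 0"
    unfolding AE_finite_all[OF D(1)]
  proof
    fix z assume z: "z \<in> D"
    show "AE y in table_measure. (\<lambda>n. (\<Sum>i<n. y (z, i)) / real n) \<longlonglongrightarrow> 0"
      by (rule T.indep_normal_averages_tendsto_0[OF T.indep_vars_row[OF indep_vars_table z] pos[OF z] dist[OF z]])
  qed
  have sep: "AE y in table_measure. averages_separated D r y"
    by (rule T.averages_separated_infinitely_often[OF indep_vars_table D dist pos lln])
  have "AE y in table_measure. (\<forall>z\<in>D. (\<lambda>n. (\<Sum>i<n. y (z, i)) / real n) \<longlonglongrightarrow> 0) \<and> averages_separated D r y"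
    using lln sep by eventually_elim blast
  from AE_table[OF this] show ?thesis
  proof eventually_elim
    fix \<omega>
    assume "\<exists>y. (\<forall>z\<in>D. (\<lambda>n. (\<Sum>i<n. table (\<omega>, y) (z, i)) / real n) \<longlonglongrightarrow> 0) \<and>
      averages_separated D r (table (\<omega>, y))"
    then obtain y where lim: "\<And>z. z \<in> D \<Longrightarrow> (\<lambda>n. (\<Sum>i<n. table (\<omega>, y) (z, i)) / real n) \<longlonglongrightarrow> 0"
      and sep: "averages_separated D r (table (\<omega>, y))"
      by blast
    have mean: "sample_mean (sampled \<omega>) (sampled_noise \<omega>) n z =
        (\<Sum>i<counts n z \<omega>. table (\<omega>, y) (z, i)) / counts n z \<omega>" if "z \<in> D" for n z
      using that by (simp add: sample_mean_def sum_table)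
    show "(\<forall>z\<in>D. filterlim (\<lambda>n. counts n z \<omega>) at_top sequentially \<longrightarrow>
       (\<lambda>n. sample_mean (sampled \<omega>) (sampled_noise \<omega>) n z) \<longlonglongrightarrow> 0) \<and>
      (\<forall>(L :: nat) (h :: nat) (m0 :: nat). \<exists>m\<ge>m0. \<forall>z\<in>D. \<forall>z'\<in>D. r z < r z' \<longrightarrow>
       (\<forall>n n'. counts n z \<omega> \<in> {m..L * m} \<longrightarrow> counts n' z' \<omega> \<in> {m..L * m} \<longrightarrow>
          h / sqrt m \<le> sample_mean (sampled \<omega>) (sampled_noise \<omega>) n z
                          - sample_mean (sampled \<omega>) (sampled_noise \<omega>) n' z'))"
    proof (intro conjI ballI impI allI)
      fix z assume z: "z \<in> D" "filterlim (\<lambda>n. counts n z \<omega>) at_top sequentially"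
      show "(\<lambda>n. sample_mean (sampled \<omega>) (sampled_noise \<omega>) n z) \<longlonglongrightarrow> 0"
        unfolding mean[OF z(1)] by (rule filterlim_compose[OF lim[OF z(1)] z(2)])
    next
      fix L h m0 :: nat
      obtain m where "m0 \<le> m" and m: "\<And>z z' n n'. z \<in> D \<Longrightarrow> z' \<in> D \<Longrightarrow> r z < r z' \<Longrightarrow> n \<in> {m..L * m} \<Longrightarrow> n' \<in> {m..L * m} \<Longrightarrow>
          h / sqrt m \<le> (\<Sum>i<n. table (\<omega>, y) (z, i)) / n - (\<Sum>i<n'. table (\<omega>, y) (z', i)) / n'"
        using sep unfolding averages_separated_def by blast
      then show "\<exists>m\<ge>m0. \<forall>z\<in>D. \<forall>z'\<in>D. r z < r z' \<longrightarrow>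
       (\<forall>n n'. counts n z \<omega> \<in> {m..L * m} \<longrightarrow> counts n' z' \<omega> \<in> {m..L * m} \<longrightarrow>
          h / sqrt m \<le> sample_mean (sampled \<omega>) (sampled_noise \<omega>) n z
                          - sample_mean (sampled \<omega>) (sampled_noise \<omega>) n' z')"
        by (intro exI[of _ m]) (simp add: mean)
    qed
  qed
qed

end

subsection \<open>Optimality conditions\<close>

text \<open>For fixed \<open>s\<close> the equations force
  \<open>q k = v k / (\<Delta> k * s - v0)\<close>, and the remaining condition becomes
  \<open>g s = 1 / v0\<close>, solved by the intermediate value theorem. Later \<open>q k\<close> is
  the ratio of the fraction of \<open>k\<close> to that of the best alternative in one
  context.\<close>

lemma exists_balanced_ratios:
  fixes \<Delta> v :: "'k \<Rightarrow> real"
  assumes I: "finite I" "I \<noteq> {}" and pos: "\<And>k. k \<in> I \<Longrightarrow> 0 < \<Delta> k" "\<And>k. k \<in> I \<Longrightarrow> 0 < v k" "0 < v0"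
  shows "\<exists>s q. 0 < s \<and> (\<forall>k\<in>I. 0 < q k \<and> v0 + v k / q k = \<Delta> k * s) \<and> (\<Sum>k\<in>I. (q k)\<^sup>2 / v k) = 1 / v0"
proof -
  define n where "n = real (card I)"
  have n: "1 \<le> n"
    using I by (simp add: n_def Suc_le_eq card_gt_0_iff)
  \<comment> \<open>\<open>S t\<close> is the least \<open>s\<close> beyond the poles of
    \<open>g\<close> at which every term of \<open>g\<close> is at most \<open>1 / (t * v0)\<close>.
    At \<open>S 1\<close> some term equals \<open>1 / v0\<close>, so \<open>g\<close> is large
    enough; at \<open>S n\<close> all \<open>n\<close> terms together are at most
    \<open>1 / v0\<close>.\<close>
  define S where "S t = Max ((\<lambda>k. (v0 + sqrt (t * v k * v0)) / \<Delta> k) ` I)" for t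
  define g where "g s = (\<Sum>k\<in>I. v k / (\<Delta> k * s - v0)\<^sup>2)" for s
  have S_ge: "v0 + sqrt (t * v k * v0) \<le> \<Delta> k * s" if "k \<in> I" "S t \<le> s" for k s t
  proof -
    have "(v0 + sqrt (t * v k * v0)) / \<Delta> k \<le> S t"
      unfolding S_def using that(1) I by (intro Max_ge) auto
    then have "(v0 + sqrt (t * v k * v0)) / \<Delta> k \<le> s"
      using that(2) by simp
    then show ?thesis
      using pos(1)[OF that(1)] by (simp add: field_simps)
  qed
  have denom: "0 < \<Delta> k * s - v0" if "k \<in> I" "S 1 \<le> s" for k s
  proof -
    have "0 < sqrt (1 * v k * v0)"
      using pos that(1) by simp
    then show ?thesis
      using S_ge[OF that] by linarith
  qed
  have S_mono: "S 1 \<le> S n"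
    unfolding S_def
  proof (rule Max.boundedI)
    fix x assume "x \<in> (\<lambda>k. (v0 + sqrt (1 * v k * v0)) / \<Delta> k) ` I"
    then obtain k where k: "k \<in> I" "x = (v0 + sqrt (1 * v k * v0)) / \<Delta> k"
      by blast
    have "x \<le> (v0 + sqrt (n * v k * v0)) / \<Delta> k"
      unfolding k(2) using pos k(1) n
      by (intro divide_right_mono add_left_mono real_sqrt_le_mono mult_right_mono) (auto intro: less_imp_le)
    also have "\<dots> \<le> Max ((\<lambda>k. (v0 + sqrt (n * v k * v0)) / \<Delta> k) ` I)"
      using k(1) I by (intro Max_ge) auto
    finally show "x \<le> Max ((\<lambda>k. (v0 + sqrt (n * v k * v0)) / \<Delta> k) ` I)" .
  qed (use I in auto)
  have upper: "1 / v0 \<le> g (S 1)"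
  proof -
    have "S 1 \<in> (\<lambda>k. (v0 + sqrt (1 * v k * v0)) / \<Delta> k) ` I"
      unfolding S_def using I by (intro Max_in) auto
    then obtain k where k: "k \<in> I" "S 1 = (v0 + sqrt (v k * v0)) / \<Delta> k"
      by auto
    have "(\<Delta> k * S 1 - v0)\<^sup>2 = v k * v0"
      using pos(1,2)[OF k(1)] pos(3) k(2) by simp
    then have "v k / (\<Delta> k * S 1 - v0)\<^sup>2 = 1 / v0"
      using pos(2)[OF k(1)] by simp
    moreover have "v k / (\<Delta> k * S 1 - v0)\<^sup>2 \<le> g (S 1)"
      unfolding g_def using I(1) k(1) less_imp_le[OF pos(2)] by (intro member_le_sum) auto
    ultimately show ?thesis
      by simp
  qed
  have lower: "g (S n) \<le> 1 / v0"
  proof -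
    have "g (S n) \<le> (\<Sum>k\<in>I. 1 / (n * v0))"
      unfolding g_def
    proof (rule sum_mono)
      fix k assume k: "k \<in> I"
      have "(sqrt (n * v k * v0))\<^sup>2 \<le> (\<Delta> k * S n - v0)\<^sup>2"
        using S_ge[OF k order_refl, of n] pos(2)[OF k] pos(3) n by (intro power_mono) auto
      then have "n * v k * v0 \<le> (\<Delta> k * S n - v0)\<^sup>2"
        using pos(2)[OF k] pos(3) n by simp
      moreover have nv: "0 < n * v k * v0"
        using pos(2)[OF k] pos(3) n by simp
      ultimately have "v k / (\<Delta> k * S n - v0)\<^sup>2 \<le> v k / (n * v k * v0)"
        using pos(2)[OF k] by (intro divide_left_mono mult_pos_pos[OF _ nv]) auto
      then show "v k / (\<Delta> k * S n - v0)\<^sup>2 \<le> 1 / (n * v0)"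
        using pos(2)[OF k] by simp
    qed
    also have "\<dots> = 1 / v0"
      using n by (simp add: n_def)
    finally show ?thesis .
  qed
  have "\<forall>s. S 1 \<le> s \<and> s \<le> S n \<longrightarrow> isCont g s"
    unfolding g_def using denom by (auto intro!: continuous_intros simp: order_less_imp_not_eq2)
  then obtain s where s: "S 1 \<le> s" "g s = 1 / v0"
    using IVT2[of g "S n" "1 / v0" "S 1"] lower upper S_mono by blast
  define q where "q k = v k / (\<Delta> k * s - v0)" for k
  have q: "0 < q k \<and> v0 + v k / q k = \<Delta> k * s" if "k \<in> I" for k
    using denom[OF that s(1)] pos(2)[OF that] by (simp add: q_def)
  have "(\<Sum>k\<in>I. (q k)\<^sup>2 / v k) = g s"
    unfolding g_def q_def using pos(2)
    by (intro sum.cong refl) (simp add: power_divide power2_eq_square order_less_imp_not_eq2)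
  moreover have "0 < s"
  proof -
    obtain k where k: "k \<in> I"
      using I by blast
    have "0 < \<Delta> k * s"
      using denom[OF k s(1)] pos(3) by linarith
    then show ?thesis
      using pos(1)[OF k] by (simp add: zero_less_mult_iff)
  qed
  ultimately show ?thesis
    using q s(2) by metis
qed

section \<open>Existence and uniqueness of the optimal allocation\<close>

locale ranking_problem =
  fixes K :: "'k set" and C :: "'c set" and F v :: "'k \<times> 'c \<Rightarrow> real"
  assumes K: "finite K" "2 \<le> card K" and C: "finite C" "C \<noteq> {}"
    and unique_best: "\<And>c. c \<in> C \<Longrightarrow> \<exists>!k. is_arg_max (\<lambda>k. F (k, c)) (\<lambda>k. k \<in> K) k"
    and v_pos: "\<And>z. z \<in> K \<times> C \<Longrightarrow> 0 < v z"
begin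

abbreviation "\<pi> \<equiv> best_alt F K"
abbreviation "gap k c \<equiv> (F (\<pi> c, c) - F (k, c))\<^sup>2"
abbreviation "others c \<equiv> K - {\<pi> c}"

lemma best: assumes "c \<in> C" shows "\<pi> c \<in> K" "\<And>k. k \<in> others c \<Longrightarrow> F (k, c) < F (\<pi> c, c)"
proof -
  obtain k where k: "is_arg_max (\<lambda>k. F (k, c)) (\<lambda>k. k \<in> K) k"
    and uniq: "\<And>k'. is_arg_max (\<lambda>k. F (k, c)) (\<lambda>k. k \<in> K) k' \<Longrightarrow> k' = k"
    using unique_best[OF assms] by (elim ex1E) blast
  have "\<pi> c = k"
    unfolding best_alt_def arg_max_on_def arg_max_def using k uniq by (rule some_equality)
  then have max: "is_arg_max (\<lambda>k. F (k, c)) (\<lambda>k. k \<in> K) (\<pi> c)"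
    using k by simp
  then show "\<pi> c \<in> K"
    by (simp add: is_arg_max_def)
  fix j assume j: "j \<in> others c"
  then have "\<not> is_arg_max (\<lambda>k. F (k, c)) (\<lambda>k. k \<in> K) j"
    using uniq \<open>\<pi> c = k\<close> by auto
  then obtain i where "i \<in> K" "F (j, c) < F (i, c)"
    using j by (auto simp: is_arg_max_def)
  moreover have "F (i, c) \<le> F (\<pi> c, c)"
    using max \<open>i \<in> K\<close> by (auto simp: is_arg_max_def not_less)
  ultimately show "F (j, c) < F (\<pi> c, c)"
    by simp
qed

lemma gap_pos: "c \<in> C \<Longrightarrow> k \<in> others c \<Longrightarrow> 0 < gap k c"
  using best(2)[of c k] by simp

lemma others: "finite (others c)" "c \<in> C \<Longrightarrow> others c \<noteq> {}"
proof -
  assume "c \<in> C"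
  then have "card (others c) = card K - 1"
    using best(1) by simp
  then have "0 < card (others c)"
    using K(2) by linarith
  then show "others c \<noteq> {}"
    by (auto simp: card_gt_0_iff)
qed (use K in simp)

lemma sum_K: "c \<in> C \<Longrightarrow> (\<Sum>k\<in>K. f k) = f (\<pi> c) + (\<Sum>k\<in>others c. f k)" for f :: "'k \<Rightarrow> real"
  using K best(1) by (intro sum.remove) auto

definition balanced :: "('k \<times> 'c \<Rightarrow> real) \<Rightarrow> real \<Rightarrow> bool" where
  "balanced p \<eta>0 \<longleftrightarrow> (\<forall>z\<in>K \<times> C. 0 < p z) \<and> (\<Sum>z\<in>K \<times> C. p z) = 1 \<and> 0 < \<eta>0 \<and>
     (\<forall>c\<in>C. (p (\<pi> c, c))\<^sup>2 / v (\<pi> c, c) = (\<Sum>k\<in>others c. (p (k, c))\<^sup>2 / v (k, c))) \<and>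
     (\<forall>c\<in>C. \<forall>k\<in>others c. eta F v \<pi> p k c = \<eta>0)"

text \<open>\<open>exists_balanced_ratios\<close> fixes the ratios within each context. Then
  \<open>eta\<close> equals \<open>p (\<pi> c, c) / s c\<close>, so the contexts agree once the best
  alternative of \<open>c\<close> has mass proportional to \<open>s c\<close>; dividing by the total
  mass \<open>T\<close> makes the common value \<open>1 / T\<close>.\<close>

lemma exists_balanced: "\<exists>p \<eta>0. balanced p \<eta>0"
proof -
  have "\<exists>s q. 0 < s \<and> (\<forall>k\<in>others c. 0 < q k \<and> v (\<pi> c, c) + v (k, c) / q k = gap k c * s) \<and>
      (\<Sum>k\<in>others c. (q k)\<^sup>2 / v (k, c)) = 1 / v (\<pi> c, c)" if c: "c \<in> C" for c
    using c best(1) by (intro exists_balanced_ratios others gap_pos v_pos) auto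
  then have "\<forall>c\<in>C. \<exists>x. 0 < fst x \<and> (\<forall>k\<in>others c. 0 < snd x k \<and> v (\<pi> c, c) + v (k, c) / snd x k = gap k c * fst x) \<and>
      (\<Sum>k\<in>others c. (snd x k)\<^sup>2 / v (k, c)) = 1 / v (\<pi> c, c)"
    by (simp only: split_paired_Ex fst_conv snd_conv) blast
  from bchoice[OF this] obtain x where
    x: "\<forall>c\<in>C. 0 < fst (x c) \<and> (\<forall>k\<in>others c. 0 < snd (x c) k \<and> v (\<pi> c, c) + v (k, c) / snd (x c) k = gap k c * fst (x c)) \<and>
      (\<Sum>k\<in>others c. (snd (x c) k)\<^sup>2 / v (k, c)) = 1 / v (\<pi> c, c)"
    by blast
  define s where "s c = fst (x c)" for c
  define q where "q c = snd (x c)" for c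
  have s: "0 < s c" and sum: "(\<Sum>k\<in>others c. (q c k)\<^sup>2 / v (k, c)) = 1 / v (\<pi> c, c)" if "c \<in> C" for c
    using x that unfolding s_def q_def by blast+
  have q: "0 < q c k" "v (\<pi> c, c) + v (k, c) / q c k = gap k c * s c" if "c \<in> C" "k \<in> others c" for c k
    using x that unfolding s_def q_def by blast+
  define \<beta> where "\<beta> z = (if fst z = \<pi> (snd z) then s (snd z) else q (snd z) (fst z) * s (snd z))" for z
  define T where "T = (\<Sum>z\<in>K \<times> C. \<beta> z)"
  have \<beta>: "0 < \<beta> z" if "z \<in> K \<times> C" for z
    using that s q(1) by (auto simp: \<beta>_def)
  have "K \<times> C \<noteq> {}"
    using K C by auto
  then have T: "0 < T"
    unfolding T_def using \<beta> K C by (intro sum_pos) auto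
  define p where "p z = \<beta> z / T" for z
  have p: "0 < p z" if "z \<in> K \<times> C" for z
    using \<beta>[OF that] T by (simp add: p_def)
  have "balanced p (1 / T)"
    unfolding balanced_def
  proof (intro conjI ballI)
    show "(\<Sum>z\<in>K \<times> C. p z) = 1"
      using T by (simp add: p_def sum_divide_distrib[symmetric] T_def[symmetric])
    fix c assume c: "c \<in> C"
    have "(\<Sum>k\<in>others c. (p (k, c))\<^sup>2 / v (k, c)) = (\<Sum>k\<in>others c. (s c / T)\<^sup>2 * ((q c k)\<^sup>2 / v (k, c)))"
      by (intro sum.cong) (auto simp: p_def \<beta>_def power_mult_distrib power_divide)
    also have "\<dots> = (s c / T)\<^sup>2 * (1 / v (\<pi> c, c))"
      unfolding sum_distrib_left[symmetric] sum[OF c] ..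
    finally show "(p (\<pi> c, c))\<^sup>2 / v (\<pi> c, c) = (\<Sum>k\<in>others c. (p (k, c))\<^sup>2 / v (k, c))"
      by (simp add: p_def \<beta>_def)
    fix k assume k: "k \<in> others c"
    have "v (\<pi> c, c) / p (\<pi> c, c) + v (k, c) / p (k, c) = (v (\<pi> c, c) + v (k, c) / q c k) * (T / s c)"
      using k by (simp add: p_def \<beta>_def distrib_right add_divide_distrib)
    also have "\<dots> = gap k c * T"
      using q(2)[OF c k] s[OF c] by simp
    finally show "eta F v \<pi> p k c = 1 / T"
      using p[of "(\<pi> c, c)"] p[of "(k, c)"] gap_pos[OF c k] k c best(1)[OF c] by (simp add: eta_def)
  qed (use p T in auto)
  then show ?thesis
    by blast
qed

text \<open>
  With the weights \<open>p\<^sup>2 / v\<close>, the tangents of the convex functions \<open>v / q\<close> at \<open>q = p\<close> add up to the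
  total mass of a context, so an allocation with no smaller \<open>eta\<close> would need more mass.
\<close>

lemma balanced_unique:
  assumes bal: "balanced p \<eta>0" and q: "q \<in> allocations K C"
    and eta: "\<And>c k. c \<in> C \<Longrightarrow> k \<in> others c \<Longrightarrow> \<eta>0 \<le> eta F v \<pi> q k c" and z: "z \<in> K \<times> C"
  shows "q z = p z"
proof -
  have p: "0 < p z" if "z \<in> K \<times> C" for z
    using bal that unfolding balanced_def by blast
  have \<eta>0: "0 < \<eta>0"
    using bal by (simp add: balanced_def)
  have q0: "0 \<le> q z" if "z \<in> K \<times> C" for z
    using q that unfolding allocations_def by blast
  have nz: "q (\<pi> c, c) \<noteq> 0 \<and> q (k, c) \<noteq> 0" if "c \<in> C" "k \<in> others c" for c k
    using eta[OF that] \<eta>0 by (auto simp: eta_def split: if_splits)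
  have qpos: "0 < q (k, c)" if ck: "c \<in> C" "k \<in> K" for c k
  proof (cases "k = \<pi> c")
    case True
    obtain k' where "k' \<in> others c"
      using others(2)[OF ck(1)] by blast
    then show ?thesis
      using nz[OF ck(1)] q0[of "(k, c)"] ck True by (auto simp: less_le)
  next
    case False
    then show ?thesis
      using nz[of c k] q0[of "(k, c)"] ck by (auto simp: less_le)
  qed
  define d where "d z = (q z - p z)\<^sup>2 / q z" for z
  \<comment> \<open>This is the tangent of \<open>v / q\<close> at \<open>q = p\<close> with its
    exact remainder, a positive multiple of \<open>d\<close>; so \<open>d\<close> keeps track of the
    deviation from \<open>p\<close>.\<close>
  have tangent: "v z / q z - v z / p z = (v z / (p z)\<^sup>2) * (d z - (q z - p z))" if "z \<in> K \<times> C" for z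
  proof -
    have "0 < q z" "0 < p z"
      using that qpos p by auto
    then show ?thesis
      unfolding d_def by (simp add: divide_simps) (simp add: power2_eq_square algebra_simps)
  qed
  have context_sum: "(\<Sum>k\<in>K. d (k, c)) \<le> (\<Sum>k\<in>K. q (k, c) - p (k, c))" if c: "c \<in> C" for c
  proof -
    have \<pi>c: "(\<pi> c, c) \<in> K \<times> C"
      using c best(1) by simp
    have bal_c: "(\<Sum>k\<in>others c. (p (k, c))\<^sup>2 / v (k, c)) = (p (\<pi> c, c))\<^sup>2 / v (\<pi> c, c)"
      using bal c by (simp add: balanced_def)
    define e where "e z = d z - (q z - p z)" for z
    \<comment> \<open>The comparison of \<open>eta\<close> for \<open>k\<close> is weighted by
      \<open>p\<^sup>2 / v\<close>, which makes the coefficient of \<open>e (k, c)\<close> equal to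
      1; after summation the balance condition does the same for
      \<open>e (\<pi> c, c)\<close>.\<close>
    have "(p (k, c))\<^sup>2 / v (k, c) * (v (\<pi> c, c) / (p (\<pi> c, c))\<^sup>2) * e (\<pi> c, c) + e (k, c) \<le> 0"
      if k: "k \<in> others c" for k
    proof -
      have kc: "(k, c) \<in> K \<times> C"
        using k c by simp
      have "eta F v \<pi> p k c \<le> eta F v \<pi> q k c"
        using eta[OF c k] bal c k by (simp add: balanced_def)
      then have "gap k c / (v (\<pi> c, c) / p (\<pi> c, c) + v (k, c) / p (k, c)) \<le> gap k c / (v (\<pi> c, c) / q (\<pi> c, c) + v (k, c) / q (k, c))"
        using nz[OF c k] p[OF \<pi>c] p[OF kc] by (simp add: eta_def)
      moreover have "0 < v (\<pi> c, c) / p (\<pi> c, c) + v (k, c) / p (k, c)" "0 < v (\<pi> c, c) / q (\<pi> c, c) + v (k, c) / q (k, c)"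
        using p[OF \<pi>c] p[OF kc] qpos[of c "\<pi> c"] qpos[of c k] v_pos[OF \<pi>c] v_pos[OF kc] c k best(1)[OF c]
        by (auto intro!: add_pos_pos)
      ultimately have "v (\<pi> c, c) / q (\<pi> c, c) + v (k, c) / q (k, c) \<le> v (\<pi> c, c) / p (\<pi> c, c) + v (k, c) / p (k, c)"
        using gap_pos[OF c k] by (simp add: frac_le_eq divide_simps split: if_splits)
      then have "(v (\<pi> c, c) / (p (\<pi> c, c))\<^sup>2) * e (\<pi> c, c) + (v (k, c) / (p (k, c))\<^sup>2) * e (k, c) \<le> 0"
        using tangent[OF \<pi>c] tangent[OF kc] unfolding e_def by linarith
      then have "(p (k, c))\<^sup>2 / v (k, c) * ((v (\<pi> c, c) / (p (\<pi> c, c))\<^sup>2) * e (\<pi> c, c) + (v (k, c) / (p (k, c))\<^sup>2) * e (k, c)) \<le> 0"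
        using v_pos[OF kc] by (intro mult_nonneg_nonpos) (auto intro: less_imp_le)
      then show ?thesis
        using v_pos[OF kc] p[OF kc] by (simp add: distrib_left)
    qed
    then have "(\<Sum>k\<in>others c. (p (k, c))\<^sup>2 / v (k, c) * (v (\<pi> c, c) / (p (\<pi> c, c))\<^sup>2) * e (\<pi> c, c) + e (k, c)) \<le> 0"
      by (intro sum_nonpos)
    also have "(\<Sum>k\<in>others c. (p (k, c))\<^sup>2 / v (k, c) * (v (\<pi> c, c) / (p (\<pi> c, c))\<^sup>2) * e (\<pi> c, c) + e (k, c)) =
        (p (\<pi> c, c))\<^sup>2 / v (\<pi> c, c) * (v (\<pi> c, c) / (p (\<pi> c, c))\<^sup>2) * e (\<pi> c, c) + (\<Sum>k\<in>others c. e (k, c))"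
      unfolding sum.distrib sum_distrib_right[symmetric] bal_c ..
    also have "\<dots> = e (\<pi> c, c) + (\<Sum>k\<in>others c. e (k, c))"
      using v_pos[OF \<pi>c] p[OF \<pi>c] by simp
    also have "\<dots> = (\<Sum>k\<in>K. e (k, c))"
      by (rule sum_K[OF c, symmetric])
    finally show ?thesis
      by (simp add: e_def sum_subtractf)
  qed
  have "(\<Sum>z\<in>K \<times> C. d z) = (\<Sum>c\<in>C. \<Sum>k\<in>K. d (k, c))"
    by (simp add: sum.cartesian_product' sum.swap[of _ C])
  also have "\<dots> \<le> (\<Sum>c\<in>C. \<Sum>k\<in>K. q (k, c) - p (k, c))"
    by (intro sum_mono context_sum)
  also have "\<dots> = (\<Sum>z\<in>K \<times> C. q z - p z)"
    by (simp add: sum.cartesian_product' sum.swap[of _ C])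
  also have "\<dots> = 0"
    using bal q by (simp add: sum_subtractf balanced_def allocations_def)
  \<comment> \<open>Both allocations have mass 1, so the nonnegative numbers \<open>d z\<close> have
    a sum of at most 0.\<close>
  finally have le: "(\<Sum>z\<in>K \<times> C. d z) \<le> 0" .
  have d: "0 \<le> d z" if "z \<in> K \<times> C" for z
    using that qpos by (auto simp: d_def intro!: divide_nonneg_pos)
  have "d z = 0"
  proof -
    have "d z \<le> (\<Sum>z\<in>K \<times> C. d z)"
      using z d K C by (intro member_le_sum) auto
    then show ?thesis
      using le d[OF z] by linarith
  qed
  then show ?thesis
    using z qpos[of "snd z" "fst z"] by (auto simp: d_def)
qed

lemma ld_rate_ge_iff: "x \<le> ld_rate F v K C p \<longleftrightarrow> (\<forall>c\<in>C. \<forall>k\<in>others c. x \<le> eta F v \<pi> p k c / 2)"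
  unfolding ld_rate_def using C others by (simp add: Min_ge_iff)

lemma ld_rate_balanced:
  assumes "balanced p \<eta>0"
  shows "ld_rate F v K C p = \<eta>0 / 2"
proof (rule antisym)
  show "\<eta>0 / 2 \<le> ld_rate F v K C p"
    using assms by (simp add: ld_rate_ge_iff balanced_def)
  obtain c k where "c \<in> C" "k \<in> others c"
    using C(2) others(2) by blast
  then show "ld_rate F v K C p \<le> \<eta>0 / 2"
    using ld_rate_ge_iff[of "ld_rate F v K C p" p] assms by (auto simp: balanced_def)
qed

text \<open>An allocation with rate at least \<open>\<eta>0 / 2\<close> has every \<open>eta\<close>
  at least \<open>\<eta>0\<close>, hence equals \<open>p\<close> by \<open>balanced_unique\<close>.
  This gives optimality and uniqueness at once; the agreement is on \<open>K \<times> C\<close>,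
  outside of which allocations are unconstrained.\<close>

lemma balanced_optimal:
  assumes "balanced p \<eta>0"
  shows "optimal_allocation F v K C p"
    and "\<And>q z. optimal_allocation F v K C q \<Longrightarrow> z \<in> K \<times> C \<Longrightarrow> q z = p z"
proof -
  have p: "p \<in> allocations K C"
    using assms by (auto simp: allocations_def balanced_def intro: less_imp_le)
  have ge: "q z = p z" if "q \<in> allocations K C" "ld_rate F v K C p \<le> ld_rate F v K C q" "z \<in> K \<times> C" for q z
    using that ld_rate_ge_iff[of "\<eta>0 / 2" q]
    by (intro balanced_unique[OF assms]) (auto simp: ld_rate_balanced[OF assms])
  show "optimal_allocation F v K C p"
    unfolding optimal_allocation_def is_arg_max_def
  proof (intro conjI p notI)
    assume "\<exists>q. q \<in> allocations K C \<and> ld_rate F v K C p < ld_rate F v K C q"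
    then obtain q where q: "q \<in> allocations K C" "ld_rate F v K C p < ld_rate F v K C q"
      by blast
    obtain c k where ck: "c \<in> C" "k \<in> others c"
      using C(2) others(2) by blast
    have "eta F v \<pi> q k c = eta F v \<pi> p k c"
      using ge[OF q(1) less_imp_le[OF q(2)]] ck best(1) by (simp add: eta_def)
    moreover have "ld_rate F v K C q \<le> eta F v \<pi> q k c / 2"
      using ld_rate_ge_iff[of "ld_rate F v K C q" q] ck by simp
    ultimately show False
      using q(2) ck assms by (simp add: ld_rate_balanced[OF assms] balanced_def)
  qed
  fix q z assume "optimal_allocation F v K C q" "z \<in> K \<times> C"
  then show "q z = p z"
    using p by (intro ge) (auto simp: optimal_allocation_def is_arg_max_def not_less)
qed

end

subsection \<open>The policy on a single sample path\<close>

locale ocba_path = ranking_problem K C F v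
  for K :: "'k set" and C :: "'c set" and F v :: "'k \<times> 'c \<Rightarrow> real" +
  fixes \<mu>0 :: "'k \<times> 'c \<Rightarrow> real" and \<Sigma>0 :: "'k \<times> 'c \<Rightarrow> ennreal" and N0 :: nat
    and x :: "nat \<Rightarrow> 'k \<times> 'c" and e :: "nat \<Rightarrow> real"
  assumes \<Sigma>0_pos: "\<And>z. z \<in> K \<times> C \<Longrightarrow> 0 < \<Sigma>0 z"
    and x_in: "\<And>n. x n \<in> K \<times> C"
    and initial: "\<And>z. z \<in> K \<times> C \<Longrightarrow> \<Sigma>0 z = \<infinity> \<Longrightarrow> \<exists>n<N0. x n = z"
    and policy: "gp_c_ocba_path K C \<mu>0 \<Sigma>0 v N0 x (\<lambda>n. F (x n) + e n)"
begin

abbreviation "lam \<equiv> prior_precision \<Sigma>0"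
abbreviation "N \<equiv> num_samples x"
abbreviation "mu \<equiv> post_mean \<mu>0 \<Sigma>0 v x (\<lambda>n. F (x n) + e n)"
abbreviation "S \<equiv> post_var \<Sigma>0 v x"

text \<open>
  The prior is worth \<open>lam z * v z\<close> samples of \<open>z\<close>.
\<close>

definition A :: "nat \<Rightarrow> 'k \<times> 'c \<Rightarrow> real" where
  "A n z = N n z + lam z * v z"

text \<open>This is \<open>n\<close> times the quotient \<open>sample_frac / S\<close> that occurs
  in \<open>psi1\<close> and \<open>psi2\<close>, so the test of the policy compares values of
  \<open>W\<close>. It is quadratic in the count.\<close>

definition W :: "nat \<Rightarrow> 'k \<times> 'c \<Rightarrow> real" where
  "W n z = N n z * A n z / v z"

lemma lam_nonneg: "0 \<le> lam z"
  by (simp add: prior_precision_def)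

lemma N_le_A: "z \<in> K \<times> C \<Longrightarrow> N n z \<le> A n z"
  using lam_nonneg[of z] v_pos[of z] by (simp add: A_def)

lemma A_nonneg: "z \<in> K \<times> C \<Longrightarrow> 0 \<le> A n z"
  using N_le_A[of z n] by linarith

lemma A_Suc: "A (Suc n) z = A n z + (if x n = z then 1 else 0)"
  by (simp add: A_def num_samples_Suc)

lemma A_mono: "m \<le> n \<Longrightarrow> A m z \<le> A n z"
  using num_samples_mono[of m n x z] by (simp add: A_def)

text \<open>For infinite prior variance \<open>lam z = 0\<close>, and positivity comes from the
  initial sample; otherwise the prior itself contributes a positive amount.\<close>

lemma A_pos: assumes "z \<in> K \<times> C" "N0 \<le> n" shows "0 < A n z"
proof (cases "\<Sigma>0 z = \<infinity>")
  case True
  then obtain i where "i < N0" "x i = z"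
    using initial[OF assms(1)] by blast
  then have "0 < N n z"
    using less_num_samples_iff[of "N i z" x n z] less_le_trans[OF _ assms(2)] by (metis gr_zeroI not_less_zero)
  then show ?thesis
    using N_le_A[OF assms(1), of n] by linarith
next
  case False
  then have "0 < 1 / \<Sigma>0 z" "1 / \<Sigma>0 z < \<infinity>"
    using \<Sigma>0_pos[OF assms(1)] by (auto simp: ennreal_zero_less_divide ennreal_divide_eq_top_iff less_top[symmetric])
  then have "0 < lam z"
    by (simp add: prior_precision_def enn2real_positive_iff)
  then show ?thesis
    using v_pos[OF assms(1)] by (simp add: A_def add_nonneg_pos)
qed

lemma A_tendsto_infinity:
  assumes "z \<in> K \<times> C" "filterlim (\<lambda>n. N n z) at_top sequentially"
  shows "filterlim (\<lambda>n. A n z) at_top sequentially"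
proof (rule filterlim_at_top_mono)
  show "filterlim (\<lambda>n. real (N n z)) at_top sequentially"
    by (rule filterlim_compose[OF filterlim_real_sequentially assms(2)])
  show "\<forall>\<^sub>F n in sequentially. real (N n z) \<le> A n z"
    using N_le_A[OF assms(1)] by simp
qed

lemma S_eq: "z \<in> K \<times> C \<Longrightarrow> S n z = v z / A n z"
  using v_pos[of z] by (simp add: post_var_def A_def field_simps)

lemma W_nonneg: "z \<in> K \<times> C \<Longrightarrow> 0 \<le> W n z"
  using A_nonneg[of z n] v_pos[of z] by (simp add: W_def)

lemma zeta_eq:
  assumes "c \<in> C" "k \<in> K" "b c \<in> K"
  shows "zeta (mu n) (S n) b k c =
    (mu n (b c, c) - mu n (k, c))\<^sup>2 / (v (b c, c) / A n (b c, c) + v (k, c) / A n (k, c))"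
  using assms by (simp add: zeta_def S_eq)

lemma mu_eq:
  assumes "z \<in> K \<times> C" "0 < A n z"
  shows "mu n z - F z = (lam z * v z * (\<mu>0 z - F z) + N n z * sample_mean x e n z) / A n z"
proof -
  have "real (N n z) * sample_mean x (\<lambda>n. F (x n) + e n) n z = N n z * F z + N n z * sample_mean x e n z"
  proof (cases "N n z = 0")
    case False
    have "(\<Sum>i | i < n \<and> x i = z. F (x i) + e i) = N n z * F z + (\<Sum>i | i < n \<and> x i = z. e i)"
      by (simp add: sum.distrib num_samples_def)
    then show ?thesis
      using False by (simp add: sample_mean_def)
  qed simp
  then have "mu n z = (\<mu>0 z * lam z + (N n z * F z + N n z * sample_mean x e n z) / v z) / (A n z / v z)"
    using v_pos[OF assms(1)] by (simp add: post_mean_def A_def add_divide_distrib add.commute[of "lam z"])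
  then have "mu n z * A n z = \<mu>0 z * lam z * v z + (N n z * F z + N n z * sample_mean x e n z)"
  proof -
    have "(P + Q / w) / (a / w) * a = P * w + Q" if "w \<noteq> 0" "a \<noteq> 0" for P Q w a :: real
      using that by (simp add: field_simps)
    then show ?thesis
      unfolding \<open>mu n z = _\<close> using assms(2) v_pos[OF assms(1)] by (metis order_less_irrefl)
  qed
  moreover have "mu n z - F z = (mu n z * A n z - F z * A n z) / A n z"
    using assms(2) by (simp add: diff_divide_distrib)
  ultimately show ?thesis
    by (simp add: A_def algebra_simps)
qed

lemma policy_step:
  assumes "N0 \<le> n"
  obtains b k c where "\<And>c'. c' \<in> C \<Longrightarrow> b c' \<in> K" "\<And>c' k'. c' \<in> C \<Longrightarrow> k' \<in> K \<Longrightarrow> mu n (k', c') \<le> mu n (b c', c')"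
    "c \<in> C" "k \<in> K" "k \<noteq> b c"
    "\<And>c' k'. c' \<in> C \<Longrightarrow> k' \<in> K \<Longrightarrow> k' \<noteq> b c' \<Longrightarrow> zeta (mu n) (S n) b k c \<le> zeta (mu n) (S n) b k' c'"
    "x n = (b c, c) \<and> W n (b c, c) < (\<Sum>k\<in>K - {b c}. W n (k, c)) \<or>
     x n = (k, c) \<and> (\<Sum>k\<in>K - {b c}. W n (k, c)) \<le> W n (b c, c)"
proof -
  have "gp_c_ocba_next K C (mu n) (S n) (sample_frac x n) (x n)"
    using policy assms unfolding gp_c_ocba_path_def by blast
  then obtain b k c where b: "\<forall>c'\<in>C. is_arg_max (\<lambda>k'. mu n (k', c')) (\<lambda>k'. k' \<in> K) (b c')"
    and kc: "is_arg_min (\<lambda>(k', c'). zeta (mu n) (S n) b k' c') (\<lambda>(k', c'). c' \<in> C \<and> k' \<in> K \<and> k' \<noteq> b c') (k, c)"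
    and x: "x n = (if psi1 (sample_frac x n) (S n) b c < psi2 K (sample_frac x n) (S n) b c then (b c, c) else (k, c))"
    unfolding gp_c_ocba_next_def by blast
  have bK: "b c' \<in> K" and bmax: "k' \<in> K \<Longrightarrow> mu n (k', c') \<le> mu n (b c', c')" if "c' \<in> C" for c' k'
    using b that by (auto simp: is_arg_max_def not_less)
  have c: "c \<in> C" "k \<in> K" "k \<noteq> b c"
    using kc by (auto simp: is_arg_min_def)
  have kcmin: "zeta (mu n) (S n) b k c \<le> zeta (mu n) (S n) b k' c'" if "c' \<in> C" "k' \<in> K" "k' \<noteq> b c'" for c' k'
    using kc that by (auto simp: is_arg_min_def not_less)
  have frac: "sample_frac x n z / S n z = W n z / n" if "z \<in> K \<times> C" for z
    using that by (simp add: sample_frac_def S_eq W_def)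
  have psi1: "psi1 (sample_frac x n) (S n) b c = W n (b c, c) / n"
    using frac[of "(b c, c)"] bK[OF c(1)] c(1) by (simp add: psi1_def)
  have psi2: "psi2 K (sample_frac x n) (S n) b c = (\<Sum>k\<in>K - {b c}. W n (k, c)) / n"
    unfolding psi2_def sum_divide_distrib using c(1) by (intro sum.cong) (auto simp: frac)
  have "psi1 (sample_frac x n) (S n) b c < psi2 K (sample_frac x n) (S n) b c \<longleftrightarrow>
      W n (b c, c) < (\<Sum>k\<in>K - {b c}. W n (k, c))"
  \<comment> \<open>At \<open>n = 0\<close> the fractions are 0 by \<open>x / 0 = 0\<close>, and so
    is \<open>W\<close>; both strict comparisons fail.\<close>
  proof (cases "n = 0")
    case True
    then show ?thesis
      unfolding psi1 psi2 by (simp add: W_def)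
  next
    case False
    then show ?thesis
      unfolding psi1 psi2 by (simp add: divide_less_cancel)
  qed
  then have "x n = (b c, c) \<and> W n (b c, c) < (\<Sum>k\<in>K - {b c}. W n (k, c)) \<or>
     x n = (k, c) \<and> (\<Sum>k\<in>K - {b c}. W n (k, c)) \<le> W n (b c, c)"
    using x by auto
  then show ?thesis
    using that bK bmax c kcmin by blast
qed

end

text \<open>\<open>a\<close> jumps only while \<open>a / b\<close> is nearly at most
  \<open>q\<close>. Once \<open>b\<close> is large, a jump of size at most \<open>\<kappa>\<close>
  from below \<open>(q + \<epsilon> / 2) * b\<close> ends below \<open>(q + \<epsilon>) * b\<close>,
  and between jumps the ratio cannot grow because \<open>b\<close> is nondecreasing.\<close>

lemma eventually_ratio_le:
  fixes a b :: "nat \<Rightarrow> real"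
  assumes b: "\<And>n. n0 \<le> n \<Longrightarrow> 0 < b n" "\<And>n. b n \<le> b (Suc n)" "filterlim b at_top sequentially"
    and a: "filterlim a at_top sequentially" and q: "0 \<le> q" and \<kappa>: "0 < \<kappa>"
    and step: "\<And>\<epsilon>. 0 < \<epsilon> \<Longrightarrow> \<forall>\<^sub>F n in sequentially. a (Suc n) = a n \<or> a (Suc n) \<le> a n + \<kappa> \<and> a n \<le> (q + \<epsilon>) * b n"
    and \<epsilon>: "0 < \<epsilon>"
  shows "\<forall>\<^sub>F n in sequentially. a n / b n \<le> q + \<epsilon>"
proof -
  have "\<forall>\<^sub>F n in sequentially. n0 \<le> n \<and> 2 * \<kappa> / \<epsilon> \<le> b n \<and>
      (a (Suc n) = a n \<or> a (Suc n) \<le> a n + \<kappa> \<and> a n \<le> (q + \<epsilon> / 2) * b n)"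
    using eventually_ge_at_top[of n0] filterlim_at_top[THEN iffD1, OF b(3), rule_format, of "2 * \<kappa> / \<epsilon>"] step[of "\<epsilon> / 2"] \<epsilon>
    by (auto simp: eventually_conj_iff)
  then obtain n1 where n1: "\<And>n. n1 \<le> n \<Longrightarrow> n0 \<le> n" "\<And>n. n1 \<le> n \<Longrightarrow> 2 * \<kappa> / \<epsilon> \<le> b n"
    "\<And>n. n1 \<le> n \<Longrightarrow> a (Suc n) = a n \<or> a (Suc n) \<le> a n + \<kappa> \<and> a n \<le> (q + \<epsilon> / 2) * b n"
    unfolding eventually_sequentially by blast
  have jump: "a (Suc n) \<le> (q + \<epsilon>) * b (Suc n)" if "n1 \<le> n" "a (Suc n) \<noteq> a n" for n
  proof -
    have "a (Suc n) \<le> (q + \<epsilon> / 2) * b n + \<kappa>"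
      using n1(3)[OF that(1)] that(2) by linarith
    also have "\<kappa> \<le> \<epsilon> / 2 * b n"
      using n1(2)[OF that(1)] \<epsilon> by (simp add: field_simps)
    also have "(q + \<epsilon> / 2) * b n + \<epsilon> / 2 * b n = (q + \<epsilon>) * b n"
      by (simp add: algebra_simps)
    also have "\<dots> \<le> (q + \<epsilon>) * b (Suc n)"
      using b(2)[of n] q \<epsilon> by (intro mult_left_mono) auto
    finally show ?thesis by simp
  qed
  \<comment> \<open>The bound has to be started by a jump, since nothing is known about the ratio
    before; a jump exists because \<open>a\<close> is unbounded.\<close>
  have "\<exists>m\<ge>n1. a (Suc m) \<noteq> a m"
  proof (rule ccontr)
    assume "\<not> (\<exists>m\<ge>n1. a (Suc m) \<noteq> a m)"
    then have *: "a (Suc m) = a m" if "n1 \<le> m" for m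
      using that by blast
    have "a n = a n1" if "n1 \<le> n" for n
      using that by (induction n rule: dec_induct) (auto simp: *)
    moreover have "\<forall>\<^sub>F n in sequentially. a n1 + 1 \<le> a n"
      using a by (simp add: filterlim_at_top)
    then obtain n2 where "\<And>n. n2 \<le> n \<Longrightarrow> a n1 + 1 \<le> a n"
      unfolding eventually_sequentially by blast
    then have "a n1 + 1 \<le> a (max n1 n2)"
      by simp
    ultimately show False
      by (metis add_le_same_cancel1 max.cobounded1 not_one_le_zero)
  qed
  then obtain m where m: "n1 \<le> m" "a (Suc m) \<noteq> a m"
    by blast
  have "a n \<le> (q + \<epsilon>) * b n" if "Suc m \<le> n" for n
    using that
  proof (induction n rule: dec_induct)
    case base
    then show ?case
      using jump m by blast
  next
    case (step n)
    show ?case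
    proof (cases "a (Suc n) = a n")
      case True
      have "(q + \<epsilon>) * b n \<le> (q + \<epsilon>) * b (Suc n)"
        using b(2)[of n] q \<epsilon> by (intro mult_left_mono) auto
      then show ?thesis
        using True step.IH by linarith
    next
      case False
      then show ?thesis
        using step.hyps m(1) by (intro jump) auto
    qed
  qed
  then have "a n / b n \<le> q + \<epsilon>" if "Suc m \<le> n" for n
    using that b(1)[of n] n1(1)[of n] m(1) by (simp add: pos_divide_le_eq)
  then show ?thesis
    unfolding eventually_sequentially by blast
qed

text \<open>A term falling short of its limit would have to be compensated by the others, which have
  no room above their own limits.\<close>

lemma tendsto_of_eventually_le_sum:
  fixes f :: "'i \<Rightarrow> nat \<Rightarrow> real"
  assumes I: "finite I" and le: "\<And>i \<epsilon>. i \<in> I \<Longrightarrow> 0 < \<epsilon> \<Longrightarrow> \<forall>\<^sub>F n in sequentially. f i n \<le> l i + \<epsilon>"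
    and sum: "(\<lambda>n. \<Sum>i\<in>I. f i n) \<longlonglongrightarrow> (\<Sum>i\<in>I. l i)" and i: "i \<in> I"
  shows "f i \<longlonglongrightarrow> l i"
proof (rule tendstoI)
  fix \<epsilon> :: real assume \<epsilon>: "0 < \<epsilon>"
  define n where "n = real (card I) + 1"
  have n: "1 \<le> n"
    by (simp add: n_def)
  have "\<forall>\<^sub>F m in sequentially. \<forall>j\<in>I. f j m \<le> l j + \<epsilon> / (2 * n)"
    using I le \<epsilon> n by (simp add: eventually_ball_finite)
  moreover have "\<forall>\<^sub>F m in sequentially. (\<Sum>i\<in>I. l i) - \<epsilon> / 2 < (\<Sum>i\<in>I. f i m)"
    using \<epsilon> by (intro order_tendstoD(1)[OF sum]) simp
  ultimately show "\<forall>\<^sub>F m in sequentially. dist (f i m) (l i) < \<epsilon>"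
  proof eventually_elim
    case (elim m)
    have "(\<Sum>j\<in>I - {i}. f j m) \<le> (\<Sum>j\<in>I - {i}. l j + \<epsilon> / (2 * n))"
      using elim(1) by (intro sum_mono) auto
    also have "\<dots> = (\<Sum>j\<in>I - {i}. l j) + real (card (I - {i})) * (\<epsilon> / (2 * n))"
      by (simp add: sum.distrib)
    also have "real (card (I - {i})) * (\<epsilon> / (2 * n)) \<le> n * (\<epsilon> / (2 * n))"
      using \<epsilon> n card_Diff1_le[of I i] by (intro mult_right_mono) (auto simp: n_def)
    also have "n * (\<epsilon> / (2 * n)) = \<epsilon> / 2"
      using n by simp
    finally have "l i - \<epsilon> < f i m"
      using elim(2) by (simp add: sum.remove[OF I i])
    moreover have "\<epsilon> / (2 * n) < \<epsilon>"
      using \<epsilon> n by (simp add: divide_less_eq)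
    ultimately show ?case
      using bspec[OF elim(1) i] by (simp add: dist_real_def abs_less_iff)
  qed
qed

subsection \<open>Convergence of the sample fractions\<close>

locale consistent_path = ocba_path K C F v \<mu>0 \<Sigma>0 N0 x e
  for K :: "'k set" and C :: "'c set" and F v \<mu>0 \<Sigma>0 N0 x e +
  fixes p :: "'k \<times> 'c \<Rightarrow> real" and \<eta>0 :: real
  assumes N_inf: "\<And>z. z \<in> K \<times> C \<Longrightarrow> filterlim (\<lambda>n. N n z) at_top sequentially"
    and mu_lim: "\<And>z. z \<in> K \<times> C \<Longrightarrow> (\<lambda>n. mu n z) \<longlonglongrightarrow> F z"
    and bal: "balanced p \<eta>0"
begin

abbreviation "gapn n k c \<equiv> (mu n (\<pi> c, c) - mu n (k, c))\<^sup>2"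
abbreviation "Z n k c \<equiv> gapn n k c / (v (\<pi> c, c) / A n (\<pi> c, c) + v (k, c) / A n (k, c))"
abbreviation "\<rho> n k c \<equiv> A n (k, c) / A n (\<pi> c, c)"
text \<open>By \<open>Z_eq\<close> this is \<open>A n (\<pi> c, c) / Z n k c\<close>. It depends on
  the counts only through the ratio \<open>\<rho>\<close> and the estimated gap, and minimizing
  \<open>Z\<close> within a context means maximizing it. Its target \<open>s c\<close> is common to
  all \<open>k\<close> by \<open>q_eq\<close>.\<close>

abbreviation "\<tau> n k c \<equiv> (v (\<pi> c, c) + v (k, c) / \<rho> n k c) / gapn n k c"
abbreviation "q k c \<equiv> p (k, c) / p (\<pi> c, c)"
abbreviation "s c \<equiv> p (\<pi> c, c) / \<eta>0"

lemma bestC: "c \<in> C \<Longrightarrow> (\<pi> c, c) \<in> K \<times> C"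
  using best(1) by simp

lemma p_pos: "z \<in> K \<times> C \<Longrightarrow> 0 < p z" and \<eta>0_pos: "0 < \<eta>0"
  using bal unfolding balanced_def by blast+

lemma bal_eta: "c \<in> C \<Longrightarrow> k \<in> others c \<Longrightarrow> eta F v \<pi> p k c = \<eta>0"
  and bal_sum: "c \<in> C \<Longrightarrow> (\<Sum>k\<in>others c. (p (k, c))\<^sup>2 / v (k, c)) = (p (\<pi> c, c))\<^sup>2 / v (\<pi> c, c)"
  and sum_p: "(\<Sum>z\<in>K \<times> C. p z) = 1"
  using bal unfolding balanced_def by auto

lemma q_pos: "c \<in> C \<Longrightarrow> k \<in> K \<Longrightarrow> 0 < q k c"
  using p_pos[of "(\<pi> c, c)"] p_pos[of "(k, c)"] bestC by simp

lemma s_pos: "c \<in> C \<Longrightarrow> 0 < s c"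
  using p_pos[OF bestC] \<eta>0_pos by simp

lemma q_eq:
  assumes "c \<in> C" "k \<in> others c"
  shows "v (\<pi> c, c) + v (k, c) / q k c = gap k c * s c"
proof -
  let ?D = "v (\<pi> c, c) / p (\<pi> c, c) + v (k, c) / p (k, c)"
  have pp: "0 < p (\<pi> c, c)" "0 < p (k, c)" "0 < v (\<pi> c, c)" "0 < v (k, c)"
    using assms p_pos v_pos bestC by auto
  have "gap k c / ?D = \<eta>0"
    using bal_eta[OF assms] pp by (simp add: eta_def)
  moreover have "0 < ?D"
    using pp by (auto intro!: add_pos_pos)
  ultimately have "gap k c = \<eta>0 * ?D"
    by (simp add: field_simps)
  then have "gap k c * s c = ?D * p (\<pi> c, c)"
    using \<eta>0_pos by simp
  also have "\<dots> = v (\<pi> c, c) + v (k, c) / q k c"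
    using pp by (simp add: distrib_right)
  finally show ?thesis by simp
qed

lemma sum_q: "c \<in> C \<Longrightarrow> (\<Sum>k\<in>others c. (q k c)\<^sup>2 / v (k, c)) = 1 / v (\<pi> c, c)"
proof -
  assume c: "c \<in> C"
  have "(\<Sum>k\<in>others c. (q k c)\<^sup>2 / v (k, c)) = (\<Sum>k\<in>others c. (p (k, c))\<^sup>2 / v (k, c)) / (p (\<pi> c, c))\<^sup>2"
    unfolding sum_divide_distrib by (intro sum.cong) (auto simp: power_divide)
  also have "\<dots> = 1 / v (\<pi> c, c)"
    using p_pos[OF bestC[OF c]] by (simp add: bal_sum[OF c])
  finally show ?thesis .
qed

lemma A_inf: "z \<in> K \<times> C \<Longrightarrow> filterlim (\<lambda>n. A n z) at_top sequentially"
  by (rule A_tendsto_infinity[OF _ N_inf])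

lemma gapn_lim: "c \<in> C \<Longrightarrow> k \<in> others c \<Longrightarrow> (\<lambda>n. gapn n k c) \<longlonglongrightarrow> gap k c"
  using bestC by (intro tendsto_power tendsto_diff mu_lim) auto

lemma eventually_best: "\<forall>\<^sub>F n in sequentially. \<forall>c\<in>C. \<forall>k\<in>others c. mu n (k, c) < mu n (\<pi> c, c)"
proof (intro eventually_ball_finite C others(1) ballI)
  fix c k assume ck: "c \<in> C" "k \<in> others c"
  have "(\<lambda>n. mu n (\<pi> c, c) - mu n (k, c)) \<longlonglongrightarrow> F (\<pi> c, c) - F (k, c)"
    using ck bestC by (intro tendsto_diff mu_lim) auto
  then have "\<forall>\<^sub>F n in sequentially. 0 < mu n (\<pi> c, c) - mu n (k, c)"
    using best(2)[OF ck] by (intro order_tendstoD(1)) auto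
  then show "\<forall>\<^sub>F n in sequentially. mu n (k, c) < mu n (\<pi> c, c)"
    by simp
qed

text \<open>The form of a policy step once the predicted best alternatives are the true ones.
  \<open>(k, c)\<close> is the minimizing pair even when the sample goes to
  \<open>\<pi> c\<close>.\<close>

definition choice :: "nat \<Rightarrow> 'k \<Rightarrow> 'c \<Rightarrow> bool" where
  "choice n k c \<longleftrightarrow> c \<in> C \<and> k \<in> others c \<and> (\<forall>c'\<in>C. \<forall>k'\<in>others c'. Z n k c \<le> Z n k' c') \<and>
     (x n = (\<pi> c, c) \<and> W n (\<pi> c, c) < (\<Sum>k\<in>others c. W n (k, c)) \<or>
      x n = (k, c) \<and> (\<Sum>k\<in>others c. W n (k, c)) \<le> W n (\<pi> c, c))"

lemma eventually_choice: "\<forall>\<^sub>F n in sequentially. \<exists>k c. choice n k c"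
  using eventually_best eventually_ge_at_top[of N0]
proof eventually_elim
  case (elim n)
  from elim(2) show ?case
  proof (rule policy_step)
    fix b k c
    assume b: "\<And>c'. c' \<in> C \<Longrightarrow> b c' \<in> K" "\<And>c' k'. c' \<in> C \<Longrightarrow> k' \<in> K \<Longrightarrow> mu n (k', c') \<le> mu n (b c', c')"
      and kc: "c \<in> C" "k \<in> K" "k \<noteq> b c"
      and min: "\<And>c' k'. c' \<in> C \<Longrightarrow> k' \<in> K \<Longrightarrow> k' \<noteq> b c' \<Longrightarrow> zeta (mu n) (S n) b k c \<le> zeta (mu n) (S n) b k' c'"
      and x: "x n = (b c, c) \<and> W n (b c, c) < (\<Sum>k\<in>K - {b c}. W n (k, c)) \<or>
        x n = (k, c) \<and> (\<Sum>k\<in>K - {b c}. W n (k, c)) \<le> W n (b c, c)"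
    have b\<pi>: "b c' = \<pi> c'" if "c' \<in> C" for c'
    proof (rule ccontr)
      assume "b c' \<noteq> \<pi> c'"
      then have "mu n (b c', c') < mu n (\<pi> c', c')"
        using elim(1) b(1) that by auto
      then show False
        using b(2)[OF that best(1)[OF that]] by simp
    qed
    have "Z n k c \<le> Z n k' c'" if "c' \<in> C" "k' \<in> others c'" for k' c'
      using min[of c' k'] that kc b\<pi>[OF that(1)] b\<pi>[OF kc(1)] best(1) by (simp add: zeta_eq)
    then have "choice n k c"
      using kc x b\<pi>[OF kc(1)] by (auto simp: choice_def)
    then show ?thesis
      by blast
  qed
qed

text \<open>Every sample in \<open>c\<close> moves the discrepancy toward 0 or across it, so its
  size can grow only by a crossing and is then at most one increment of \<open>W\<close>. As
  \<open>W\<close> is quadratic, its increments are linear in the counts.\<close>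

lemma balance_bounded:
  assumes c: "c \<in> C"
  shows "\<exists>B D. 0 \<le> B \<and> 0 \<le> D \<and> (\<forall>\<^sub>F n in sequentially.
    \<bar>W n (\<pi> c, c) - (\<Sum>k\<in>others c. W n (k, c))\<bar> \<le> B + D * (1 + (\<Sum>k\<in>K. real (N n (k, c)))))"
proof -
  define G where "G n = W n (\<pi> c, c) - (\<Sum>k\<in>others c. W n (k, c))" for n
  define T where "T n = (\<Sum>k\<in>K. real (N n (k, c)))" for n
  \<comment> \<open>An increment of \<open>W\<close> is \<open>(2 * N + lam * v + 1) / v\<close>, at
    most \<open>(lam * v + 2) / v * (1 + N)\<close>; \<open>D\<close> adds up these
    constants.\<close>
  define D where "D = (\<Sum>k\<in>K. (lam (k, c) * v (k, c) + 2) / v (k, c))"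
  have term_nonneg: "0 \<le> (lam (k, c) * v (k, c) + 2) / v (k, c)" if "k \<in> K" for k
    using that c v_pos[of "(k, c)"] lam_nonneg by (auto intro!: divide_nonneg_pos)
  have D: "0 \<le> D"
    unfolding D_def by (intro sum_nonneg term_nonneg)
  have T: "0 \<le> T n" "T n \<le> T (Suc n)" "k \<in> K \<Longrightarrow> real (N n (k, c)) \<le> T n" for n k
    unfolding T_def using K num_samples_mono[of n "Suc n" x]
    by (auto intro!: sum_nonneg sum_mono member_le_sum[of k K "\<lambda>k. real (N n (k, c))"])
  have incr: "0 \<le> W (Suc n) (k, c) - W n (k, c)" "W (Suc n) (k, c) - W n (k, c) \<le> D * (1 + T n)"
    if k: "k \<in> K" and xn: "x n = (k, c)" for n k
  proof -
    have v: "0 < v (k, c)"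
      using k c by (intro v_pos) simp
    have "W (Suc n) (k, c) = ((N n (k, c) + 1) * (A n (k, c) + 1)) / v (k, c)"
      using xn by (simp add: W_def A_Suc num_samples_Suc)
    then have eq: "W (Suc n) (k, c) - W n (k, c) = (N n (k, c) + A n (k, c) + 1) / v (k, c)"
      by (simp add: W_def diff_divide_distrib[symmetric] algebra_simps)
    then show "0 \<le> W (Suc n) (k, c) - W n (k, c)"
      using v k c A_nonneg[of "(k, c)" n] by auto
    have "N n (k, c) + A n (k, c) + 1 \<le> (lam (k, c) * v (k, c) + 2) * (1 + N n (k, c))"
      using lam_nonneg[of "(k, c)"] v by (simp add: A_def algebra_simps)
    then have "W (Suc n) (k, c) - W n (k, c) \<le> (lam (k, c) * v (k, c) + 2) * (1 + N n (k, c)) / v (k, c)"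
      unfolding eq using v by (intro divide_right_mono) auto
    also have "\<dots> = (lam (k, c) * v (k, c) + 2) / v (k, c) * (1 + N n (k, c))"
      by simp
    also have "\<dots> \<le> D * (1 + T n)"
      unfolding D_def using k K T(1)[of n] T(3)[OF k, of n] term_nonneg by (intro mult_mono member_le_sum add_mono) (auto intro!: sum_nonneg)
    finally show "W (Suc n) (k, c) - W n (k, c) \<le> D * (1 + T n)" .
  qed
  have same: "W (Suc n) z = W n z" if "x n \<noteq> z" for n z
    using that by (simp add: W_def A_Suc num_samples_Suc)
  obtain n1 where n1: "\<And>n. n1 \<le> n \<Longrightarrow> \<exists>k c. choice n k c"
    using eventually_choice unfolding eventually_sequentially by blast
  have "\<bar>G n\<bar> \<le> \<bar>G n1\<bar> + D * (1 + T n)" if "n1 \<le> n" for n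
    using that
  proof (induction n rule: dec_induct)
    case base
    show ?case
      using D T(1)[of n1] by simp
  next
    case (step n)
    obtain k c' where kc: "choice n k c'"
      using n1[OF step.hyps(1)] by blast
    have mono: "D * (1 + T n) \<le> D * (1 + T (Suc n))"
      using D T(2)[of n] by (intro mult_left_mono) auto
    have D1: "0 \<le> D * (1 + T n)"
      using D T(1)[of n] by simp
    show ?case
    proof (cases "c' = c")
      case False
      then have "snd (x n) \<noteq> c"
        using kc by (auto simp: choice_def)
      then have "W (Suc n) (k, c) = W n (k, c)" for k
        by (intro same) auto
      then show ?thesis
        using step.IH mono by (simp add: G_def)
    next
      case True
      then have kc: "choice n k c"
        using kc by simp
      have k: "k \<in> others c"
        using kc by (simp add: choice_def)
      have dis: "x n = (\<pi> c, c) \<and> G n < 0 \<or> x n = (k, c) \<and> 0 \<le> G n"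
        using kc unfolding choice_def G_def by auto
      have "\<bar>G (Suc n)\<bar> \<le> max \<bar>G n\<bar> (D * (1 + T n))"
        using dis
      proof
        assume *: "x n = (\<pi> c, c) \<and> G n < 0"
        have "(\<Sum>k\<in>others c. W (Suc n) (k, c)) = (\<Sum>k\<in>others c. W n (k, c))"
          using * by (intro sum.cong same) auto
        then have "G (Suc n) = G n + (W (Suc n) (\<pi> c, c) - W n (\<pi> c, c))"
          by (simp add: G_def)
        then show ?thesis
          using * incr[OF best(1)[OF c], of n] by linarith
      next
        assume *: "x n = (k, c) \<and> 0 \<le> G n"
        have "(\<Sum>k'\<in>others c - {k}. W (Suc n) (k', c)) = (\<Sum>k'\<in>others c - {k}. W n (k', c))"
          using * by (intro sum.cong same) auto
        then have "(\<Sum>k'\<in>others c. W (Suc n) (k', c)) = (\<Sum>k'\<in>others c. W n (k', c)) + (W (Suc n) (k, c) - W n (k, c))"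
          by (simp add: sum.remove[OF others(1) k])
        moreover have "W (Suc n) (\<pi> c, c) = W n (\<pi> c, c)"
          using * k by (intro same) auto
        ultimately have "G (Suc n) = G n - (W (Suc n) (k, c) - W n (k, c))"
          by (simp add: G_def)
        then show ?thesis
          using * incr[of k n] k by force
      qed
      then show ?thesis
        using step.IH mono D1 by linarith
    qed
  qed
  then have "\<forall>\<^sub>F n in sequentially. \<bar>G n\<bar> \<le> \<bar>G n1\<bar> + D * (1 + T n)"
    unfolding eventually_sequentially by blast
  then show ?thesis
    using D unfolding G_def T_def by (intro exI[of _ "\<bar>G n1\<bar>"] exI[of _ D]) (auto simp: G_def)
qed


text \<open>Division by the square of \<open>A n (\<pi> c, c)\<close> removes the linear error of
  \<open>balance_bounded\<close>, provided that the total count of the context is of the order of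
  \<open>A n (\<pi> c, c)\<close>. That provision follows from the balance itself.\<close>

lemma sum_rho_tendsto:
  assumes c: "c \<in> C"
  shows "(\<lambda>n. \<Sum>k\<in>others c. (\<rho> n k c)\<^sup>2 / v (k, c)) \<longlonglongrightarrow> 1 / v (\<pi> c, c)"
proof -
  obtain B D where BD: "0 \<le> B" "0 \<le> D" and G: "\<forall>\<^sub>F n in sequentially.
    \<bar>W n (\<pi> c, c) - (\<Sum>k\<in>others c. W n (k, c))\<bar> \<le> B + D * (1 + (\<Sum>k\<in>K. real (N n (k, c))))"
    using balance_bounded[OF c] by blast
  define U where "U n = (\<Sum>k\<in>K. A n (k, c))" for n
  define a where "a n = A n (\<pi> c, c)" for n
  define Q where "Q n = (\<Sum>k\<in>others c. (A n (k, c))\<^sup>2 / v (k, c))" for n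
  define \<Lambda> where "\<Lambda> = (\<Sum>k\<in>K. lam (k, c))"
  define B1 where "B1 = B + D"
  define B2 where "B2 = D + \<Lambda>"
  define V where "V = (\<Sum>k\<in>K. v (k, c))"
  have kc: "(k, c) \<in> K \<times> C" if "k \<in> K" for k
    using that c by simp
  have \<Lambda>: "0 \<le> \<Lambda>"
    unfolding \<Lambda>_def by (intro sum_nonneg lam_nonneg)
  have B12: "0 \<le> B1" "0 \<le> B2"
    using BD \<Lambda> by (auto simp: B1_def B2_def)
  have vpos: "0 < v (k, c)" if "k \<in> K" for k
    by (rule v_pos[OF kc[OF that]])
  have V: "v (k, c) \<le> V" if "k \<in> K" for k
    unfolding V_def using that K vpos by (intro member_le_sum) (auto intro: less_imp_le)
  have V0: "0 < V"
    using V[OF best(1)[OF c]] vpos[OF best(1)[OF c]] by simp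
  have A0: "0 \<le> A n (k, c)" if "k \<in> K" for n k
    by (rule A_nonneg[OF kc[OF that]])
  have U: "A n (k, c) \<le> U n" if "k \<in> K" for n k
    unfolding U_def using that K A0 by (intro member_le_sum) auto
  \<comment> \<open>The prior makes \<open>W\<close> differ from \<open>A\<^sup>2 / v\<close> only
    by a linear term, which joins the linear error.\<close>
  have W_eq: "W n z = (A n z)\<^sup>2 / v z - lam z * A n z" if "z \<in> K \<times> C" for n z
  proof -
    have "N n z = A n z - lam z * v z"
      by (simp add: A_def)
    then show ?thesis
      unfolding W_def using v_pos[OF that] by (simp only:) (simp add: field_simps power2_eq_square)
  qed
  have diff: "\<forall>\<^sub>F n in sequentially. \<bar>Q n - (a n)\<^sup>2 / v (\<pi> c, c)\<bar> \<le> B1 + B2 * U n"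
    using G
  proof eventually_elim
    case (elim n)
    have "Q n = (\<Sum>k\<in>others c. W n (k, c)) + (\<Sum>k\<in>others c. lam (k, c) * A n (k, c))"
      unfolding Q_def sum.distrib[symmetric] using c by (intro sum.cong) (auto simp: W_eq)
    moreover have "(a n)\<^sup>2 / v (\<pi> c, c) = W n (\<pi> c, c) + lam (\<pi> c, c) * A n (\<pi> c, c)"
      using W_eq[OF bestC[OF c]] by (simp add: a_def)
    ultimately have "\<bar>Q n - (a n)\<^sup>2 / v (\<pi> c, c)\<bar> \<le>
        \<bar>W n (\<pi> c, c) - (\<Sum>k\<in>others c. W n (k, c))\<bar> + \<bar>(\<Sum>k\<in>others c. lam (k, c) * A n (k, c)) - lam (\<pi> c, c) * A n (\<pi> c, c)\<bar>"
      by linarith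
    also have "\<bar>(\<Sum>k\<in>others c. lam (k, c) * A n (k, c)) - lam (\<pi> c, c) * A n (\<pi> c, c)\<bar> \<le> \<Lambda> * U n"
    proof -
      have "0 \<le> (\<Sum>k\<in>others c. lam (k, c) * A n (k, c))" "0 \<le> lam (\<pi> c, c) * A n (\<pi> c, c)"
        using A0 lam_nonneg best(1)[OF c] by (auto intro!: sum_nonneg mult_nonneg_nonneg)
      moreover have "lam (\<pi> c, c) * A n (\<pi> c, c) + (\<Sum>k\<in>others c. lam (k, c) * A n (k, c)) \<le> \<Lambda> * U n"
      proof -
        have "(\<Sum>k\<in>K. lam (k, c) * A n (k, c)) \<le> \<Lambda> * U n"
          unfolding \<Lambda>_def sum_distrib_right using U lam_nonneg by (intro sum_mono mult_left_mono) auto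
        then show ?thesis
          by (simp add: sum_K[OF c])
      qed
      ultimately show ?thesis
        by linarith
    qed
    also have "\<bar>W n (\<pi> c, c) - (\<Sum>k\<in>others c. W n (k, c))\<bar> \<le> B + D * (1 + U n)"
    proof -
      have "(\<Sum>k\<in>K. real (N n (k, c))) \<le> U n"
        unfolding U_def using N_le_A[OF kc] by (intro sum_mono) auto
      then have "D * (1 + (\<Sum>k\<in>K. real (N n (k, c)))) \<le> D * (1 + U n)"
        using BD(2) by (intro mult_left_mono) auto
      then show ?thesis
        using elim by linarith
    qed
    finally show ?case
      by (simp add: B1_def B2_def algebra_simps)
  qed
  define c1 where "c1 = real (card K) * V"
  have c1: "0 < c1"
    using V0 K by (simp add: c1_def)
  have U2: "(U n)\<^sup>2 \<le> c1 * ((a n)\<^sup>2 / v (\<pi> c, c) + Q n)" for n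
  proof -
    have "(U n)\<^sup>2 \<le> (\<Sum>k\<in>K. (A n (k, c))\<^sup>2) * real (card K)"
      unfolding U_def by (rule sum_squared_le_sum_of_squares)
    also have "(\<Sum>k\<in>K. (A n (k, c))\<^sup>2) \<le> (\<Sum>k\<in>K. V * ((A n (k, c))\<^sup>2 / v (k, c)))"
    proof (rule sum_mono)
      fix k assume k: "k \<in> K"
      have "v (k, c) * ((A n (k, c))\<^sup>2 / v (k, c)) \<le> V * ((A n (k, c))\<^sup>2 / v (k, c))"
        using V[OF k] vpos[OF k] by (intro mult_right_mono) auto
      then show "(A n (k, c))\<^sup>2 \<le> V * ((A n (k, c))\<^sup>2 / v (k, c))"
        using vpos[OF k] by simp
    qed
    also have "\<dots> = V * ((a n)\<^sup>2 / v (\<pi> c, c) + Q n)"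
      unfolding sum_distrib_left[symmetric] sum_K[OF c] a_def Q_def ..
    finally show ?thesis
      by (simp add: c1_def mult_ac mult_right_mono)
  qed
  have a_inf: "filterlim a at_top sequentially"
    unfolding a_def[abs_def] by (rule A_inf[OF bestC[OF c]])
  define C2 where "C2 = sqrt (4 * c1 / v (\<pi> c, c))"
  have U_inf: "filterlim U at_top sequentially"
    by (rule filterlim_at_top_mono[OF a_inf]) (use U[OF best(1)[OF c]] in \<open>simp add: a_def\<close>)
  have "\<forall>\<^sub>F n in sequentially. 1 \<le> U n \<and> 2 * c1 * (B1 + B2) \<le> U n"
    using U_inf by (simp add: filterlim_at_top eventually_conj_iff)
  \<comment> \<open>A self-bounding estimate: \<open>U\<^sup>2\<close> is at most a multiple of
    \<open>a\<^sup>2\<close> plus a term linear in \<open>U\<close>, and for large \<open>U\<close>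
    the latter is absorbed by \<open>U\<^sup>2 / 2\<close>.\<close>
  then have UC: "\<forall>\<^sub>F n in sequentially. U n \<le> C2 * a n"
    using diff
  proof eventually_elim
    case (elim n)
    have "c1 * (B1 + B2 * U n) \<le> c1 * ((B1 + B2) * U n)"
      using elim(1) B12 c1 mult_left_mono[of 1 "U n" B1] by (intro mult_left_mono) (auto simp: algebra_simps)
    also have "\<dots> = (2 * c1 * (B1 + B2)) * U n / 2"
      by simp
    also have "\<dots> \<le> U n * U n / 2"
      using elim(1) by (intro divide_right_mono mult_right_mono) auto
    finally have "c1 * (B1 + B2 * U n) \<le> (U n)\<^sup>2 / 2"
      by (simp add: power2_eq_square)
    moreover have "(U n)\<^sup>2 \<le> c1 * (2 * ((a n)\<^sup>2 / v (\<pi> c, c)) + (B1 + B2 * U n))"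
    proof (rule order_trans[OF U2])
      show "c1 * ((a n)\<^sup>2 / v (\<pi> c, c) + Q n) \<le> c1 * (2 * ((a n)\<^sup>2 / v (\<pi> c, c)) + (B1 + B2 * U n))"
        using c1 elim(2) by (intro mult_left_mono) auto
    qed
    moreover have "c1 * (2 * ((a n)\<^sup>2 / v (\<pi> c, c)) + (B1 + B2 * U n)) =
        4 * c1 / v (\<pi> c, c) * (a n)\<^sup>2 / 2 + c1 * (B1 + B2 * U n)"
      by (simp add: distrib_left)
    moreover have "x \<le> r" if "p \<le> x / 2" "x \<le> y" "y = r / 2 + p" for x y r p :: real
      using that by linarith
    ultimately have "(U n)\<^sup>2 \<le> 4 * c1 / v (\<pi> c, c) * (a n)\<^sup>2"
      by blast
    then have "sqrt ((U n)\<^sup>2) \<le> sqrt (4 * c1 / v (\<pi> c, c) * (a n)\<^sup>2)"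
      by (rule real_sqrt_le_mono)
    also have "\<dots> = C2 * a n"
      unfolding C2_def real_sqrt_mult using A0[OF best(1)[OF c], of n] by (simp add: a_def)
    finally show ?case
      using elim(1) by simp
  qed
  have "\<forall>\<^sub>F n in sequentially. norm ((\<Sum>k\<in>others c. (\<rho> n k c)\<^sup>2 / v (k, c)) - 1 / v (\<pi> c, c)) \<le> (B1 + B2 * C2) / a n"
    using UC diff filterlim_at_top[THEN iffD1, OF a_inf, rule_format, of 1]
  proof eventually_elim
    case (elim n)
    have "(\<Sum>k\<in>others c. (\<rho> n k c)\<^sup>2 / v (k, c)) - 1 / v (\<pi> c, c) = (Q n - (a n)\<^sup>2 / v (\<pi> c, c)) / (a n)\<^sup>2"
      using elim(3) by (simp add: Q_def a_def diff_divide_distrib sum_divide_distrib power_divide mult_ac)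
    also have "norm \<dots> \<le> (B1 + B2 * U n) / (a n)\<^sup>2"
      using elim(2) by (auto simp: abs_divide intro: divide_right_mono)
    also have "\<dots> \<le> (B1 * a n + B2 * (C2 * a n)) / (a n)\<^sup>2"
      using elim B12 mult_left_mono[of 1 "a n" B1] by (intro divide_right_mono add_mono mult_left_mono) auto
    also have "\<dots> = (B1 + B2 * C2) / a n"
      using elim(3) by (simp add: power2_eq_square add_divide_distrib)
    finally show ?case .
  qed
  moreover have "(\<lambda>n. (B1 + B2 * C2) / a n) \<longlonglongrightarrow> 0"
    by (intro tendsto_divide_0[OF tendsto_const] filterlim_at_top_imp_at_infinity a_inf)
  ultimately show ?thesis
    by (rule Lim_null_comparison[THEN LIM_zero_cancel])
qed


lemma eventually_A_pos: "\<forall>\<^sub>F n in sequentially. \<forall>z\<in>K \<times> C. 0 < A n z"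
  using eventually_ge_at_top[of N0] by eventually_elim (use A_pos in blast)

lemma eventually_gapn_pos:
  assumes "c \<in> C"
  shows "\<forall>\<^sub>F n in sequentially. \<forall>k\<in>others c. 0 < gapn n k c"
  using gapn_lim[OF assms] gap_pos[OF assms]
  by (intro eventually_ball_finite others(1) ballI) (rule order_tendstoD(1))

lemma Z_eq:
  assumes "c \<in> C" "k \<in> others c" "0 < A n (\<pi> c, c)" "0 < A n (k, c)"
  shows "Z n k c = A n (\<pi> c, c) / \<tau> n k c"
proof -
  have "v (\<pi> c, c) / A n (\<pi> c, c) + v (k, c) / A n (k, c) = (v (\<pi> c, c) + v (k, c) / \<rho> n k c) / A n (\<pi> c, c)"
    using assms(3,4) by (simp add: add_divide_distrib)
  then show ?thesis
    by simp
qed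

lemma tau_pos:
  assumes "c \<in> C" "k \<in> others c" "0 < A n (\<pi> c, c)" "0 < A n (k, c)" "0 < gapn n k c"
  shows "0 < \<tau> n k c"
proof -
  have "0 < v (\<pi> c, c)" "0 < v (k, c)"
    using assms(1,2) bestC v_pos by auto
  then show ?thesis
    using assms by (intro divide_pos_pos add_pos_pos) auto
qed

text \<open>
  Since the squares of the ratios have the right weighted sum in the limit, not all of them can exceed
  their targets.
\<close>

lemma eventually_some_tau_ge:
  assumes c: "c \<in> C" and \<eta>: "0 < \<eta>"
  shows "\<forall>\<^sub>F n in sequentially. \<exists>k\<in>others c. s c - \<eta> \<le> \<tau> n k c"
proof -
  \<comment> \<open>By continuity a slack \<open>\<delta>\<close> in the ratios costs less than
    \<open>\<eta>\<close> in \<open>\<tau>\<close>; one \<open>\<delta>\<close> works for the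
    finitely many \<open>k\<close>.\<close>
  have "\<forall>\<^sub>F \<delta> in at_right 0. \<forall>k\<in>others c. s c - \<eta> < (v (\<pi> c, c) + v (k, c) / (q k c + \<delta>)) / gap k c"
  proof (intro eventually_ball_finite others(1) ballI)
    fix k assume k: "k \<in> others c"
    have "((\<lambda>\<delta>. (v (\<pi> c, c) + v (k, c) / (q k c + \<delta>)) / gap k c) \<longlongrightarrow> (v (\<pi> c, c) + v (k, c) / (q k c + 0)) / gap k c) (at_right 0)"
      using gap_pos[OF c k] q_pos[of c k] c k by (intro tendsto_intros) auto
    moreover have "(v (\<pi> c, c) + v (k, c) / (q k c + 0)) / gap k c = s c"
      using q_eq[OF c k] gap_pos[OF c k] by simp
    ultimately show "\<forall>\<^sub>F \<delta> in at_right 0. s c - \<eta> < (v (\<pi> c, c) + v (k, c) / (q k c + \<delta>)) / gap k c"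
      using \<eta> by (intro order_tendstoD(1)) auto
  qed
  then have "\<forall>\<^sub>F \<delta> in at_right 0. 0 < \<delta> \<and> (\<forall>k\<in>others c. s c - \<eta> < (v (\<pi> c, c) + v (k, c) / (q k c + \<delta>)) / gap k c)"
    using eventually_at_right_less[of "0::real"] by eventually_elim simp
  then obtain \<delta> where \<delta>: "0 < \<delta>" and tau: "\<And>k. k \<in> others c \<Longrightarrow> s c - \<eta> < (v (\<pi> c, c) + v (k, c) / (q k c + \<delta>)) / gap k c"
    using eventually_happens'[OF trivial_limit_at_right_real] by blast
  have "\<forall>\<^sub>F n in sequentially. \<forall>k\<in>others c. s c - \<eta> < (v (\<pi> c, c) + v (k, c) / (q k c + \<delta>)) / gapn n k c"
  proof (intro eventually_ball_finite others(1) ballI)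
    fix k assume k: "k \<in> others c"
    have "(\<lambda>n. (v (\<pi> c, c) + v (k, c) / (q k c + \<delta>)) / gapn n k c) \<longlonglongrightarrow> (v (\<pi> c, c) + v (k, c) / (q k c + \<delta>)) / gap k c"
      using gap_pos[OF c k] by (intro tendsto_divide tendsto_const gapn_lim[OF c k]) simp
    then show "\<forall>\<^sub>F n in sequentially. s c - \<eta> < (v (\<pi> c, c) + v (k, c) / (q k c + \<delta>)) / gapn n k c"
      using tau[OF k] by (rule order_tendstoD(1))
  qed
  moreover have "\<forall>\<^sub>F n in sequentially. (\<Sum>k\<in>others c. (\<rho> n k c)\<^sup>2 / v (k, c)) < (\<Sum>k\<in>others c. (q k c + \<delta>)\<^sup>2 / v (k, c))"
  proof (rule order_tendstoD(2)[OF sum_rho_tendsto[OF c]])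
    show "1 / v (\<pi> c, c) < (\<Sum>k\<in>others c. (q k c + \<delta>)\<^sup>2 / v (k, c))"
      unfolding sum_q[OF c, symmetric]
    proof (rule sum_strict_mono)
      fix k assume k: "k \<in> others c"
      have "(q k c)\<^sup>2 < (q k c + \<delta>)\<^sup>2"
        using \<delta> q_pos[of c k] c k by (intro power_strict_mono) auto
      then show "(q k c)\<^sup>2 / v (k, c) < (q k c + \<delta>)\<^sup>2 / v (k, c)"
        using v_pos[of "(k, c)"] c k by (intro divide_strict_right_mono) auto
    qed (use others c in auto)
  qed
  ultimately show ?thesis
    using eventually_A_pos eventually_gapn_pos[OF c]
  proof eventually_elim
    case (elim n)
    have Apos: "0 < A n (\<pi> c, c)" "\<And>k. k \<in> others c \<Longrightarrow> 0 < A n (k, c)"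
      using elim(3) bestC[OF c] c by auto
    have gp: "0 < gapn n k c" if "k \<in> others c" for k
      using elim(4) that by blast
    obtain k where k: "k \<in> others c" "\<rho> n k c \<le> q k c + \<delta>"
    proof (rule ccontr)
      assume "\<not> thesis"
      then have *: "q k c + \<delta> < \<rho> n k c" if "k \<in> others c" for k
        using that \<open>\<And>k. k \<in> others c \<Longrightarrow> \<rho> n k c \<le> q k c + \<delta> \<Longrightarrow> thesis\<close> not_le by blast
      have "(\<Sum>k\<in>others c. (q k c + \<delta>)\<^sup>2 / v (k, c)) \<le> (\<Sum>k\<in>others c. (\<rho> n k c)\<^sup>2 / v (k, c))"
      proof (rule sum_mono)
        fix k assume k: "k \<in> others c"
        have "(q k c + \<delta>)\<^sup>2 \<le> (\<rho> n k c)\<^sup>2"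
          using *[OF k] \<delta> q_pos[of c k] c k by (intro power_mono) auto
        then show "(q k c + \<delta>)\<^sup>2 / v (k, c) \<le> (\<rho> n k c)\<^sup>2 / v (k, c)"
          using v_pos[of "(k, c)"] c k by (intro divide_right_mono) auto
      qed
      then show False
        using elim(2) by simp
    qed
    have "v (k, c) / (q k c + \<delta>) \<le> v (k, c) / \<rho> n k c"
      using k Apos v_pos[of "(k, c)"] c q_pos[of c k] \<delta> by (intro divide_left_mono mult_pos_pos add_pos_pos) auto
    then have "(v (\<pi> c, c) + v (k, c) / (q k c + \<delta>)) / gapn n k c \<le> \<tau> n k c"
      using gp[OF k(1)] by (intro divide_right_mono) auto
    then have "s c - \<eta> \<le> \<tau> n k c"
      using elim(1) k(1) by force
    then show ?case
      using k(1) by blast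
  qed
qed

text \<open>The chosen \<open>k\<close> maximizes \<open>\<tau>\<close> in its context, so by
  \<open>eventually_some_tau_ge\<close> its \<open>\<tau>\<close> is nearly at least
  \<open>s c\<close>. Since \<open>\<tau>\<close> decreases in \<open>\<rho>\<close> and is near
  \<open>s c\<close> at the target ratio, \<open>\<rho>\<close> cannot exceed the target by more
  than \<open>\<epsilon>\<close>.\<close>

lemma eventually_chosen_rho_le:
  assumes c: "c \<in> C" and k: "k \<in> others c" and \<epsilon>: "0 < \<epsilon>"
  shows "\<forall>\<^sub>F n in sequentially. choice n k c \<longrightarrow> \<rho> n k c \<le> q k c + \<epsilon>"
proof -
  have qp: "0 < q k c" and vp: "0 < v (k, c)" and gp: "0 < gap k c"
    using q_pos[of c k] v_pos[of "(k, c)"] gap_pos[OF c k] c k by auto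
  \<comment> \<open>With this \<open>\<eta>\<close>,
    \<open>(s c - \<eta>) * gap k c - v (\<pi> c, c)\<close> is the midpoint of
    \<open>v (k, c) / (q k c + \<epsilon>)\<close> and \<open>v (k, c) / q k c\<close>, which leaves
    room for replacing \<open>gap\<close> by its estimate.\<close>
  define \<eta> where "\<eta> = (v (k, c) / q k c - v (k, c) / (q k c + \<epsilon>)) / (2 * gap k c)"
  have lt: "v (k, c) / (q k c + \<epsilon>) < v (k, c) / q k c"
    using qp vp \<epsilon> by (intro divide_strict_left_mono mult_pos_pos add_pos_pos) auto
  then have \<eta>: "0 < \<eta>"
    unfolding \<eta>_def using gp by simp
  have "(\<lambda>n. (s c - \<eta>) * gapn n k c - v (\<pi> c, c)) \<longlonglongrightarrow> (s c - \<eta>) * gap k c - v (\<pi> c, c)"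
    by (intro tendsto_intros gapn_lim c k)
  moreover have "v (k, c) / (q k c + \<epsilon>) < (s c - \<eta>) * gap k c - v (\<pi> c, c)"
  proof -
    have "\<eta> * gap k c = (v (k, c) / q k c - v (k, c) / (q k c + \<epsilon>)) / 2"
      using gp by (simp add: \<eta>_def)
    moreover have "v (k, c) / q k c = gap k c * s c - v (\<pi> c, c)"
      using q_eq[OF c k] by linarith
    moreover have "(s c - \<eta>) * gap k c = gap k c * s c - \<eta> * gap k c"
      by (simp add: left_diff_distrib)
    moreover have "u < t - w" if "d = (r - u) / 2" "r = g - w" "t = g - d" "u < r" for d r u g w t :: real
      using that by (simp add: field_simps)
    ultimately show ?thesis
      using lt by blast
  qed
  ultimately have "\<forall>\<^sub>F n in sequentially. v (k, c) / (q k c + \<epsilon>) < (s c - \<eta>) * gapn n k c - v (\<pi> c, c)"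
    by (rule order_tendstoD(1))
  then show ?thesis
    using eventually_some_tau_ge[OF c \<eta>] eventually_A_pos
      eventually_gapn_pos[OF c]
  proof eventually_elim
    case (elim n)
    have Apos: "0 < A n (\<pi> c, c)" "\<And>k. k \<in> others c \<Longrightarrow> 0 < A n (k, c)"
      using elim(3) bestC[OF c] c by auto
    have gp: "0 < gapn n k c" if "k \<in> others c" for k
      using elim(4) that by blast
    show ?case
    proof
      assume choice: "choice n k c"
      obtain k' where k': "k' \<in> others c" "s c - \<eta> \<le> \<tau> n k' c"
        using elim(2) by blast
      have "Z n k c \<le> Z n k' c"
        using choice k' c by (simp add: choice_def)
      then have "A n (\<pi> c, c) / \<tau> n k c \<le> A n (\<pi> c, c) / \<tau> n k' c"
        unfolding Z_eq[OF c k Apos(1) Apos(2)[OF k]] Z_eq[OF c k'(1) Apos(1) Apos(2)[OF k'(1)]] .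
      moreover have "t' \<le> t" if "a / t \<le> a / t'" "0 < a" "0 < t" "0 < t'" for a t t' :: real
        using that by (simp add: field_simps)
      ultimately have "\<tau> n k' c \<le> \<tau> n k c"
        using Apos(1) tau_pos[OF c k Apos(1) Apos(2)[OF k] gp[OF k]] tau_pos[OF c k'(1) Apos(1) Apos(2)[OF k'(1)] gp[OF k'(1)]]
        by blast
      then have "s c - \<eta> \<le> (v (\<pi> c, c) + v (k, c) / \<rho> n k c) / gapn n k c"
        using k'(2) by simp
      then have "(s c - \<eta>) * gapn n k c \<le> v (\<pi> c, c) + v (k, c) / \<rho> n k c"
        using gp[OF k] by (simp add: pos_le_divide_eq)
      then have "v (k, c) / (q k c + \<epsilon>) < v (k, c) / \<rho> n k c"
        using elim(1) by linarith
      moreover have "0 < \<rho> n k c"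
        using Apos k by simp
      ultimately show "\<rho> n k c \<le> q k c + \<epsilon>"
        using vp qp \<epsilon> by (smt (verit) divide_left_mono mult_pos_pos)
    qed
  qed
qed

text \<open>\<open>A n (k, c)\<close> grows only when \<open>k\<close> is chosen, so
  \<open>eventually_ratio_le\<close> bounds the ratios from above. Their weighted squares have the
  right sum in the limit, so \<open>tendsto_of_eventually_le_sum\<close> upgrades these bounds to
  limits.\<close>

lemma rho_tendsto:
  assumes c: "c \<in> C" and k: "k \<in> others c"
  shows "(\<lambda>n. \<rho> n k c) \<longlonglongrightarrow> q k c"
proof -
  have le: "\<forall>\<^sub>F n in sequentially. \<rho> n k c \<le> q k c + \<epsilon>" if k: "k \<in> others c" and "0 < \<epsilon>" for k \<epsilon>
  proof (rule eventually_ratio_le[where ?n0.0 = N0 and \<kappa> = 1])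
    show "0 < A n (\<pi> c, c)" if "N0 \<le> n" for n
      using A_pos[OF bestC[OF c] that] .
    show "A n (\<pi> c, c) \<le> A (Suc n) (\<pi> c, c)" for n
      by (rule A_mono) simp
    show "filterlim (\<lambda>n. A n (\<pi> c, c)) at_top sequentially" "filterlim (\<lambda>n. A n (k, c)) at_top sequentially"
      using c k bestC by (auto intro: A_inf)
    show "0 \<le> q k c"
      using q_pos[OF c, of k] k by simp
    show "\<forall>\<^sub>F n in sequentially. A (Suc n) (k, c) = A n (k, c) \<or>
        A (Suc n) (k, c) \<le> A n (k, c) + 1 \<and> A n (k, c) \<le> (q k c + \<epsilon>) * A n (\<pi> c, c)" if "0 < \<epsilon>" for \<epsilon>
      using eventually_choice eventually_chosen_rho_le[OF c k that] eventually_A_pos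
    proof eventually_elim
      case (elim n)
      obtain k' c' where ch: "choice n k' c'"
        using elim(1) by blast
      show ?case
      proof (cases "x n = (k, c)")
        case True
        then have "choice n k c"
          using ch k by (auto simp: choice_def)
        then have "\<rho> n k c \<le> q k c + \<epsilon>"
          using elim(2) by blast
        moreover have "0 < A n (\<pi> c, c)"
          using elim(3) bestC[OF c] by blast
        ultimately have "A n (k, c) \<le> (q k c + \<epsilon>) * A n (\<pi> c, c)"
          by (simp add: pos_divide_le_eq)
        then show ?thesis
          by (simp add: A_Suc)
      qed (simp add: A_Suc)
    qed
  qed (use that in auto)
  have "(\<lambda>n. (\<rho> n k c)\<^sup>2 / v (k, c)) \<longlonglongrightarrow> (q k c)\<^sup>2 / v (k, c)"
  proof (rule tendsto_of_eventually_le_sum[OF others(1) _ _ k, where f = "\<lambda>k n. (\<rho> n k c)\<^sup>2 / v (k, c)" and l = "\<lambda>k. (q k c)\<^sup>2 / v (k, c)"])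
    show "(\<lambda>n. \<Sum>k\<in>others c. (\<rho> n k c)\<^sup>2 / v (k, c)) \<longlonglongrightarrow> (\<Sum>k\<in>others c. (q k c)\<^sup>2 / v (k, c))"
      unfolding sum_q[OF c] by (rule sum_rho_tendsto[OF c])
    fix k \<epsilon> assume k: "k \<in> others c" and \<epsilon>: "0 < (\<epsilon> :: real)"
    have vp: "0 < v (k, c)"
      using c k by (intro v_pos) simp
    have "((\<lambda>\<delta>. (q k c + \<delta>)\<^sup>2 / v (k, c)) \<longlongrightarrow> (q k c + 0)\<^sup>2 / v (k, c)) (at_right 0)"
      using vp by (intro tendsto_intros) auto
    then have "\<forall>\<^sub>F \<delta> in at_right 0. (q k c + \<delta>)\<^sup>2 / v (k, c) < (q k c)\<^sup>2 / v (k, c) + \<epsilon>"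
      using \<epsilon> by (intro order_tendstoD(2)) auto
    then have "\<forall>\<^sub>F \<delta> in at_right 0. 0 < \<delta> \<and> (q k c + \<delta>)\<^sup>2 / v (k, c) < (q k c)\<^sup>2 / v (k, c) + \<epsilon>"
      using eventually_at_right_less[of "0::real"] by eventually_elim simp
    then obtain \<delta> where \<delta>: "0 < \<delta>" "(q k c + \<delta>)\<^sup>2 / v (k, c) < (q k c)\<^sup>2 / v (k, c) + \<epsilon>"
      using eventually_happens'[OF trivial_limit_at_right_real] by blast
    show "\<forall>\<^sub>F n in sequentially. (\<rho> n k c)\<^sup>2 / v (k, c) \<le> (q k c)\<^sup>2 / v (k, c) + \<epsilon>"
      using le[OF k \<delta>(1)] eventually_A_pos
    proof eventually_elim
      case (elim n)
      have "0 < A n (\<pi> c, c)" "0 < A n (k, c)"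
        using elim(2) bestC[OF c] c k by auto
      then have "(\<rho> n k c)\<^sup>2 \<le> (q k c + \<delta>)\<^sup>2"
        using elim(1) by (intro power_mono) auto
      then have "(\<rho> n k c)\<^sup>2 / v (k, c) \<le> (q k c + \<delta>)\<^sup>2 / v (k, c)"
        using vp by (intro divide_right_mono) auto
      then show ?case
        using \<delta>(2) by linarith
    qed
  qed
  then have "(\<lambda>n. sqrt ((\<rho> n k c)\<^sup>2 / v (k, c) * v (k, c))) \<longlonglongrightarrow> sqrt ((q k c)\<^sup>2 / v (k, c) * v (k, c))"
    by (intro tendsto_real_sqrt tendsto_mult tendsto_const)
  moreover have "sqrt ((\<rho> n k c)\<^sup>2 / v (k, c) * v (k, c)) = \<rho> n k c" for n
    using v_pos[of "(k, c)"] c k A_nonneg[of "(k, c)" n] A_nonneg[OF bestC[OF c], of n] by simp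
  moreover have "sqrt ((q k c)\<^sup>2 / v (k, c) * v (k, c)) = q k c"
  proof -
    have "y\<^sup>2 / w * w = y\<^sup>2" if "0 < w" for y w :: real
      using that by simp
    moreover have "0 < v (k, c)" and qp: "0 < q k c"
      using v_pos[of "(k, c)"] c k q_pos[OF c, of k] by auto
    ultimately show ?thesis
      by (simp only: real_sqrt_abs abs_of_pos[OF qp])
  qed
  ultimately show ?thesis
    by simp
qed

end

text \<open>Suited to the ratio of two contexts: the policy gives upper bounds only, but exchanging
  the contexts gives one for the inverse, which acts as a lower bound.\<close>

lemma tendsto_of_eventually_le_inverse:
  fixes f :: "'a \<Rightarrow> real"
  assumes r: "0 < r" and pos: "\<forall>\<^sub>F n in G. 0 < f n"
    and up: "\<And>\<epsilon>. 0 < \<epsilon> \<Longrightarrow> \<forall>\<^sub>F n in G. f n \<le> r + \<epsilon>"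
    and lo: "\<And>\<epsilon>. 0 < \<epsilon> \<Longrightarrow> \<forall>\<^sub>F n in G. inverse (f n) \<le> inverse r + \<epsilon>"
  shows "(f \<longlongrightarrow> r) G"
proof (rule order_tendstoI)
  fix a assume a: "r < a"
  have "\<forall>\<^sub>F n in G. f n \<le> r + (a - r) / 2"
    using a by (intro up) simp
  then show "\<forall>\<^sub>F n in G. f n < a"
    by eventually_elim (use a in \<open>simp add: field_simps\<close>)
next
  fix a assume a: "a < r"
  define b where "b = max a (r / 2)"
  have b: "0 < b" "a \<le> b" "b < r"
    using a r by (auto simp: b_def)
  then have "inverse r < inverse b"
    by simp
  then have "\<forall>\<^sub>F n in G. inverse (f n) \<le> inverse r + (inverse b - inverse r) / 2"
    by (intro lo) simp
  then show "\<forall>\<^sub>F n in G. a < f n"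
    using pos
  proof eventually_elim
    case (elim n)
    have "inverse (f n) < inverse b"
    proof -
      have "u < w" if "u \<le> y + (w - y) / 2" "y < w" for u w y :: real
        using that by (simp add: field_simps)
      then show ?thesis
        using elim(1) \<open>inverse r < inverse b\<close> by blast
    qed
    then have "b < f n"
      using elim(2) b(1) by simp
    then show ?case
      using b(2) by linarith
  qed
qed

section \<open>Comparison of different contexts\<close>

context consistent_path
begin

lemma tau_tendsto:
  assumes c: "c \<in> C" and k: "k \<in> others c"
  shows "(\<lambda>n. \<tau> n k c) \<longlonglongrightarrow> s c"
proof -
  have "(\<lambda>n. \<tau> n k c) \<longlonglongrightarrow> (v (\<pi> c, c) + v (k, c) / q k c) / gap k c"
    using gap_pos[OF c k] q_pos[OF c, of k] k
    by (intro tendsto_divide tendsto_add tendsto_const gapn_lim[OF c k] rho_tendsto[OF c k]) auto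
  then show ?thesis
    using q_eq[OF c k] gap_pos[OF c k] by simp
qed

text \<open>The minimal index is \<open>A n (\<pi> c, c) / \<tau> n k c\<close> with
  \<open>\<tau>\<close> close to \<open>s c\<close>, so in the chosen context
  \<open>A n (\<pi> c, c) / s c\<close> is nearly at most its value in any other context.\<close>

lemma eventually_chosen_context_le:
  assumes c: "c \<in> C" "c' \<in> C" and \<epsilon>: "0 < \<epsilon>"
  shows "\<forall>\<^sub>F n in sequentially. \<forall>k. choice n k c \<longrightarrow> A n (\<pi> c, c) \<le> (s c / s c' + \<epsilon>) * A n (\<pi> c', c')"
proof -
  obtain k' where k': "k' \<in> others c'"
    using others(2)[OF c(2)] by blast
  have "\<forall>\<^sub>F n in sequentially. \<forall>k\<in>others c. \<tau> n k c / \<tau> n k' c' < s c / s c' + \<epsilon>"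
  proof (intro eventually_ball_finite others(1) ballI)
    fix k assume k: "k \<in> others c"
    have "(\<lambda>n. \<tau> n k c / \<tau> n k' c') \<longlonglongrightarrow> s c / s c'"
      by (intro tendsto_divide[OF tau_tendsto[OF c(1) k] tau_tendsto[OF c(2) k']] less_imp_neq[OF s_pos[OF c(2)], symmetric])
    then show "\<forall>\<^sub>F n in sequentially. \<tau> n k c / \<tau> n k' c' < s c / s c' + \<epsilon>"
      by (rule order_tendstoD(2)) (use \<epsilon> in simp)
  qed
  then show ?thesis
    using eventually_A_pos eventually_gapn_pos[OF c(1)] eventually_gapn_pos[OF c(2)]
  proof eventually_elim
    case (elim n)
    show ?case
    proof (intro allI impI)
      fix k assume ch: "choice n k c"
      then have k: "k \<in> others c"
        by (simp add: choice_def)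
      have A: "0 < A n (\<pi> c, c)" "0 < A n (\<pi> c', c')" "0 < A n (k, c)" "0 < A n (k', c')"
        using elim(2) bestC c k k' by auto
      have t: "0 < \<tau> n k c" "0 < \<tau> n k' c'"
        using tau_pos[OF c(1) k A(1,3)] tau_pos[OF c(2) k' A(2,4)] elim(3,4) k k' by blast+
      have "Z n k c \<le> Z n k' c'"
        using ch c k' by (simp add: choice_def)
      then have "A n (\<pi> c, c) / \<tau> n k c \<le> A n (\<pi> c', c') / \<tau> n k' c'"
        unfolding Z_eq[OF c(1) k A(1,3)] Z_eq[OF c(2) k' A(2,4)] .
      moreover have "a \<le> t / t' * a'" if "a / t \<le> a' / t'" "0 < t" "0 < t'" for a a' t t' :: real
        using that by (simp add: field_simps)
      ultimately have "A n (\<pi> c, c) \<le> \<tau> n k c / \<tau> n k' c' * A n (\<pi> c', c')"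
        using t by blast
      also have "\<dots> \<le> (s c / s c' + \<epsilon>) * A n (\<pi> c', c')"
        using elim(1) k A(2) by (intro mult_right_mono) (auto intro: less_imp_le)
      finally show "A n (\<pi> c, c) \<le> (s c / s c' + \<epsilon>) * A n (\<pi> c', c')" .
    qed
  qed
qed

lemma eventually_context_ratio_le:
  assumes c: "c \<in> C" "c' \<in> C" and "0 < \<epsilon>"
  shows "\<forall>\<^sub>F n in sequentially. A n (\<pi> c, c) / A n (\<pi> c', c') \<le> s c / s c' + \<epsilon>"
proof (rule eventually_ratio_le[where ?n0.0 = N0 and \<kappa> = 1])
  show "0 < A n (\<pi> c', c')" if "N0 \<le> n" for n
    using A_pos[OF bestC[OF c(2)] that] .
  show "A n (\<pi> c', c') \<le> A (Suc n) (\<pi> c', c')" for n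
    by (rule A_mono) simp
  show "filterlim (\<lambda>n. A n (\<pi> c', c')) at_top sequentially" "filterlim (\<lambda>n. A n (\<pi> c, c)) at_top sequentially"
    using c bestC by (auto intro: A_inf)
  show "0 \<le> s c / s c'"
    by (rule less_imp_le[OF divide_pos_pos[OF s_pos[OF c(1)] s_pos[OF c(2)]]])
  show "\<forall>\<^sub>F n in sequentially. A (Suc n) (\<pi> c, c) = A n (\<pi> c, c) \<or>
      A (Suc n) (\<pi> c, c) \<le> A n (\<pi> c, c) + 1 \<and> A n (\<pi> c, c) \<le> (s c / s c' + \<epsilon>) * A n (\<pi> c', c')" if "0 < \<epsilon>" for \<epsilon>
    using eventually_choice eventually_chosen_context_le[OF c that]
  proof eventually_elim
    case (elim n)
    obtain k d where ch: "choice n k d"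
      using elim(1) by blast
    show ?case
    proof (cases "x n = (\<pi> c, c)")
      case True
      then have "choice n k c"
        using ch by (auto simp: choice_def)
      then have "A n (\<pi> c, c) \<le> (s c / s c' + \<epsilon>) * A n (\<pi> c', c')"
        using elim(2) by blast
      moreover have "A (Suc n) (\<pi> c, c) \<le> A n (\<pi> c, c) + 1"
        by (simp add: A_Suc)
      ultimately show ?thesis
        by blast
    qed (simp add: A_Suc)
  qed
qed (use assms in auto)

lemma context_ratio_tendsto:
  assumes c: "c \<in> C" "c' \<in> C"
  shows "(\<lambda>n. A n (\<pi> c, c) / A n (\<pi> c', c')) \<longlonglongrightarrow> s c / s c'"
proof (rule tendsto_of_eventually_le_inverse)
  show "0 < s c / s c'"
    by (rule divide_pos_pos[OF s_pos[OF c(1)] s_pos[OF c(2)]])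
  show "\<forall>\<^sub>F n in sequentially. 0 < A n (\<pi> c, c) / A n (\<pi> c', c')"
    using eventually_A_pos by eventually_elim (use bestC c in auto)
  fix \<epsilon> :: real assume \<epsilon>: "0 < \<epsilon>"
  show "\<forall>\<^sub>F n in sequentially. A n (\<pi> c, c) / A n (\<pi> c', c') \<le> s c / s c' + \<epsilon>"
    by (rule eventually_context_ratio_le[OF c \<epsilon>])
  show "\<forall>\<^sub>F n in sequentially. inverse (A n (\<pi> c, c) / A n (\<pi> c', c')) \<le> inverse (s c / s c') + \<epsilon>"
    unfolding inverse_divide by (rule eventually_context_ratio_le[OF c(2,1) \<epsilon>])
qed

text \<open>Relative to one reference count \<open>a n\<close>, each count tends to the
  corresponding ratio of \<open>p\<close>, and the prior share of \<open>A\<close> vanishes. The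
  counts add up to \<open>n\<close> and \<open>p\<close> to 1, which identifies the limit of
  \<open>n / a n\<close> and removes the reference.\<close>

theorem sample_frac_tendsto:
  assumes z: "z \<in> K \<times> C"
  shows "(\<lambda>n. sample_frac x n z) \<longlonglongrightarrow> p z"
proof -
  obtain d where d: "d \<in> C"
    using C(2) by blast
  define a where "a n = A n (\<pi> d, d)" for n
  have pd: "0 < p (\<pi> d, d)"
    by (rule p_pos[OF bestC[OF d]])
  have a_inf: "filterlim a at_top sequentially"
    unfolding a_def[abs_def] by (rule A_inf[OF bestC[OF d]])
  have Aa: "(\<lambda>n. A n z / a n) \<longlonglongrightarrow> p z / p (\<pi> d, d)" if z: "z \<in> K \<times> C" for z
  proof -
    obtain k c where kc: "z = (k, c)" "k \<in> K" "c \<in> C"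
      using z by blast
    have "s c / s d = p (\<pi> c, c) / p (\<pi> d, d)"
      using \<eta>0_pos by simp
    then have lim: "(\<lambda>n. A n (\<pi> c, c) / a n) \<longlonglongrightarrow> p (\<pi> c, c) / p (\<pi> d, d)"
      using context_ratio_tendsto[OF kc(3) d] unfolding a_def by (simp only:)
    show ?thesis
    proof (cases "k = \<pi> c")
      case True
      then show ?thesis
        using lim kc by simp
    next
      case False
      then have "(\<lambda>n. \<rho> n k c * (A n (\<pi> c, c) / a n)) \<longlonglongrightarrow> q k c * (p (\<pi> c, c) / p (\<pi> d, d))"
        using kc by (intro tendsto_mult rho_tendsto lim) auto
      moreover have "q k c * (p (\<pi> c, c) / p (\<pi> d, d)) = p z / p (\<pi> d, d)"
        using p_pos[OF bestC[OF kc(3)]] kc by simp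
      moreover have "\<forall>\<^sub>F n in sequentially. \<rho> n k c * (A n (\<pi> c, c) / a n) = A n z / a n"
        using eventually_A_pos
      proof eventually_elim
        case (elim n)
        then have "0 < A n (\<pi> c, c)"
          using bestC[OF kc(3)] by blast
        then show ?case
          by (simp add: kc)
      qed
      ultimately show ?thesis
        by (simp only: tendsto_cong)
    qed
  qed
  have Na: "(\<lambda>n. N n z / a n) \<longlonglongrightarrow> p z / p (\<pi> d, d)" if z: "z \<in> K \<times> C" for z
  proof -
    have "(\<lambda>n. lam z * v z / a n) \<longlonglongrightarrow> 0"
      by (intro tendsto_divide_0[OF tendsto_const] filterlim_at_top_imp_at_infinity a_inf)
    then have "(\<lambda>n. A n z / a n - lam z * v z / a n) \<longlonglongrightarrow> p z / p (\<pi> d, d) - 0"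
      by (intro tendsto_diff Aa z)
    then show ?thesis
      by (simp add: A_def add_divide_distrib)
  qed
  have total: "(\<Sum>z\<in>K \<times> C. real (N n z)) = real n" for n
  proof (induction n)
    case (Suc n)
    have "(\<Sum>z\<in>K \<times> C. real (N (Suc n) z)) = (\<Sum>z\<in>K \<times> C. real (N n z)) + (\<Sum>z\<in>K \<times> C. if z = x n then 1 else 0)"
      unfolding sum.distrib[symmetric] by (intro sum.cong) (auto simp: num_samples_Suc)
    then show ?case
      using Suc x_in[of n] K C by (simp add: sum.delta)
  qed simp
  have "(\<lambda>n. \<Sum>z\<in>K \<times> C. N n z / a n) \<longlonglongrightarrow> (\<Sum>z\<in>K \<times> C. p z / p (\<pi> d, d))"
    by (intro tendsto_sum Na)
  then have "(\<lambda>n. real n / a n) \<longlonglongrightarrow> 1 / p (\<pi> d, d)"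
    by (simp add: sum_divide_distrib[symmetric] total sum_p)
  then have "(\<lambda>n. (N n z / a n) / (real n / a n)) \<longlonglongrightarrow> (p z / p (\<pi> d, d)) / (1 / p (\<pi> d, d))"
    by (intro tendsto_divide[OF Na[OF z]]) (use pd in simp_all)
  moreover have "\<forall>\<^sub>F n in sequentially. (N n z / a n) / (real n / a n) = sample_frac x n z"
    using filterlim_at_top_dense[THEN iffD1, OF a_inf, rule_format, of 0]
    by eventually_elim (simp add: sample_frac_def)
  moreover have "(p z / p (\<pi> d, d)) / (1 / p (\<pi> d, d)) = p z"
    using pd by simp
  ultimately show ?thesis
    by (simp only: tendsto_cong)
qed

end

subsection \<open>Every pair is sampled infinitely often\<close>

text \<open>
  A combinatorial form of the blocking argument: among the counters \<open>us\<close>, listed from the highest to the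
  lowest estimate, the first one blocks the later ones once it has entered the window, and cannot
  itself run away from them.
\<close>

lemma crossing_bound:
  fixes cnt :: "nat \<Rightarrow> 'k \<Rightarrow> nat"
  assumes Suc_cnt: "\<And>n j. cnt n j \<le> cnt (Suc n) j" "\<And>n j. cnt (Suc n) j \<le> Suc (cnt n j)"
    and single: "\<And>n i j. cnt (Suc n) i \<noteq> cnt n i \<Longrightarrow> cnt (Suc n) j \<noteq> cnt n j \<Longrightarrow> i = j"
    and block: "\<And>n i j. n0 \<le> n \<Longrightarrow> i \<in> T \<Longrightarrow> j \<in> T \<Longrightarrow> high i j \<Longrightarrow> cnt n i \<in> {m..L * m} \<Longrightarrow> cnt n j \<in> {m..L * m} \<Longrightarrow>
      cnt (Suc n) j = cnt n j"
    and balance: "\<And>n B u. n0 \<le> n \<Longrightarrow> u \<in> T \<Longrightarrow> m \<le> B \<Longrightarrow> (\<And>j. j \<in> T \<Longrightarrow> j \<noteq> u \<Longrightarrow> cnt n j \<le> B) \<Longrightarrow> cnt n u = R * B \<Longrightarrow>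
      cnt (Suc n) u = cnt n u"
    and start: "\<And>j. j \<in> T \<Longrightarrow> cnt n0 j < m" and R: "1 \<le> R"
    and us: "sorted_wrt high us" "set us \<subseteq> T" "distinct us" "R ^ length us \<le> L"
    and n: "n0 \<le> n" and outside: "\<And>j. j \<in> T \<Longrightarrow> j \<notin> set us \<Longrightarrow> cnt n j < m" and j: "j \<in> set us"
  shows "cnt n j \<le> R ^ length us * m"
  using us n outside j
proof (induction us arbitrary: n j)
  case (Cons u us)
  \<comment> \<open>The counters after \<open>u\<close> never exceed \<open>B\<close>, and
    \<open>u\<close> itself may be higher by one factor \<open>R\<close> from the balance. Both
    bounds lie inside the window because \<open>R * B \<le> L * m\<close>.\<close>
  define B where "B = R ^ length us * m"
  have mB: "m \<le> B"
    using R by (simp add: B_def)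
  have BRB: "B \<le> R * B"
    using R by simp
  have RBL: "R * B \<le> L * m"
    using Cons.prems(4) by (simp add: B_def)
  have uT: "u \<in> T" and usT: "set us \<subseteq> T" and u_us: "u \<notin> set us"
    using Cons.prems by auto
  have RL: "R ^ length us \<le> L"
  proof -
    have "R ^ length us \<le> R ^ length (u # us)"
      using R by simp
    then show ?thesis
      using Cons.prems(4) by (rule order_trans)
  qed
  have IH: "cnt n j \<le> B" if "n0 \<le> n" "\<And>j. j \<in> T \<Longrightarrow> j \<notin> set us \<Longrightarrow> cnt n j < m" "j \<in> set us" for n j
    unfolding B_def using Cons.prems RL that by (intro Cons.IH) auto
  \<comment> \<open>Induction over time. The condition on the outside counters is kept as a premise;
    since counts are monotone, it passes from \<open>Suc n\<close> back to \<open>n\<close>.\<close>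
  have "(\<forall>j\<in>T. j \<notin> set (u # us) \<longrightarrow> cnt n j < m) \<longrightarrow> (\<forall>j\<in>set us. cnt n j \<le> B) \<and> cnt n u \<le> R * B"
    using \<open>n0 \<le> n\<close>
  proof (induction n rule: dec_induct)
    case base
    show ?case
      using start uT usT mB BRB by (meson dual_order.strict_implies_order order_trans subsetD)
  next
    case (step n)
    show ?case
    proof (intro impI)
      assume out: "\<forall>j\<in>T. j \<notin> set (u # us) \<longrightarrow> cnt (Suc n) j < m"
      then have out_n: "\<forall>j\<in>T. j \<notin> set (u # us) \<longrightarrow> cnt n j < m"
        using Suc_cnt(1) le_less_trans by blast
      have bounds: "\<forall>j\<in>set us. cnt n j \<le> B" "cnt n u \<le> R * B"
        using step.IH out_n by auto
      show "(\<forall>j\<in>set us. cnt (Suc n) j \<le> B) \<and> cnt (Suc n) u \<le> R * B"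
      \<comment> \<open>As long as \<open>u\<close> is below the window it is itself an outside
        counter, and the induction hypothesis for the shorter list applies.\<close>
      proof (cases "cnt (Suc n) u < m")
        case True
        then have "cnt (Suc n) j < m" if "j \<in> T" "j \<notin> set us" for j
          using that out by (cases "j = u") auto
        then have "\<forall>j\<in>set us. cnt (Suc n) j \<le> B"
          using step.hyps by (intro ballI IH) auto
        moreover have "cnt (Suc n) u \<le> R * B"
          using True mB BRB by linarith
        ultimately show ?thesis
          by blast
      next
        case False
        show ?thesis
        proof (intro conjI ballI)
          fix j assume j: "j \<in> set us"
          show "cnt (Suc n) j \<le> B"
          \<comment> \<open>If \<open>u\<close> enters the window in this very step, no other
            counter moves.\<close>
          proof (cases "cnt n u < m")
            case True
            then have "cnt (Suc n) u \<noteq> cnt n u"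
              using False by simp
            then have "cnt (Suc n) j = cnt n j"
              using single j u_us by metis
            then show ?thesis
              using bounds j by simp
          next
            case in_window: False
            show ?thesis
            proof (cases "cnt n j = B")
              case True
              \<comment> \<open>A later counter that has reached \<open>B\<close> is in the window
                together with \<open>u\<close>, so \<open>u\<close> blocks it.\<close>
              have "cnt (Suc n) j = cnt n j"
              proof (rule block)
                show "high u j"
                  using Cons.prems(1) j by simp
                show "cnt n u \<in> {m..L * m}" "cnt n j \<in> {m..L * m}"
                  using in_window bounds(2) RBL order_trans[OF BRB RBL] mB True by auto
              qed (use step.hyps uT usT j in auto)
              then show ?thesis
                using True by simp
            next
              case False
              then have "cnt n j < B"
                using bounds(1) j by (simp add: le_neq_implies_less)
              then show ?thesis
                using Suc_cnt(2)[of n j] by linarith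
            qed
          qed
        next
          show "cnt (Suc n) u \<le> R * B"
          proof (cases "cnt n u = R * B")
            case True
            have "cnt (Suc n) u = cnt n u"
            proof (rule balance)
              show "cnt n j \<le> B" if "j \<in> T" "j \<noteq> u" for j
              proof (cases "j \<in> set us")
                case True then show ?thesis using bounds(1) by blast
              next
                case False
                then have "cnt n j < m"
                  using out_n that by simp
                then show ?thesis
                  using mB by simp
              qed
            qed (use step.hyps uT mB True in auto)
            then show ?thesis
              using True by simp
          next
            case False
            then have "cnt n u < R * B"
              using bounds(2) by simp
            then show ?thesis
              using Suc_cnt(2)[of n u] by linarith
          qed
        qed
      qed
    qed
  qed
  then have "(\<forall>j\<in>set us. cnt n j \<le> B) \<and> cnt n u \<le> R * B"
    using Cons.prems by simp
  then have "cnt n j \<le> R * B"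
    using Cons.prems(7) BRB by (auto intro: order_trans)
  then show ?case
    by (simp add: B_def)
qed simp

section \<open>Excluding pairs that are sampled only finitely often\<close>

context ocba_path
begin

lemma sampled_infinitely_or_stops:
  "filterlim (\<lambda>n. N n z) at_top sequentially \<or> (\<exists>n0. \<forall>n\<ge>n0. x n \<noteq> z)"
proof (rule disjCI)
  assume "\<not> (\<exists>n0. \<forall>n\<ge>n0. x n \<noteq> z)"
  then have io: "\<exists>n\<ge>n0. x n = z" for n0
    by blast
  have "\<exists>n. B \<le> N n z" for B
  proof (induction B)
    case (Suc B)
    then obtain n where n: "B \<le> N n z"
      by blast
    obtain m where m: "n \<le> m" "x m = z"
      using io by blast
    have "Suc B \<le> N (Suc m) z"
      using n num_samples_mono[OF m(1), of x z] m(2) by (simp add: num_samples_Suc)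
    then show ?case
      by blast
  qed simp
  then show "filterlim (\<lambda>n. N n z) at_top sequentially"
    unfolding filterlim_at_top eventually_sequentially
    by (meson num_samples_mono order_trans)
qed

lemma unsampled_const:
  assumes "\<And>i. n0 \<le> i \<Longrightarrow> x i \<noteq> z" "n0 \<le> n"
  shows "N n z = N n0 z" "A n z = A n0 z" "W n z = W n0 z" "mu n z = mu n0 z"
proof -
  have "{i. i < n \<and> x i = z} = {i. i < n0 \<and> x i = z}"
    using assms by (auto simp: not_less[symmetric])
  then show "N n z = N n0 z" "A n z = A n0 z" "W n z = W n0 z" "mu n z = mu n0 z"
    by (simp_all add: A_def W_def post_mean_def sample_mean_def num_samples_def)
qed

lemma mu_error:
  assumes z: "z \<in> K \<times> C" and A: "0 < A n z"
  shows "\<bar>mu n z - F z - sample_mean x e n z\<bar> \<le>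
    (lam z * v z * \<bar>\<mu>0 z - F z\<bar> + lam z * v z * \<bar>sample_mean x e n z\<bar>) / A n z"
proof -
  have eq: "mu n z - F z - sample_mean x e n z =
      (lam z * v z * (\<mu>0 z - F z) - lam z * v z * sample_mean x e n z) / A n z"
  proof -
    have NA: "real (N n z) = A n z - lam z * v z"
      by (simp add: A_def)
    show ?thesis
      unfolding mu_eq[OF z A] NA using A by (simp add: field_simps)
  qed
  have lv: "0 \<le> lam z * v z"
    using lam_nonneg v_pos[OF z] by (intro mult_nonneg_nonneg) auto
  have "\<bar>lam z * v z * (\<mu>0 z - F z) - lam z * v z * sample_mean x e n z\<bar> \<le>
      \<bar>lam z * v z * (\<mu>0 z - F z)\<bar> + \<bar>lam z * v z * sample_mean x e n z\<bar>"
    by (rule abs_triangle_ineq4)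
  also have "\<dots> = lam z * v z * \<bar>\<mu>0 z - F z\<bar> + lam z * v z * \<bar>sample_mean x e n z\<bar>"
    using lv by (simp add: abs_mult[of "lam z * v z"])
  finally show ?thesis
    unfolding eq using A by (simp add: abs_divide divide_right_mono)
qed

lemma mu_tendsto:
  assumes z: "z \<in> K \<times> C" and inf: "filterlim (\<lambda>n. N n z) at_top sequentially"
    and lln: "(\<lambda>n. sample_mean x e n z) \<longlonglongrightarrow> 0"
  shows "(\<lambda>n. mu n z) \<longlonglongrightarrow> F z"
proof -
  let ?g = "\<lambda>n. (lam z * v z * \<bar>\<mu>0 z - F z\<bar> + lam z * v z * \<bar>sample_mean x e n z\<bar>) / A n z"
  have "(\<lambda>n. lam z * v z * \<bar>\<mu>0 z - F z\<bar> + lam z * v z * \<bar>sample_mean x e n z\<bar>) \<longlonglongrightarrow>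
      lam z * v z * \<bar>\<mu>0 z - F z\<bar> + lam z * v z * \<bar>0\<bar>"
    by (intro tendsto_intros lln)
  then have "?g \<longlonglongrightarrow> 0"
    by (rule real_tendsto_divide_at_top[OF _ A_tendsto_infinity[OF z inf]])
  moreover have "\<forall>\<^sub>F n in sequentially. norm (mu n z - F z - sample_mean x e n z) \<le> ?g n"
    using eventually_ge_at_top[of N0] by eventually_elim (use mu_error[OF z A_pos[OF z]] in simp)
  ultimately have "(\<lambda>n. mu n z - F z - sample_mean x e n z) \<longlonglongrightarrow> 0"
    by (rule Lim_null_comparison[rotated])
  then have "(\<lambda>n. (mu n z - F z - sample_mean x e n z) + sample_mean x e n z + F z) \<longlonglongrightarrow> 0 + 0 + F z"
    by (intro tendsto_add lln tendsto_const)
  then show ?thesis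
    by simp
qed


definition always_sampled :: "('k \<times> 'c) set" where
  "always_sampled = {z \<in> K \<times> C. filterlim (\<lambda>n. N n z) at_top sequentially}"

lemma stops: "z \<in> K \<times> C \<Longrightarrow> z \<notin> always_sampled \<Longrightarrow> \<exists>n0. \<forall>n\<ge>n0. x n \<noteq> z"
  using sampled_infinitely_or_stops[of z] by (auto simp: always_sampled_def)

lemma eventually_always_sampled: "\<exists>n0\<ge>N0. \<forall>n\<ge>n0. x n \<in> always_sampled"
proof -
  have "\<forall>\<^sub>F n in sequentially. \<forall>z\<in>K \<times> C - always_sampled. x n \<noteq> z"
    using stops K C by (intro eventually_ball_finite) (auto simp: eventually_sequentially)
  then have "\<forall>\<^sub>F n in sequentially. N0 \<le> n \<and> x n \<in> always_sampled"
    using eventually_ge_at_top[of N0] by eventually_elim (use x_in in blast)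
  then obtain n0 where n0: "\<And>n. n0 \<le> n \<Longrightarrow> N0 \<le> n \<and> x n \<in> always_sampled"
    unfolding eventually_sequentially by blast
  then show ?thesis
    by (intro exI[of _ n0]) auto
qed

lemma eventually_index_large:
  assumes z: "z \<in> K \<times> C" "z' \<in> K \<times> C" and inf: "filterlim (\<lambda>n. A n z) at_top sequentially" "filterlim (\<lambda>n. A n z') at_top sequentially"
    and lim: "(\<lambda>n. mu n z) \<longlonglongrightarrow> a" "(\<lambda>n. mu n z') \<longlonglongrightarrow> a'" and ne: "a \<noteq> a'"
  shows "\<forall>\<^sub>F n in sequentially. M < (mu n z - mu n z')\<^sup>2 / (v z / A n z + v z' / A n z')"
proof -
  have "(\<lambda>n. (\<bar>M\<bar> + 1) * (v z / A n z + v z' / A n z')) \<longlonglongrightarrow> (\<bar>M\<bar> + 1) * (0 + 0)"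
    by (intro tendsto_intros real_tendsto_divide_at_top[OF tendsto_const inf(1)] real_tendsto_divide_at_top[OF tendsto_const inf(2)])
  then have "(\<lambda>n. (mu n z - mu n z')\<^sup>2 - (\<bar>M\<bar> + 1) * (v z / A n z + v z' / A n z')) \<longlonglongrightarrow> (a - a')\<^sup>2 - (\<bar>M\<bar> + 1) * (0 + 0)"
    by (intro tendsto_diff tendsto_power lim)
  then have "\<forall>\<^sub>F n in sequentially. 0 < (mu n z - mu n z')\<^sup>2 - (\<bar>M\<bar> + 1) * (v z / A n z + v z' / A n z')"
    using ne by (intro order_tendstoD(1)) auto
  then show ?thesis
    using eventually_ge_at_top[of N0]
  proof eventually_elim
    case (elim n)
    have pos: "0 < v z / A n z + v z' / A n z'"
      using A_pos z elim(2) v_pos by (intro add_pos_pos divide_pos_pos) auto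
    have "M * (v z / A n z + v z' / A n z') \<le> (\<bar>M\<bar> + 1) * (v z / A n z + v z' / A n z')"
      using pos by (intro mult_right_mono) auto
    also have "\<dots> < (mu n z - mu n z')\<^sup>2"
      using elim(1) by simp
    finally show ?case
      unfolding pos_less_divide_eq[OF pos] .
  qed
qed

text \<open>The counterpart of \<open>choice\<close> for a predicted best \<open>b\<close> that
  cannot yet be identified with \<open>\<pi>\<close>.\<close>

definition policy_choice :: "nat \<Rightarrow> ('c \<Rightarrow> 'k) \<Rightarrow> 'k \<Rightarrow> 'c \<Rightarrow> bool" where
  "policy_choice n b k c \<longleftrightarrow>
    (\<forall>c'\<in>C. b c' \<in> K \<and> (\<forall>k'\<in>K. mu n (k', c') \<le> mu n (b c', c'))) \<and> c \<in> C \<and> k \<in> K \<and> k \<noteq> b c \<and>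
    (\<forall>c'\<in>C. \<forall>k'\<in>K. k' \<noteq> b c' \<longrightarrow> zeta (mu n) (S n) b k c \<le> zeta (mu n) (S n) b k' c') \<and>
    (x n = (b c, c) \<and> W n (b c, c) < (\<Sum>k\<in>K - {b c}. W n (k, c)) \<or>
     x n = (k, c) \<and> (\<Sum>k\<in>K - {b c}. W n (k, c)) \<le> W n (b c, c))"

text \<open>Keeps only what the blocking argument needs to know about a step in \<open>c\<close>:
  the verdict of the \<open>\<psi>\<close>-test and, for a challenger \<open>u\<close>, the bound
  \<open>M\<close> on \<open>zeta\<close> in multiplied-out form.\<close>

definition tied_choice :: "'c \<Rightarrow> 'k set \<Rightarrow> real \<Rightarrow> nat \<Rightarrow> 'k \<Rightarrow> bool" where
  "tied_choice c T M n u \<longleftrightarrow> (\<exists>b\<in>T. (\<forall>k\<in>K. mu n (k, c) \<le> mu n (b, c)) \<and>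
    (u = b \<and> W n (u, c) < (\<Sum>j\<in>K - {u}. W n (j, c)) \<or>
     u \<noteq> b \<and> (mu n (b, c) - mu n (u, c))\<^sup>2 \<le> M * (v (b, c) / A n (b, c) + v (u, c) / A n (u, c)) \<and> W n (u, c) \<le> W n (b, c)))"

lemma policy_choice: "N0 \<le> n \<Longrightarrow> \<exists>b k c. policy_choice n b k c"
  by (erule policy_step) (unfold policy_choice_def, blast)

context
  assumes lln: "\<And>z. z \<in> K \<times> C \<Longrightarrow> filterlim (\<lambda>n. N n z) at_top sequentially \<Longrightarrow> (\<lambda>n. sample_mean x e n z) \<longlonglongrightarrow> 0"
begin

lemma mu_convergent:
  assumes "z \<in> K \<times> C"
  shows "convergent (\<lambda>n. mu n z)"
proof (cases "z \<in> always_sampled")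
  case True
  then have "(\<lambda>n. mu n z) \<longlonglongrightarrow> F z"
    using assms by (intro mu_tendsto lln) (auto simp: always_sampled_def)
  then show ?thesis
    by (rule convergentI)
next
  case False
  obtain n0 where "\<And>n. n0 \<le> n \<Longrightarrow> x n \<noteq> z"
    using stops[OF assms False] by blast
  then have "\<forall>\<^sub>F n in sequentially. mu n z = mu n0 z"
    unfolding eventually_sequentially using unsampled_const(4) by blast
  then have "(\<lambda>n. mu n z) \<longlonglongrightarrow> mu n0 z"
    by (rule tendsto_eventually)
  then show ?thesis
    by (rule convergentI)
qed

lemma always_sampled_lim:
  assumes "z \<in> always_sampled"
  shows "z \<in> K \<times> C" "(\<lambda>n. mu n z) \<longlonglongrightarrow> F z" "filterlim (\<lambda>n. A n z) at_top sequentially"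
  using assms mu_tendsto[OF _ _ lln] A_tendsto_infinity by (auto simp: always_sampled_def)

text \<open>The variance of a pair that is no longer sampled stays constant and keeps a denominator
  in its context away from 0, while all posterior means are bounded. So one of the values over which
  the policy minimizes is bounded.\<close>

lemma zeta_bounded:
  assumes z0: "z0 \<in> K \<times> C" "z0 \<notin> always_sampled"
  shows "\<exists>M n0. \<forall>n\<ge>n0. \<forall>b k c. policy_choice n b k c \<longrightarrow> zeta (mu n) (S n) b k c \<le> M"
proof -
  obtain k0 c0 where z0_eq: "z0 = (k0, c0)" and k0: "k0 \<in> K" "c0 \<in> C"
    using z0(1) by blast
  obtain n0 where n0: "\<And>n. n0 \<le> n \<Longrightarrow> x n \<noteq> z0"
    using stops[OF z0] by blast
  have "Bseq (\<lambda>n. mu n z)" if "z \<in> K \<times> C" for z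
    using mu_convergent[OF that] by (rule convergent_imp_Bseq)
  then have "\<forall>z\<in>K \<times> C. \<exists>B>0. \<forall>n. norm (mu n z) \<le> B"
    unfolding Bseq_def by blast
  from bchoice[OF this] obtain B where B: "\<And>z n. z \<in> K \<times> C \<Longrightarrow> 0 < B z \<and> \<bar>mu n z\<bar> \<le> B z"
    by (auto simp: real_norm_def)
  define Bm where "Bm = (\<Sum>z\<in>K \<times> C. B z)"
  have Bm: "\<bar>mu n z\<bar> \<le> Bm" if "z \<in> K \<times> C" for z n
  proof -
    have "B z \<le> Bm"
      unfolding Bm_def using that K C B by (intro member_le_sum) (auto intro: less_imp_le)
    then show ?thesis
      using B[OF that, of n] by linarith
  qed
  have "zeta (mu n) (S n) b k c \<le> (2 * Bm)\<^sup>2 / (v z0 / A n0 z0)"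
    if n: "max n0 N0 \<le> n" and ch: "policy_choice n b k c" for n b k c
  proof -
    have z0n: "A n z0 = A n0 z0"
      using n n0 by (intro unsampled_const) auto
    have v0: "0 < v z0 / A n0 z0"
      using v_pos[OF z0(1)] A_pos[OF z0(1), of n] n z0n by simp
    have b0: "b c0 \<in> K"
      using ch k0 by (simp add: policy_choice_def)
    \<comment> \<open>\<open>k1\<close> is chosen such that the comparison with the predicted best
      involves \<open>z0\<close>, which may be the predicted best itself.\<close>
    obtain k1 where k1: "k1 \<in> K" "k1 \<noteq> b c0" "k0 \<in> {k1, b c0}"
    proof (cases "k0 = b c0")
      case True
      have "K - {k0} \<noteq> {}"
        using K k0 by (metis Suc_1 card_1_singleton_iff card.empty insert_Diff_single insert_absorb not_less_eq_eq le0 numeral_2_eq_2 One_nat_def)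
      then show ?thesis
        using that True by blast
    next
      case False
      then show ?thesis
        using that k0 by blast
    qed
    have "zeta (mu n) (S n) b k c \<le> zeta (mu n) (S n) b k1 c0"
      using ch k1 k0 by (simp add: policy_choice_def)
    also have "\<dots> = (mu n (b c0, c0) - mu n (k1, c0))\<^sup>2 / (v (b c0, c0) / A n (b c0, c0) + v (k1, c0) / A n (k1, c0))"
      using k0 k1 b0 by (intro zeta_eq) auto
    also have "\<dots> \<le> (2 * Bm)\<^sup>2 / (v z0 / A n0 z0)"
    proof (rule frac_le)
      have "\<bar>mu n (b c0, c0) - mu n (k1, c0)\<bar> \<le> 2 * Bm"
        using Bm[of "(b c0, c0)" n] Bm[of "(k1, c0)" n] b0 k1 k0 by (auto simp: abs_le_iff)
      then show "(mu n (b c0, c0) - mu n (k1, c0))\<^sup>2 \<le> (2 * Bm)\<^sup>2"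
        by (rule power2_le_iff_abs_le[THEN iffD2, rotated]) (use Bm[OF z0(1), of n] in linarith)
      have "0 < v (b c0, c0) / A n (b c0, c0)" "0 < v (k1, c0) / A n (k1, c0)"
        using b0 k1 k0 n v_pos A_pos by (auto intro!: divide_pos_pos)
      then show "v z0 / A n0 z0 \<le> v (b c0, c0) / A n (b c0, c0) + v (k1, c0) / A n (k1, c0)"
        using k1(3) z0n by (auto simp: z0_eq)
    qed (use v0 in auto)
    finally show ?thesis .
  qed
  then show ?thesis
    by (intro exI[of _ "(2 * Bm)\<^sup>2 / (v z0 / A n0 z0)"] exI[of _ "max n0 N0"]) blast
qed

text \<open>\<open>T\<close> consists of the always sampled alternatives of \<open>c\<close> with
  the largest reward among those. A starved alternative cannot be the predicted best, since its
  \<open>W\<close> is frozen and the test would sample it; a challenger with a different reward has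
  a \<open>zeta\<close> above \<open>M\<close>.\<close>

lemma tied_context:
  assumes z0: "z0 \<in> K \<times> C" "z0 \<notin> always_sampled"
  shows "\<exists>c T f M n0. c \<in> C \<and> T \<subseteq> K \<and> T \<noteq> {} \<and> (\<forall>u\<in>T. (u, c) \<in> always_sampled \<and> F (u, c) = f) \<and> N0 \<le> n0 \<and>
    (\<forall>n\<ge>n0. \<forall>u. x n = (u, c) \<longrightarrow> u \<in> T \<and> tied_choice c T M n u)"
proof -
  obtain M n1 where M: "\<And>n b k c. n1 \<le> n \<Longrightarrow> policy_choice n b k c \<Longrightarrow> zeta (mu n) (S n) b k c \<le> M"
    using zeta_bounded[OF z0] by blast
  obtain n2 where n2: "N0 \<le> n2" "\<And>n. n2 \<le> n \<Longrightarrow> x n \<in> always_sampled"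
    using eventually_always_sampled by blast
  obtain k1 c where x1: "x n2 = (k1, c)"
    by (cases "x n2")
  have z1: "(k1, c) \<in> always_sampled"
    using n2(2)[of n2] x1 by simp
  then have c: "c \<in> C" "k1 \<in> K"
    by (auto simp: always_sampled_def)
  define T0 where "T0 = {k \<in> K. (k, c) \<in> always_sampled}"
  define f where "f = Max ((\<lambda>k. F (k, c)) ` T0)"
  define T where "T = {k \<in> T0. F (k, c) = f}"
  have T0: "finite T0" "T0 \<noteq> {}"
    using K z1 c by (auto simp: T0_def)
  have T: "T \<noteq> {}"
  proof -
    have "f \<in> (\<lambda>k. F (k, c)) ` T0"
      unfolding f_def using T0 by (intro Max_in) auto
    then show ?thesis
      by (auto simp: T_def)
  qed
  have T0_le: "F (k, c) \<le> f" if "k \<in> T0" for k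
    unfolding f_def using that T0 by (intro Max_ge) auto
  have lim: "(\<lambda>n. mu n (k, c)) \<longlonglongrightarrow> F (k, c)" "filterlim (\<lambda>n. A n (k, c)) at_top sequentially" if "k \<in> T0" for k
    using that always_sampled_lim[of "(k, c)"] by (auto simp: T0_def)
  have "\<forall>\<^sub>F n in sequentially. \<forall>k\<in>T0. \<forall>k'\<in>T0. F (k, c) < F (k', c) \<longrightarrow> mu n (k, c) < mu n (k', c)"
  proof (intro eventually_ball_finite T0 ballI)
    fix k k' assume k: "k \<in> T0" "k' \<in> T0"
    show "\<forall>\<^sub>F n in sequentially. F (k, c) < F (k', c) \<longrightarrow> mu n (k, c) < mu n (k', c)"
    proof (cases "F (k, c) < F (k', c)")
      case True
      have "(\<lambda>n. mu n (k', c) - mu n (k, c)) \<longlonglongrightarrow> F (k', c) - F (k, c)"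
        by (intro tendsto_diff lim k)
      then have "\<forall>\<^sub>F n in sequentially. 0 < mu n (k', c) - mu n (k, c)"
        using True by (intro order_tendstoD(1)) auto
      then show ?thesis
        by eventually_elim simp
    qed simp
  qed
  moreover have "\<forall>\<^sub>F n in sequentially. \<forall>k\<in>T0. \<forall>k'\<in>T0. F (k, c) \<noteq> F (k', c) \<longrightarrow>
      M < (mu n (k, c) - mu n (k', c))\<^sup>2 / (v (k, c) / A n (k, c) + v (k', c) / A n (k', c))"
  proof (intro eventually_ball_finite T0 ballI)
    fix k k' assume k: "k \<in> T0" "k' \<in> T0"
    have "\<forall>\<^sub>F n in sequentially. M < (mu n (k, c) - mu n (k', c))\<^sup>2 / (v (k, c) / A n (k, c) + v (k', c) / A n (k', c))"
      if "F (k, c) \<noteq> F (k', c)"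
      by (rule eventually_index_large[OF _ _ lim(2)[OF k(1)] lim(2)[OF k(2)] lim(1)[OF k(1)] lim(1)[OF k(2)] that])
        (use k c in \<open>auto simp: T0_def\<close>)
    then show "\<forall>\<^sub>F n in sequentially. F (k, c) \<noteq> F (k', c) \<longrightarrow>
        M < (mu n (k, c) - mu n (k', c))\<^sup>2 / (v (k, c) / A n (k, c) + v (k', c) / A n (k', c))"
      by (cases "F (k, c) = F (k', c)") auto
  qed
  \<comment> \<open>\<open>W\<close> is frozen for a starved alternative and unbounded for
    \<open>k1\<close>; this decides the test in favour of a starved \<open>b\<close>.\<close>
  moreover have "\<forall>\<^sub>F n in sequentially. \<forall>b\<in>K - T0. W n (b, c) < W n (k1, c)"
  proof (intro eventually_ball_finite ballI)
    fix b assume b: "b \<in> K - T0"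
    then obtain n3 where n3: "\<And>n. n3 \<le> n \<Longrightarrow> x n \<noteq> (b, c)"
      using stops[of "(b, c)"] c by (auto simp: T0_def)
    have "filterlim (\<lambda>n. N n (k1, c)) at_top sequentially"
      using z1 by (simp add: always_sampled_def)
    then have "filterlim (\<lambda>n. real (N n (k1, c)) * (A n (k1, c) * (1 / v (k1, c)))) at_top sequentially"
      using A_tendsto_infinity[of "(k1, c)"] v_pos[of "(k1, c)"] c
      by (intro filterlim_at_top_mult_at_top filterlim_compose[OF filterlim_real_sequentially]
          filterlim_at_top_mult_tendsto_pos[OF tendsto_const] ) (auto simp: mult.commute)
    then have "filterlim (\<lambda>n. W n (k1, c)) at_top sequentially"
      by (simp add: W_def)
    then have "\<forall>\<^sub>F n in sequentially. W n3 (b, c) < W n (k1, c)"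
      by (simp add: filterlim_at_top_dense)
    then show "\<forall>\<^sub>F n in sequentially. W n (b, c) < W n (k1, c)"
      using eventually_ge_at_top[of n3] by eventually_elim (use n3 unsampled_const(3) in metis)
  qed (use K in simp)
  ultimately have "\<forall>\<^sub>F n in sequentially. max n1 n2 \<le> n \<and>
      (\<forall>k\<in>T0. \<forall>k'\<in>T0. F (k, c) < F (k', c) \<longrightarrow> mu n (k, c) < mu n (k', c)) \<and>
      (\<forall>k\<in>T0. \<forall>k'\<in>T0. F (k, c) \<noteq> F (k', c) \<longrightarrow>
        M < (mu n (k, c) - mu n (k', c))\<^sup>2 / (v (k, c) / A n (k, c) + v (k', c) / A n (k', c))) \<and>
      (\<forall>b\<in>K - T0. W n (b, c) < W n (k1, c))"
    using eventually_ge_at_top[of "max n1 n2"] by eventually_elim blast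
  then obtain n0 where n0: "\<And>n. n0 \<le> n \<Longrightarrow> max n1 n2 \<le> n"
    "\<And>n k k'. n0 \<le> n \<Longrightarrow> k \<in> T0 \<Longrightarrow> k' \<in> T0 \<Longrightarrow> F (k, c) < F (k', c) \<Longrightarrow> mu n (k, c) < mu n (k', c)"
    "\<And>n k k'. n0 \<le> n \<Longrightarrow> k \<in> T0 \<Longrightarrow> k' \<in> T0 \<Longrightarrow> F (k, c) \<noteq> F (k', c) \<Longrightarrow>
      M < (mu n (k, c) - mu n (k', c))\<^sup>2 / (v (k, c) / A n (k, c) + v (k', c) / A n (k', c))"
    "\<And>n b. n0 \<le> n \<Longrightarrow> b \<in> K - T0 \<Longrightarrow> W n (b, c) < W n (k1, c)"
    unfolding eventually_sequentially by blast
  have W0: "0 \<le> W n (k, c)" if "k \<in> K" for n k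
    using that c by (intro W_nonneg) simp
  have W_le: "W n (u, c) \<le> (\<Sum>k\<in>K - {b}. W n (k, c))" if "u \<in> K" "u \<noteq> b" for n u b
    using that K W0 by (intro member_le_sum) auto
  have main: "u \<in> T \<and> tied_choice c T M n u"
    if n: "n0 \<le> n" and u: "x n = (u, c)" for n u
  proof -
    have nn: "n1 \<le> n" "n2 \<le> n" "N0 \<le> n"
      using n0(1)[OF n] n2(1) by auto
    obtain b' k c' where ch: "policy_choice n b' k c'"
      using policy_choice[OF nn(3)] by blast
    have c': "c' = c"
      using ch u by (auto simp: policy_choice_def)
    define b where "b = b' c"
    have b: "b \<in> K" "\<And>k'. k' \<in> K \<Longrightarrow> mu n (k', c) \<le> mu n (b, c)" and k: "k \<in> K" "k \<noteq> b"
      and uu: "u = b \<and> W n (b, c) < (\<Sum>k\<in>K - {b}. W n (k, c)) \<or> u = k \<and> (\<Sum>k\<in>K - {b}. W n (k, c)) \<le> W n (b, c)"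
      using ch c u unfolding policy_choice_def c' b_def by auto
    have z: "(mu n (b, c) - mu n (k, c))\<^sup>2 / (v (b, c) / A n (b, c) + v (k, c) / A n (k, c)) \<le> M"
      using M[OF nn(1) ch] zeta_eq[OF c(1) k(1), of b' n] b(1) unfolding c' b_def by simp
    have uT0: "u \<in> T0"
      using n2(2)[OF nn(2)] u by (auto simp: T0_def always_sampled_def)
    have bT0: "b \<in> T0"
    proof (rule ccontr)
      assume nb: "b \<notin> T0"
      then have "k1 \<noteq> b"
        using z1 c by (auto simp: T0_def)
      then have "W n (b, c) < (\<Sum>k\<in>K - {b}. W n (k, c))"
        using n0(4)[OF n, of b] nb b(1) W_le[OF c(2), of b n] by auto
      then show False
        using uu uT0 nb by auto
    qed
    have bT: "b \<in> T"
    proof (rule ccontr)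
      assume "b \<notin> T"
      then have "F (b, c) < f"
        using T0_le[OF bT0] bT0 by (auto simp: T_def)
      moreover obtain t where t: "t \<in> T"
        using T by blast
      ultimately have "mu n (b, c) < mu n (t, c)"
        using bT0 by (intro n0(2)[OF n]) (auto simp: T_def)
      then show False
        using b(2)[of t] t by (auto simp: T_def T0_def)
    qed
    show ?thesis
    proof (cases "u = b")
      case True
      then show ?thesis
        using uu bT b(2) k unfolding tied_choice_def by auto
    next
      case False
      then have uk: "u = k" and le: "(\<Sum>k\<in>K - {b}. W n (k, c)) \<le> W n (b, c)"
        using uu by auto
      have "F (b, c) = F (u, c)"
        using n0(3)[OF n bT0 uT0] z uk by force
      then have "u \<in> T"
        using bT uT0 by (auto simp: T_def)
      moreover have "0 < v (b, c) / A n (b, c) + v (u, c) / A n (u, c)"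
        using b(1) k(1) uk c nn(3) v_pos A_pos by (auto intro!: add_pos_pos divide_pos_pos)
      then have "(mu n (b, c) - mu n (u, c))\<^sup>2 \<le> M * (v (b, c) / A n (b, c) + v (u, c) / A n (u, c))"
        using z unfolding uk by (simp add: pos_divide_le_eq)
      moreover have "W n (u, c) \<le> W n (b, c)"
        using W_le[of u b n] k uk le by auto
      ultimately show ?thesis
        using False bT b(2) unfolding tied_choice_def by blast
    qed
  qed
  have "T \<subseteq> K" "\<forall>u\<in>T. (u, c) \<in> always_sampled \<and> F (u, c) = f"
    by (auto simp: T_def T0_def)
  moreover have "N0 \<le> n0"
    using n0(1)[of n0] n2(1) by simp
  ultimately show ?thesis
    using c(1) T main by (intro exI[of _ c] exI[of _ T] exI[of _ f] exI[of _ M] exI[of _ n0]) simp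
qed


end


text \<open>All constants are fixed by the priors, the variances, \<open>M\<close> and the tied set
  \<open>T\<close> before the separated scale \<open>m\<close> is taken; then the counts in
  \<open>T\<close> satisfy the assumptions of \<open>crossing_bound\<close>.\<close>

theorem always_sampled_all:
  fixes r :: "'k \<times> 'c \<Rightarrow> nat"
  assumes lln: "\<And>z. z \<in> K \<times> C \<Longrightarrow> filterlim (\<lambda>n. N n z) at_top sequentially \<Longrightarrow> (\<lambda>n. sample_mean x e n z) \<longlonglongrightarrow> 0"
    and inj: "inj_on r (K \<times> C)"
    and sep: "\<And>(L :: nat) (h :: nat) (m0 :: nat). \<exists>m\<ge>m0. \<forall>z\<in>K \<times> C. \<forall>z'\<in>K \<times> C. r z < r z' \<longrightarrow>
       (\<forall>n n'. N n z \<in> {m..L * m} \<longrightarrow> N n' z' \<in> {m..L * m} \<longrightarrow>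
          h / sqrt m \<le> sample_mean x e n z - sample_mean x e n' z')"
    and z0: "z0 \<in> K \<times> C"
  shows "z0 \<in> always_sampled"
proof (rule ccontr)
  assume "z0 \<notin> always_sampled"
  from tied_context[OF lln z0 this] obtain c T f M n0 where c: "c \<in> C" and T: "T \<subseteq> K" "T \<noteq> {}"
    and Tf: "\<And>u. u \<in> T \<Longrightarrow> (u, c) \<in> always_sampled" "\<And>u. u \<in> T \<Longrightarrow> F (u, c) = f" and n0: "N0 \<le> n0"
    and step: "\<And>n u. n0 \<le> n \<Longrightarrow> x n = (u, c) \<Longrightarrow> u \<in> T \<and> tied_choice c T M n u"
    by blast
  have kc: "(k, c) \<in> K \<times> C" if "k \<in> K" for k
    using that c by simp
  \<comment> \<open>\<open>V\<close>, \<open>U\<close> and \<open>\<Lambda>\<close> make the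
    estimates uniform over the alternatives of \<open>c\<close>:
    \<open>N\<^sup>2 / V \<le> W\<close>, and \<open>W\<close> is at most
    \<open>(1 + \<Lambda>) * U\<close> times the square of any bound on the count that is at least
    1.\<close>
  define V where "V = (\<Sum>k\<in>K. v (k, c))"
  define U where "U = (\<Sum>k\<in>K. 1 / v (k, c))"
  define \<Lambda> where "\<Lambda> = (\<Sum>k\<in>K. lam (k, c) * v (k, c) * (1 + \<bar>\<mu>0 (k, c) - F (k, c)\<bar>))"
  have vpos: "0 < v (k, c)" if "k \<in> K" for k
    by (rule v_pos[OF kc[OF that]])
  have V: "v (k, c) \<le> V" if "k \<in> K" for k
    unfolding V_def using that K vpos by (intro member_le_sum) (auto intro: less_imp_le)
  have U: "1 / v (k, c) \<le> U" if "k \<in> K" for k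
    unfolding U_def using that K vpos by (intro member_le_sum) (auto intro: less_imp_le)
  have VU: "0 < V" "0 < U"
  proof -
    obtain k where "k \<in> K"
      using T by blast
    then show "0 < V" "0 < U"
      using V[of k] U[of k] vpos[of k] less_le_trans[of 0 "1 / v (k, c)" U] by (auto intro: less_le_trans)
  qed
  have lv0: "0 \<le> lam (k, c) * v (k, c)" if "k \<in> K" for k
    using lam_nonneg[of "(k, c)"] vpos[OF that] by (intro mult_nonneg_nonneg) auto
  have \<Lambda>: "lam (k, c) * v (k, c) * (1 + \<bar>\<mu>0 (k, c) - F (k, c)\<bar>) \<le> \<Lambda>" if "k \<in> K" for k
    unfolding \<Lambda>_def using that K lv0 by (intro member_le_sum) (auto intro!: mult_nonneg_nonneg)
  have lv: "lam (k, c) * v (k, c) \<le> \<Lambda>" if "k \<in> K" for k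
  proof -
    have "lam (k, c) * v (k, c) * 1 \<le> lam (k, c) * v (k, c) * (1 + \<bar>\<mu>0 (k, c) - F (k, c)\<bar>)"
      using lv0[OF that] by (intro mult_left_mono) auto
    then show ?thesis
      using \<Lambda>[OF that] by simp
  qed
  have \<Lambda>0: "0 \<le> \<Lambda>"
    using T lv0 lv order_trans by blast
  have W_lower: "(real (N n (k, c)))\<^sup>2 / V \<le> W n (k, c)" if k: "k \<in> K" for n k
  proof -
    have "(real (N n (k, c)))\<^sup>2 / V \<le> (real (N n (k, c)))\<^sup>2 / v (k, c)"
      using V[OF k] vpos[OF k] VU by (intro divide_left_mono) auto
    also have "\<dots> \<le> W n (k, c)"
      unfolding W_def power2_eq_square using N_le_A[OF kc[OF k], of n] vpos[OF k]
      by (intro divide_right_mono mult_left_mono) auto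
    finally show ?thesis .
  qed
  have W_upper: "W n (k, c) \<le> y\<^sup>2 * ((1 + \<Lambda>) * U)" if k: "k \<in> K" and y: "N n (k, c) \<le> y" "1 \<le> y" for n k and y :: real
  proof -
    have "A n (k, c) \<le> y + \<Lambda> * y"
      using lv[OF k] y \<Lambda>0 mult_left_mono[of 1 y \<Lambda>] by (simp add: A_def)
    then have "N n (k, c) * A n (k, c) \<le> y * (y + \<Lambda> * y)"
      using y A_nonneg[OF kc[OF k], of n] by (intro mult_mono) auto
    then have "N n (k, c) * A n (k, c) * (1 / v (k, c)) \<le> y * (y + \<Lambda> * y) * U"
      by (rule mult_mono) (use U[OF k] vpos[OF k] y \<Lambda>0 in auto)
    then show ?thesis
      by (simp add: W_def power2_eq_square algebra_simps)
  qed
  \<comment> \<open>The quotient of the two constants: a comparison of \<open>W\<close> gives one of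
    squared counts up to the factor \<open>\<theta>\<close>.\<close>
  define \<theta> where "\<theta> = (1 + \<Lambda>) * U * V"
  have \<theta>: "0 < \<theta>"
    unfolding \<theta>_def using VU \<Lambda>0 by simp
  \<comment> \<open>If an alternative were sampled at count \<open>R * B\<close> with all others at
    most \<open>B\<close>, then \<open>R\<^sup>2 \<le> card K * \<theta>\<close>; this
    \<open>R\<close> excludes that.\<close>
  obtain R :: nat where R: "real (card K) * \<theta> + 1 < R"
    using reals_Archimedean2 by blast
  have R1: "1 \<le> R"
  proof -
    have "0 \<le> real (card K) * \<theta>"
      using \<theta> by simp
    then show ?thesis
      using R by linarith
  qed
  \<comment> \<open>A challenger with count at least \<open>m\<close> passes the
    \<open>\<psi>\<close>-test only if the predicted best has count above
    \<open>m / \<kappa>\<close>.\<close>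
  define \<kappa> where "\<kappa> = sqrt \<theta> + 1"
  have \<kappa>: "1 \<le> \<kappa>" "\<theta> < \<kappa>\<^sup>2"
  proof -
    show "1 \<le> \<kappa>"
      using \<theta> by (simp add: \<kappa>_def)
    have "(sqrt \<theta>)\<^sup>2 < \<kappa>\<^sup>2"
      using \<theta> by (intro power_strict_mono) (auto simp: \<kappa>_def)
    then show "\<theta> < \<kappa>\<^sup>2"
      using \<theta> by simp
  qed
  \<comment> \<open>Chosen such that posterior means differing by \<open>g / sqrt m\<close>, with
    both effective counts \<open>A\<close> at least \<open>m / \<kappa>\<close>, make
    \<open>zeta\<close> exceed \<open>M\<close>.\<close>
  define g where "g = 2 * \<bar>M\<bar> * V * \<kappa> + 1"
  have g: "1 \<le> g" "\<bar>M\<bar> * (2 * V * \<kappa>) < g\<^sup>2"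
  proof -
    have "0 \<le> 2 * \<bar>M\<bar> * V * \<kappa>"
      using VU \<kappa> by (intro mult_nonneg_nonneg) auto
    then show "1 \<le> g"
      by (simp add: g_def)
    have "\<bar>M\<bar> * (2 * V * \<kappa>) < g"
      by (simp add: g_def mult_ac)
    also have "g \<le> g\<^sup>2"
      using \<open>1 \<le> g\<close> by (simp add: power2_eq_square)
    finally show "\<bar>M\<bar> * (2 * V * \<kappa>) < g\<^sup>2" .
  qed
  \<comment> \<open>The surplus 1 over \<open>g\<close> pays for the influence of the two priors, at
    most \<open>2 * \<Lambda> / m \<le> 1 / sqrt m\<close>.\<close>
  obtain h :: nat where h: "g + 1 < h"
    using reals_Archimedean2 by blast
  have fT: "finite T"
    using T(1) K(1) by (rule finite_subset)
  have "\<forall>\<^sub>F n in sequentially. \<forall>u\<in>T. \<bar>sample_mean x e n (u, c)\<bar> < 1"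
  proof (intro eventually_ball_finite fT ballI)
    fix u assume "u \<in> T"
    then have "(\<lambda>n. sample_mean x e n (u, c)) \<longlonglongrightarrow> 0"
      using Tf(1) by (intro lln) (auto simp: always_sampled_def)
    then have "(\<lambda>n. \<bar>sample_mean x e n (u, c)\<bar>) \<longlonglongrightarrow> 0"
      by (rule tendsto_rabs_zero)
    then show "\<forall>\<^sub>F n in sequentially. \<bar>sample_mean x e n (u, c)\<bar> < 1"
      by (rule order_tendstoD(2)) simp
  qed
  then obtain n1 where n1: "\<And>n u. n1 \<le> n \<Longrightarrow> u \<in> T \<Longrightarrow> \<bar>sample_mean x e n (u, c)\<bar> < 1"
    unfolding eventually_sequentially by blast
  define n2 where "n2 = max n0 n1"
  obtain m1 :: nat where m1: "(2 * \<Lambda>)\<^sup>2 < m1"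
    using reals_Archimedean2 by blast
  \<comment> \<open>All counts of \<open>c\<close> at time \<open>n2\<close> are below
    \<open>m0\<close>, so every counter starts below the window; \<open>m1\<close> provides for
    \<open>2 * \<Lambda> \<le> sqrt m\<close>.\<close>
  define m0 where "m0 = Suc (m1 + (\<Sum>k\<in>K. N n2 (k, c)))"
  \<comment> \<open>Each member of \<open>T\<close> may raise the cap by one factor
    \<open>R\<close>, which determines the length of the window.\<close>
  define L where "L = R ^ card T"
  obtain m where m: "m0 \<le> m" and sep_m: "\<And>z z' n n'. z \<in> K \<times> C \<Longrightarrow> z' \<in> K \<times> C \<Longrightarrow> r z < r z' \<Longrightarrow>
      N n z \<in> {m..L * m} \<Longrightarrow> N n' z' \<in> {m..L * m} \<Longrightarrow> h / sqrt m \<le> sample_mean x e n z - sample_mean x e n' z'"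
    using sep[of m0 L h] by blast
  have start: "N n2 (k, c) < m" if "k \<in> K" for k
    using member_le_sum[of k K "\<lambda>k. N n2 (k, c)"] that K(1) m unfolding m0_def by simp
  have mpos: "0 < m"
    using m by (simp add: m0_def)
  have \<Lambda>m: "2 * \<Lambda> / m \<le> 1 / sqrt m"
  proof -
    have "(2 * \<Lambda>)\<^sup>2 \<le> m"
      using m1 m unfolding m0_def by linarith
    then have "2 * \<Lambda> \<le> sqrt m"
      by (rule real_le_rsqrt)
    then have "2 * \<Lambda> / m \<le> sqrt m / m"
      by (rule divide_right_mono) simp
    also have "\<dots> = 1 / sqrt m"
      using mpos by (simp add: real_div_sqrt field_simps)
    finally show ?thesis .
  qed
  have mu_sep: "g / sqrt m \<le> mu n (i, c) - mu n (j, c)"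
    if n: "n2 \<le> n" and ij: "i \<in> T" "j \<in> T" "r (i, c) < r (j, c)" and w: "N n (i, c) \<in> {m..L * m}" "N n (j, c) \<in> {m..L * m}" for n i j
  proof -
    have err: "\<bar>mu n (u, c) - f - sample_mean x e n (u, c)\<bar> \<le> \<Lambda> / m" if u: "u \<in> T" "N n (u, c) \<in> {m..L * m}" for u
    proof -
      have uK: "u \<in> K"
        using u T by blast
      have Am: "m \<le> A n (u, c)"
        using N_le_A[OF kc[OF uK], of n] u(2) by simp
      have "\<bar>mu n (u, c) - f - sample_mean x e n (u, c)\<bar> \<le>
          (lam (u, c) * v (u, c) * \<bar>\<mu>0 (u, c) - F (u, c)\<bar> + lam (u, c) * v (u, c) * \<bar>sample_mean x e n (u, c)\<bar>) / A n (u, c)"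
        using mu_error[OF kc[OF uK], of n] Am mpos Tf(2)[OF u(1)] by simp
      also have "\<dots> \<le> \<Lambda> / m"
      proof (rule frac_le)
        have "lam (u, c) * v (u, c) * \<bar>sample_mean x e n (u, c)\<bar> \<le> lam (u, c) * v (u, c) * 1"
          using n1[of n u] n u lv0[OF uK] by (intro mult_left_mono) (auto simp: n2_def)
        then show "lam (u, c) * v (u, c) * \<bar>\<mu>0 (u, c) - F (u, c)\<bar> + lam (u, c) * v (u, c) * \<bar>sample_mean x e n (u, c)\<bar> \<le> \<Lambda>"
          using \<Lambda>[OF uK] by (simp add: distrib_left)
      qed (use \<Lambda>0 mpos Am in auto)
      finally show ?thesis .
    qed
    have "h / sqrt m \<le> sample_mean x e n (i, c) - sample_mean x e n (j, c)"
      using ij T kc w by (intro sep_m) auto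
    moreover have "2 * (\<Lambda> / m) \<le> 1 / sqrt m"
      using \<Lambda>m by simp
    moreover have "(g + 1) / sqrt m \<le> h / sqrt m"
      using h by (intro divide_right_mono) auto
    ultimately show ?thesis
      using err[OF ij(1) w(1)] err[OF ij(2) w(2)] by (simp add: add_divide_distrib abs_le_iff)
  qed
  \<comment> \<open>Smallest rank first, that is, highest estimate first.\<close>
  define us where "us = sort_key (\<lambda>k. r (k, c)) (SOME us. set us = T \<and> distinct us)"
  have us: "set us = T" "distinct us"
  proof -
    have "set (SOME us. set us = T \<and> distinct us) = T \<and> distinct (SOME us. set us = T \<and> distinct us)"
      using finite_distinct_list[OF fT] by (rule someI_ex)
    then show "set us = T" "distinct us"
      by (simp_all add: us_def)
  qed
  have sorted_us: "sorted_wrt (\<lambda>i j. r (i, c) < r (j, c)) us"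
  proof -
    have "sorted (map (\<lambda>k. r (k, c)) us)"
      by (simp add: us_def)
    moreover have "inj_on (\<lambda>k. r (k, c)) T"
      by (rule inj_onI) (use inj_onD[OF inj] kc T(1) in blast)
    then have "distinct (map (\<lambda>k. r (k, c)) us)"
      using us by (simp add: distinct_map)
    ultimately have "sorted_wrt (<) (map (\<lambda>k. r (k, c)) us)"
      by (simp add: strict_sorted_iff)
    then show ?thesis
      by (simp add: sorted_wrt_map)
  qed
  have sampled: "x n = (j, c)" if "N (Suc n) (j, c) \<noteq> N n (j, c)" for n j
    using that by (simp add: num_samples_Suc split: if_splits)
  have A_ge: "real (N n (k, c)) \<le> A n (k, c)" if "k \<in> K" for n k
    by (rule N_le_A[OF kc[OF that]])
  have bound: "N n (u, c) \<le> R ^ length us * m" if n: "n2 \<le> n" and u: "u \<in> T" for n u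
  proof (rule crossing_bound[where cnt = "\<lambda>n k. N n (k, c)" and T = T and ?n0.0 = n2 and L = L and R = R
        and high = "\<lambda>i j. r (i, c) < r (j, c)" and us = us])
    show "N n (j, c) \<le> N (Suc n) (j, c)" "N (Suc n) (j, c) \<le> Suc (N n (j, c))" for n j
      by (simp_all add: num_samples_Suc)
    show "i = j" if "N (Suc n) (i, c) \<noteq> N n (i, c)" "N (Suc n) (j, c) \<noteq> N n (j, c)" for n i j
      using sampled[OF that(1)] sampled[OF that(2)] by simp
    show "N n2 (j, c) < m" if "j \<in> T" for j
      using start that T by blast
    show "1 \<le> R"
      by (rule R1)
    show "sorted_wrt (\<lambda>i j. r (i, c) < r (j, c)) us" "set us \<subseteq> T" "distinct us" "u \<in> set us"
      using sorted_us us u by auto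
    show "R ^ length us \<le> L"
      using us distinct_card[of us] by (simp add: L_def)
    show "n2 \<le> n"
      by (rule n)
    show "N n (j, c) < m" if "j \<in> T" "j \<notin> set us" for j
      using that us by simp
  next
    fix n i j assume n: "n2 \<le> n" and ij: "i \<in> T" "j \<in> T" "r (i, c) < r (j, c)"
      and w: "N n (i, c) \<in> {m..L * m}" "N n (j, c) \<in> {m..L * m}"
    \<comment> \<open>\<open>j\<close> is not the predicted best since \<open>i\<close> has a higher
      mean. As a challenger it would face a predicted best \<open>b\<close> whose mean is at least
      that of \<open>i\<close>. Even if \<open>b\<close> lies outside the window, the
      \<open>\<psi>\<close>-test makes its count large enough for \<open>zeta\<close> to exceed
      \<open>M\<close>.\<close>
    show "N (Suc n) (j, c) = N n (j, c)"
    proof (rule ccontr)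
      assume "N (Suc n) (j, c) \<noteq> N n (j, c)"
      then have xj: "x n = (j, c)"
        by (rule sampled)
      have nn: "n0 \<le> n" "N0 \<le> n"
        using n n0 by (auto simp: n2_def)
      obtain b where b: "b \<in> T" "\<And>k. k \<in> K \<Longrightarrow> mu n (k, c) \<le> mu n (b, c)"
        and alt: "j = b \<and> W n (j, c) < (\<Sum>i\<in>K - {j}. W n (i, c)) \<or>
          j \<noteq> b \<and> (mu n (b, c) - mu n (j, c))\<^sup>2 \<le> M * (v (b, c) / A n (b, c) + v (j, c) / A n (j, c)) \<and> W n (j, c) \<le> W n (b, c)"
        using step[OF nn(1) xj] unfolding tied_choice_def by blast
      have K': "i \<in> K" "j \<in> K" "b \<in> K"
        using ij b T by auto
      have gs: "0 < g / sqrt m"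
        using g mpos by simp
      have diff: "g / sqrt m \<le> mu n (b, c) - mu n (j, c)"
        using mu_sep[OF n ij w] b(2)[OF K'(1)] by linarith
      then have jb: "j \<noteq> b"
        using gs by auto
      then have sq: "(mu n (b, c) - mu n (j, c))\<^sup>2 \<le> M * (v (b, c) / A n (b, c) + v (j, c) / A n (j, c))"
        and Wle: "W n (j, c) \<le> W n (b, c)"
        using alt by auto
      define y where "y = max (real (N n (b, c))) 1"
      have "(real m)\<^sup>2 / V \<le> (real (N n (j, c)))\<^sup>2 / V"
        using w(2) VU by (intro divide_right_mono power_mono) auto
      also have "\<dots> \<le> W n (j, c)"
        by (rule W_lower[OF K'(2)])
      also have "\<dots> \<le> y\<^sup>2 * ((1 + \<Lambda>) * U)"
        using Wle W_upper[OF K'(3), of n y] by (simp add: y_def)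
      finally have "(real m)\<^sup>2 \<le> y\<^sup>2 * \<theta>"
        using VU by (simp add: \<theta>_def field_simps)
      also have "\<dots> < y\<^sup>2 * \<kappa>\<^sup>2"
        using \<kappa>(2) by (intro mult_strict_left_mono) (auto simp: y_def)
      finally have "(real m)\<^sup>2 < (y * \<kappa>)\<^sup>2"
        by (simp add: power_mult_distrib)
      then have mk: "real m < y * \<kappa>"
        by (rule power_less_imp_less_base) (use \<kappa>(1) in \<open>simp add: y_def\<close>)
      have Ab: "m / \<kappa> \<le> A n (b, c)"
      proof (cases "N n (b, c) = 0")
        case True
        have "W n (b, c) = 0"
          using True by (simp add: W_def)
        moreover have "0 < (real (N n (j, c)))\<^sup>2 / V"
          using w(2) mpos VU by simp
        ultimately show ?thesis
          using W_lower[OF K'(2), of n] Wle by linarith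
      next
        case False
        then have "y = N n (b, c)"
          by (simp add: y_def)
        then have "m / \<kappa> < N n (b, c)"
          using mk \<kappa>(1) by (simp add: pos_divide_less_eq)
        then show ?thesis
          using A_ge[OF K'(3), of n] by linarith
      qed
      have mk0: "0 < m / \<kappa>"
        using mpos \<kappa>(1) by simp
      have "v (b, c) / A n (b, c) \<le> V / (m / \<kappa>)"
        using V[OF K'(3)] vpos[OF K'(3)] Ab mk0 VU by (intro frac_le) auto
      moreover have "v (j, c) / A n (j, c) \<le> V / (m / \<kappa>)"
      proof (rule frac_le)
        have "m / \<kappa> \<le> real m"
          using \<kappa>(1) mult_left_mono[of 1 \<kappa> "real m"] by (simp add: divide_le_eq)
        also have "\<dots> \<le> A n (j, c)"
          using A_ge[OF K'(2), of n] w(2) by simp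
        finally show "m / \<kappa> \<le> A n (j, c)" .
      qed (use V[OF K'(2)] mk0 VU in auto)
      ultimately have "v (b, c) / A n (b, c) + v (j, c) / A n (j, c) \<le> 2 * V * \<kappa> / m"
        by simp
      moreover have "0 \<le> v (b, c) / A n (b, c) + v (j, c) / A n (j, c)"
        using vpos[OF K'(2)] vpos[OF K'(3)] A_nonneg[OF kc[OF K'(2)], of n] A_nonneg[OF kc[OF K'(3)], of n]
        by (intro add_nonneg_nonneg divide_nonneg_nonneg) auto
      ultimately have "M * (v (b, c) / A n (b, c) + v (j, c) / A n (j, c)) \<le> \<bar>M\<bar> * (2 * V * \<kappa> / m)"
        by (intro mult_mono) auto
      also have "\<dots> = \<bar>M\<bar> * (2 * V * \<kappa>) / m"
        by simp
      also have "\<dots> < g\<^sup>2 / m"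
        using g(2) mpos by (intro divide_strict_right_mono) auto
      also have "\<dots> = (g / sqrt m)\<^sup>2"
        using mpos by (simp add: power_divide)
      also have "\<dots> \<le> (mu n (b, c) - mu n (j, c))\<^sup>2"
        using diff gs by (intro power_mono) auto
      finally show False
        using sq by simp
    qed
  next
    fix n B u assume n: "n2 \<le> n" and u: "u \<in> T" and mB: "m \<le> B"
      and others: "\<And>j. j \<in> T \<Longrightarrow> j \<noteq> u \<Longrightarrow> N n (j, c) \<le> B" and Nu: "N n (u, c) = R * B"
    show "N (Suc n) (u, c) = N n (u, c)"
    proof (rule ccontr)
      assume "N (Suc n) (u, c) \<noteq> N n (u, c)"
      then have xu: "x n = (u, c)"
        by (rule sampled)
      have nn: "n0 \<le> n"
        using n by (simp add: n2_def)
      have uK: "u \<in> K"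
        using u T by blast
      have B1: "1 \<le> real B"
        using mB mpos by simp
      have W0: "0 \<le> W n (k, c)" if "k \<in> K" for k
        by (rule W_nonneg[OF kc[OF that]])
      have NB: "N n (j, c) \<le> B" if j: "j \<in> K - {u}" for j
      proof (cases "j \<in> T")
        case True
        then show ?thesis
          using others j by simp
      next
        case False
        \<comment> \<open>Alternatives of \<open>c\<close> outside \<open>T\<close> are no longer
          sampled from \<open>n2\<close> on, so they stay below \<open>m\<close>.\<close>
        then have "x i \<noteq> (j, c)" if "n2 \<le> i" for i
          using step[of i j] that by (auto simp: n2_def)
        then have "N n (j, c) = N n2 (j, c)"
          using n by (intro unsampled_const) auto
        then show ?thesis
          using start[of j] j mB by simp
      qed
      \<comment> \<open>This covers the challenger too: its \<open>W\<close> is at most that of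
        \<open>b\<close>, which is one of the summands.\<close>
      have "W n (u, c) \<le> (\<Sum>j\<in>K - {u}. W n (j, c))"
      proof -
        obtain b where b: "b \<in> T" "u = b \<and> W n (u, c) < (\<Sum>j\<in>K - {u}. W n (j, c)) \<or> u \<noteq> b \<and> W n (u, c) \<le> W n (b, c)"
          using step[OF nn xu] unfolding tied_choice_def by blast
        moreover have "W n (b, c) \<le> (\<Sum>j\<in>K - {u}. W n (j, c))" if "u \<noteq> b"
          using that b(1) T K(1) W0 by (intro member_le_sum) auto
        ultimately show ?thesis
          by force
      qed
      also have "\<dots> \<le> (\<Sum>j\<in>K - {u}. (real B)\<^sup>2 * ((1 + \<Lambda>) * U))"
        using NB B1 by (intro sum_mono W_upper) auto
      also have "\<dots> = real (card (K - {u})) * ((real B)\<^sup>2 * ((1 + \<Lambda>) * U))"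
        by simp
      also have "\<dots> \<le> real (card K) * ((real B)\<^sup>2 * ((1 + \<Lambda>) * U))"
        using K(1) VU \<Lambda>0 card_Diff1_le[of K u] by (intro mult_right_mono) auto
      finally have "(real (R * B))\<^sup>2 / V \<le> real (card K) * ((real B)\<^sup>2 * ((1 + \<Lambda>) * U))"
        using W_lower[OF uK, of n] unfolding Nu by (rule order_trans[rotated])
      then have "(real R)\<^sup>2 * (real B)\<^sup>2 \<le> (real (card K) * \<theta>) * (real B)\<^sup>2"
        using VU by (simp add: \<theta>_def pos_divide_le_eq power_mult_distrib mult_ac)
      then have "(real R)\<^sup>2 \<le> real (card K) * \<theta>"
        using B1 by (simp add: mult_le_cancel_right)
      moreover have "real R \<le> (real R)\<^sup>2"
        using R1 by (simp add: power2_eq_square)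
      ultimately show False
        using R by linarith
    qed
  qed
  obtain u where u: "u \<in> T"
    using T by blast
  have "\<forall>\<^sub>F n in sequentially. Suc (R ^ length us * m) \<le> N n (u, c)"
    using Tf(1)[OF u] unfolding always_sampled_def filterlim_at_top by blast
  then have "\<forall>\<^sub>F n in sequentially. False"
    using eventually_ge_at_top[of n2] by eventually_elim (use bound[OF _ u] in fastforce)
  then show False
    by simp
qed

end

subsection \<open>Almost sure convergence\<close>

context ranking_problem
begin

lemma eta_tendsto:
  assumes bal: "balanced p \<eta>0" and ph: "\<And>z. z \<in> K \<times> C \<Longrightarrow> (\<lambda>n. ph n z) \<longlonglongrightarrow> p z" and c: "c \<in> C" "k \<in> others c"
  shows "(\<lambda>n. eta F v \<pi> (ph n) k c) \<longlonglongrightarrow> \<eta>0"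
proof -
  have z: "(\<pi> c, c) \<in> K \<times> C" "(k, c) \<in> K \<times> C"
    using c best(1) by auto
  have p: "0 < p (\<pi> c, c)" "0 < p (k, c)"
    using bal z unfolding balanced_def by blast+
  have D: "0 < v (\<pi> c, c) / p (\<pi> c, c) + v (k, c) / p (k, c)"
    using p v_pos z by (intro add_pos_pos divide_pos_pos) auto
  have eta_p: "gap k c / (v (\<pi> c, c) / p (\<pi> c, c) + v (k, c) / p (k, c)) = \<eta>0"
  proof -
    have "eta F v \<pi> p k c = \<eta>0"
      using bal c unfolding balanced_def by blast
    then show ?thesis
      using p by (simp add: eta_def)
  qed
  have "(\<lambda>n. gap k c / (v (\<pi> c, c) / ph n (\<pi> c, c) + v (k, c) / ph n (k, c))) \<longlonglongrightarrow> \<eta>0"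
    unfolding eta_p[symmetric] using p D by (intro tendsto_divide tendsto_add tendsto_const ph z) auto
  moreover have "\<forall>\<^sub>F n in sequentially. gap k c / (v (\<pi> c, c) / ph n (\<pi> c, c) + v (k, c) / ph n (k, c)) = eta F v \<pi> (ph n) k c"
    using order_tendstoD(1)[OF ph[OF z(1)] p(1)] order_tendstoD(1)[OF ph[OF z(2)] p(2)]
    by eventually_elim (simp add: eta_def)
  ultimately show ?thesis
    by (simp only: tendsto_cong)
qed

lemma balance_tendsto:
  assumes bal: "balanced p \<eta>0" and ph: "\<And>z. z \<in> K \<times> C \<Longrightarrow> (\<lambda>n. ph n z) \<longlonglongrightarrow> p z" and c: "c \<in> C"
  shows "(\<lambda>n. (ph n (\<pi> c, c))\<^sup>2 / v (\<pi> c, c) - (\<Sum>k\<in>others c. (ph n (k, c))\<^sup>2 / v (k, c))) \<longlonglongrightarrow> 0"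
proof -
  have "(\<lambda>n. (ph n (\<pi> c, c))\<^sup>2 / v (\<pi> c, c) - (\<Sum>k\<in>others c. (ph n (k, c))\<^sup>2 / v (k, c))) \<longlonglongrightarrow>
      (p (\<pi> c, c))\<^sup>2 / v (\<pi> c, c) - (\<Sum>k\<in>others c. (p (k, c))\<^sup>2 / v (k, c))"
  proof -
    have "v z \<noteq> 0" if "z \<in> K \<times> C" for z
      using v_pos[OF that] by simp
    then show ?thesis
      using c best(1)[OF c]
      by (intro tendsto_diff tendsto_sum tendsto_divide tendsto_power tendsto_const ph) auto
  qed
  then show ?thesis
    using bal c by (simp add: balanced_def)
qed

end

lemma distr_of_distributed_lborel:
  assumes "distributed M lborel X f"
  shows "distr M borel X = density lborel f"
proof -
  have "distr M borel X = distr M lborel X"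
    by (intro distr_cong) simp_all
  then show ?thesis
    using distributed_distr_eq_density[OF assms] by simp
qed

theorem theorem6p9:
  fixes K :: "'k set"
    and C :: "(real ^ 'd) set"
    and F v \<mu>0 :: "'k \<times> (real ^ 'd) \<Rightarrow> real"
    and \<Sigma>0 :: "'k \<times> (real ^ 'd) \<Rightarrow> ennreal"
    and M :: "'w measure"
    and \<epsilon> :: "nat \<Rightarrow> 'k \<times> (real ^ 'd) \<Rightarrow> 'w \<Rightarrow> real"
    and N0 :: nat
    and X :: "nat \<Rightarrow> 'w \<Rightarrow> 'k \<times> (real ^ 'd)"
  defines "\<pi> \<equiv> best_alt F K"
    and "p_hat \<equiv> (\<lambda>\<omega> n. sample_frac (\<lambda>i. X i \<omega>) n)"
  assumes "finite K" and "card K \<ge> 2"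
    and "finite C" and "C \<noteq> {}"
    and unique_best: "\<forall>c\<in>C. \<exists>!k. is_arg_max (\<lambda>k. F (k, c)) (\<lambda>k. k \<in> K) k"
    and "\<forall>z\<in>K \<times> C. v z > 0"
    and "\<forall>z\<in>K \<times> C. \<Sigma>0 z > 0"
    and "prob_space M"
    and noise_normal: "\<forall>n. \<forall>z\<in>K \<times> C.
          distributed M lborel (\<epsilon> n z) (\<lambda>t. ennreal (normal_density 0 (sqrt (v z)) t))"
    and noise_indep:
          "prob_space.indep_vars M (\<lambda>_. borel) (\<lambda>(n, z). \<epsilon> n z) (UNIV \<times> (K \<times> C))"
    and nonanticipating: "\<forall>n. X n \<in> measurable (noise_history M \<epsilon> (K \<times> C) n) (count_space (K \<times> C))"
    and initial: "\<forall>\<omega>\<in>space M. \<forall>z\<in>K \<times> C. \<Sigma>0 z = \<infinity> \<longrightarrow> (\<exists>n<N0. X n \<omega> = z)"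
    and policy: "\<forall>\<omega>\<in>space M.
          gp_c_ocba_path K C \<mu>0 \<Sigma>0 v N0 (\<lambda>n. X n \<omega>) (\<lambda>n. F (X n \<omega>) + \<epsilon> n (X n \<omega>) \<omega>)"
  shows "(AE \<omega> in M.
            (\<forall>c\<in>C. (\<lambda>n. (p_hat \<omega> n (\<pi> c, c))\<^sup>2 / v (\<pi> c, c)
                        - (\<Sum>k\<in>K - {\<pi> c}. (p_hat \<omega> n (k, c))\<^sup>2 / v (k, c))) \<longlonglongrightarrow> 0) \<and>
            (\<forall>c\<in>C. \<forall>k\<in>K - {\<pi> c}. \<forall>k'\<in>K - {\<pi> c}. k \<noteq> k' \<longrightarrow>
               (\<lambda>n. eta F v \<pi> (p_hat \<omega> n) k c - eta F v \<pi> (p_hat \<omega> n) k' c) \<longlonglongrightarrow> 0) \<and>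
            (\<forall>c\<in>C. \<forall>c'\<in>C. c \<noteq> c' \<longrightarrow> (\<forall>k\<in>K - {\<pi> c}. \<forall>k'\<in>K - {\<pi> c'}.
               (\<lambda>n. eta F v \<pi> (p_hat \<omega> n) k c - eta F v \<pi> (p_hat \<omega> n) k' c') \<longlonglongrightarrow> 0)))
         \<and> (\<exists>p_star. optimal_allocation F v K C p_star)
         \<and> (\<forall>p_star. optimal_allocation F v K C p_star \<longrightarrow>
              (AE \<omega> in M. \<forall>z\<in>K \<times> C. (\<lambda>n. p_hat \<omega> n z) \<longlonglongrightarrow> p_star z))"
proof -
  interpret M: prob_space M
    by fact
  interpret P: ranking_problem K C F v
  proof
    show "\<exists>!k. is_arg_max (\<lambda>k. F (k, c)) (\<lambda>k. k \<in> K) k" if "c \<in> C" for c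
      using unique_best that by blast
    show "0 < v z" if "z \<in> K \<times> C" for z
      using \<open>\<forall>z\<in>K \<times> C. v z > 0\<close> that by blast
  qed fact+
  interpret A: adaptive_sampling M \<epsilon> "K \<times> C" X "\<lambda>z. density lborel (normal_density 0 (sqrt (v z)))"
  proof
    have "K \<noteq> {}"
      using \<open>card K \<ge> 2\<close> by auto
    then show "finite (K \<times> C)" "K \<times> C \<noteq> {}"
      using \<open>finite K\<close> \<open>finite C\<close> \<open>C \<noteq> {}\<close> by auto
    show "\<epsilon> n z \<in> borel_measurable M" if "z \<in> K \<times> C" for n z
    proof -
      have "distributed M lborel (\<epsilon> n z) (\<lambda>t. ennreal (normal_density 0 (sqrt (v z)) t))"
        using noise_normal that by blast
      from distributed_measurable[OF this] show ?thesis
        by simp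
    qed
    show "distr M borel (\<epsilon> n z) = density lborel (normal_density 0 (sqrt (v z)))" if "z \<in> K \<times> C" for n z
      using noise_normal that by (intro distr_of_distributed_lborel) blast
    show "M.indep_vars (\<lambda>_. borel) (\<lambda>(n, z). \<epsilon> n z) (UNIV \<times> (K \<times> C))"
      by (rule noise_indep)
    show "X n \<in> measurable (noise_history M \<epsilon> (K \<times> C) n) (count_space (K \<times> C))" for n
      using nonanticipating by blast
  qed
  \<comment> \<open>The target is deterministic, so one null set serves all the limits.\<close>
  obtain p \<eta>0 where bal: "P.balanced p \<eta>0"
    using P.exists_balanced by blast
  \<comment> \<open>The rank is arbitrary but fixed before the outcome; it decides which of several
    equally good alternatives gets the higher averages in a window.\<close>
  obtain r :: "'k \<times> (real ^ 'd) \<Rightarrow> nat" where r: "inj_on r (K \<times> C)"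
    using finite_imp_inj_to_nat_seg[of "K \<times> C"] \<open>finite K\<close> \<open>finite C\<close> by auto
  have "AE \<omega> in M.
    (\<forall>z\<in>K \<times> C. filterlim (\<lambda>n. num_samples (\<lambda>i. X i \<omega>) n z) at_top sequentially \<longrightarrow>
       (\<lambda>n. sample_mean (\<lambda>i. X i \<omega>) (\<lambda>i. \<epsilon> i (X i \<omega>) \<omega>) n z) \<longlonglongrightarrow> 0) \<and>
    (\<forall>(L :: nat) (h :: nat) (m0 :: nat). \<exists>m\<ge>m0. \<forall>z\<in>K \<times> C. \<forall>z'\<in>K \<times> C. r z < r z' \<longrightarrow>
       (\<forall>n n'. num_samples (\<lambda>i. X i \<omega>) n z \<in> {m..L * m} \<longrightarrow> num_samples (\<lambda>i. X i \<omega>) n' z' \<in> {m..L * m} \<longrightarrow>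
          h / sqrt (real m) \<le> sample_mean (\<lambda>i. X i \<omega>) (\<lambda>i. \<epsilon> i (X i \<omega>) \<omega>) n z
                          - sample_mean (\<lambda>i. X i \<omega>) (\<lambda>i. \<epsilon> i (X i \<omega>) \<omega>) n' z'))"
    by (rule A.AE_sampled_noise[where \<sigma> = "\<lambda>z. sqrt (v z)"]) (use P.v_pos in simp_all)
  then have lim: "AE \<omega> in M. \<forall>z\<in>K \<times> C. (\<lambda>n. p_hat \<omega> n z) \<longlonglongrightarrow> p z"
    using AE_space
  proof eventually_elim
    case (elim \<omega>)
    interpret O: ocba_path K C F v \<mu>0 \<Sigma>0 N0 "\<lambda>i. X i \<omega>" "\<lambda>i. \<epsilon> i (X i \<omega>) \<omega>"
    proof
      show "X n \<omega> \<in> K \<times> C" for n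
        by (rule A.X_in[OF elim(2)])
      show "\<exists>n<N0. X n \<omega> = z" if "z \<in> K \<times> C" "\<Sigma>0 z = \<infinity>" for z
        using bspec[OF bspec[OF initial elim(2)] that(1)] that(2) by simp
      show "gp_c_ocba_path K C \<mu>0 \<Sigma>0 v N0 (\<lambda>i. X i \<omega>) (\<lambda>n. F (X n \<omega>) + \<epsilon> n (X n \<omega>) \<omega>)"
        by (rule bspec[OF policy elim(2)])
      show "0 < \<Sigma>0 z" if "z \<in> K \<times> C" for z
        using \<open>\<forall>z\<in>K \<times> C. \<Sigma>0 z > 0\<close> that by blast
    qed
    have lln: "(\<lambda>n. sample_mean (\<lambda>i. X i \<omega>) (\<lambda>i. \<epsilon> i (X i \<omega>) \<omega>) n z) \<longlonglongrightarrow> 0"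
      if "z \<in> K \<times> C" "filterlim (\<lambda>n. num_samples (\<lambda>i. X i \<omega>) n z) at_top sequentially" for z
      using bspec[OF conjunct1[OF elim(1)] that(1)] that(2) by simp
    have inf: "filterlim (\<lambda>n. num_samples (\<lambda>i. X i \<omega>) n z) at_top sequentially" if "z \<in> K \<times> C" for z
    proof -
      have "z \<in> O.always_sampled"
      proof (rule O.always_sampled_all)
        show "inj_on r (K \<times> C)" "z \<in> K \<times> C"
          by (rule r, rule that)
        show "\<exists>m\<ge>m0. \<forall>z\<in>K \<times> C. \<forall>z'\<in>K \<times> C. r z < r z' \<longrightarrow>
            (\<forall>n n'. num_samples (\<lambda>i. X i \<omega>) n z \<in> {m..L * m} \<longrightarrow> num_samples (\<lambda>i. X i \<omega>) n' z' \<in> {m..L * m} \<longrightarrow>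
              h / sqrt (real m) \<le> sample_mean (\<lambda>i. X i \<omega>) (\<lambda>i. \<epsilon> i (X i \<omega>) \<omega>) n z
                          - sample_mean (\<lambda>i. X i \<omega>) (\<lambda>i. \<epsilon> i (X i \<omega>) \<omega>) n' z')" for L h m0 :: nat
          by (rule conjunct2[OF elim(1), THEN spec, THEN spec, THEN spec])
      qed (rule lln)
      then show ?thesis
        by (simp add: O.always_sampled_def)
    qed
    interpret consistent_path K C F v \<mu>0 \<Sigma>0 N0 "\<lambda>i. X i \<omega>" "\<lambda>i. \<epsilon> i (X i \<omega>) \<omega>" p \<eta>0
    proof
      fix z assume z: "z \<in> K \<times> C"
      show "filterlim (\<lambda>n. num_samples (\<lambda>i. X i \<omega>) n z) at_top sequentially"
        by (rule inf[OF z])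
      show "(\<lambda>n. post_mean \<mu>0 \<Sigma>0 v (\<lambda>i. X i \<omega>) (\<lambda>n. F (X n \<omega>) + \<epsilon> n (X n \<omega>) \<omega>) n z) \<longlonglongrightarrow> F z"
        by (rule O.mu_tendsto[OF z inf[OF z] lln[OF z inf[OF z]]])
    qed (rule bal)
    show ?case
      unfolding p_hat_def by (rule ballI) (rule sample_frac_tendsto)
  qed
  \<comment> \<open>Every \<open>eta\<close> tends to the same value \<open>\<eta>0\<close>, so the
    differences vanish within a context as well as across contexts.\<close>
  have "AE \<omega> in M.
            (\<forall>c\<in>C. (\<lambda>n. (p_hat \<omega> n (\<pi> c, c))\<^sup>2 / v (\<pi> c, c)
                        - (\<Sum>k\<in>K - {\<pi> c}. (p_hat \<omega> n (k, c))\<^sup>2 / v (k, c))) \<longlonglongrightarrow> 0) \<and>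
            (\<forall>c\<in>C. \<forall>k\<in>K - {\<pi> c}. (\<lambda>n. eta F v \<pi> (p_hat \<omega> n) k c) \<longlonglongrightarrow> \<eta>0)"
    using lim
  proof eventually_elim
    case (elim \<omega>)
    then have ph: "\<And>z. z \<in> K \<times> C \<Longrightarrow> (\<lambda>n. p_hat \<omega> n z) \<longlonglongrightarrow> p z"
      by blast
    show ?case
      unfolding \<pi>_def
    proof (intro conjI ballI)
      fix c assume c: "c \<in> C"
      show "(\<lambda>n. (p_hat \<omega> n (best_alt F K c, c))\<^sup>2 / v (best_alt F K c, c)
          - (\<Sum>k\<in>K - {best_alt F K c}. (p_hat \<omega> n (k, c))\<^sup>2 / v (k, c))) \<longlonglongrightarrow> 0"
        by (rule P.balance_tendsto[OF bal ph c])
      fix k assume k: "k \<in> K - {best_alt F K c}"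
      show "(\<lambda>n. eta F v (best_alt F K) (p_hat \<omega> n) k c) \<longlonglongrightarrow> \<eta>0"
        by (rule P.eta_tendsto[OF bal ph c k])
    qed
  qed
  then have "AE \<omega> in M.
            (\<forall>c\<in>C. (\<lambda>n. (p_hat \<omega> n (\<pi> c, c))\<^sup>2 / v (\<pi> c, c)
                        - (\<Sum>k\<in>K - {\<pi> c}. (p_hat \<omega> n (k, c))\<^sup>2 / v (k, c))) \<longlonglongrightarrow> 0) \<and>
            (\<forall>c\<in>C. \<forall>k\<in>K - {\<pi> c}. \<forall>k'\<in>K - {\<pi> c}. k \<noteq> k' \<longrightarrow>
               (\<lambda>n. eta F v \<pi> (p_hat \<omega> n) k c - eta F v \<pi> (p_hat \<omega> n) k' c) \<longlonglongrightarrow> 0) \<and>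
            (\<forall>c\<in>C. \<forall>c'\<in>C. c \<noteq> c' \<longrightarrow> (\<forall>k\<in>K - {\<pi> c}. \<forall>k'\<in>K - {\<pi> c'}.
               (\<lambda>n. eta F v \<pi> (p_hat \<omega> n) k c - eta F v \<pi> (p_hat \<omega> n) k' c') \<longlonglongrightarrow> 0))"
  proof eventually_elim
    case (elim \<omega>)
    have "(\<lambda>n. eta F v \<pi> (p_hat \<omega> n) k c - eta F v \<pi> (p_hat \<omega> n) k' c') \<longlonglongrightarrow> 0"
      if "c \<in> C" "c' \<in> C" "k \<in> K - {\<pi> c}" "k' \<in> K - {\<pi> c'}" for c c' k k'
    proof -
      have "(\<lambda>n. eta F v \<pi> (p_hat \<omega> n) k c) \<longlonglongrightarrow> \<eta>0" "(\<lambda>n. eta F v \<pi> (p_hat \<omega> n) k' c') \<longlonglongrightarrow> \<eta>0"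
        by (rule conjunct2[OF elim, THEN bspec, THEN bspec], fact, fact)+
      from tendsto_diff[OF this] show ?thesis
        by simp
    qed
    then show ?case
      by (intro conjI conjunct1[OF elim] ballI impI)
  qed
  moreover have "AE \<omega> in M. \<forall>z\<in>K \<times> C. (\<lambda>n. p_hat \<omega> n z) \<longlonglongrightarrow> p_star z"
    if "optimal_allocation F v K C p_star" for p_star
    using lim
  proof eventually_elim
    case (elim \<omega>)
    show ?case
    proof
      fix z assume z: "z \<in> K \<times> C"
      show "(\<lambda>n. p_hat \<omega> n z) \<longlonglongrightarrow> p_star z"
        unfolding P.balanced_optimal(2)[OF bal that z] using elim z by (rule bspec)
    qed
  qed
  ultimately show ?thesis
    using P.balanced_optimal(1)[OF bal] by blast
qed

end
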